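(* There is a randomized algorithm (ApproxXi) with the following guarantee. Given $q_0,q_1$ satisfying Assumption (A), an upper bound $\bar\zeta\geq\zeta^*$, and a failure probability $p>0$, with probability at least $1-p$ it outputs $\xi$ and $\hat\gamma$ such that $$\xi^*/4\leq\xi\leq\xi^*,\qquad\lambda_{\min}(A(\hat\gamma))\geq\xi,$$ and runs in time $$\tilde O\left(N\sqrt{\frac{\bar\zeta}{\xi^*}}\log\left(\frac{n}{p}\right)\log(\bar\zeta)\log\left(\frac{1}{\xi^*}\right)^3\right).$$
   Context: For symmetric $A_0,A_1\in\mathbb{R}^{n\times n}$, $b_0,b_1\in\mathbb{R}^n$, $c_0,c_1\in\mathbb{R}$, let $q_i(x)=x^\top A_ix+2b_i^\top x+c_i$ ($i=0,1$) and $A(\gamma)=A_0+\gamma A_1$. Assumption (A): $A_0$ and $A_1$ each have a negative eigenvalue, there exists $\gamma^*\geq 0$ with $A(\gamma^* )\succ 0$, and $\|A_0\|,\|A_1\|,\|b_0\|,\|b_1\|,|c_1|\leq 1$ (spectral norm for matrices, Euclidean norm for vectors). Under (A), $\Gamma:=\{\gamma\geq0: A(\gamma)\succeq 0\}$ is a nonempty compact interval $[\gamma_-,\gamma_+]$. $\xi^*:=\min\{1,\max_{\gamma\geq 0}\lambda_{\min}(A(\gamma))\}$, $\zeta^*:=\max\{1,\gamma_+\}$. $\lambda_{\min}$ is the smallest eigenvalue. $N$ is the number of nonzero entries of $A_0$ and $A_1$; $\tilde O$ hides $\log\log$ factors. *)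

theory Defs
  imports "HOL-Probability.Probability" "Jordan_Normal_Form.Char_Poly"
begin

no_notation Finite_Cartesian_Product.vec_nth (infixl \<open>$\<close> 90)
no_notation Inner_Product.real_inner_class.inner (infix \<open>\<bullet>\<close> 70)

section \<open>The problem data\<close>

definition vec_norm2 :: "real vec \<Rightarrow> real" where
  "vec_norm2 v = sqrt (v \<bullet> v)"

definition spectral_norm :: "real mat \<Rightarrow> real" where
  "spectral_norm A =
     Sup {vec_norm2 (A *\<^sub>v x) | x. x \<in> carrier_vec (dim_col A) \<and> vec_norm2 x = 1}"

definition pos_def :: "real mat \<Rightarrow> bool" where
  "pos_def A \<longleftrightarrow> A\<^sup>T = A \<and>
     (\<forall>x \<in> carrier_vec (dim_row A). x \<noteq> 0\<^sub>v (dim_row A) \<longrightarrow> x \<bullet> (A *\<^sub>v x) > 0)"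

definition pos_semidef :: "real mat \<Rightarrow> bool" where
  "pos_semidef A \<longleftrightarrow> A\<^sup>T = A \<and> (\<forall>x \<in> carrier_vec (dim_row A). x \<bullet> (A *\<^sub>v x) \<ge> 0)"

definition lambda_min :: "real mat \<Rightarrow> real" where
  "lambda_min A = Min {k. eigenvalue A k}"

definition pencil :: "real mat \<Rightarrow> real mat \<Rightarrow> real \<Rightarrow> real mat" where
  "pencil A0 A1 \<gamma> = A0 + \<gamma> \<cdot>\<^sub>m A1"

text \<open>The data describe \<open>q\<^sub>i(x) = x\<^sup>T A\<^sub>i x + 2 b\<^sub>i\<^sup>T x + c\<^sub>i\<close>; no bound is imposed on \<open>c\<^sub>0\<close>.\<close>

definition assumption_A ::
  "nat \<Rightarrow> real mat \<Rightarrow> real vec \<Rightarrow> real \<Rightarrow> real mat \<Rightarrow> real vec \<Rightarrow> real \<Rightarrow> bool" where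
  "assumption_A n A0 b0 c0 A1 b1 c1 \<longleftrightarrow>
     A0 \<in> carrier_mat n n \<and> A0\<^sup>T = A0 \<and> A1 \<in> carrier_mat n n \<and> A1\<^sup>T = A1 \<and>
     b0 \<in> carrier_vec n \<and> b1 \<in> carrier_vec n \<and>
     (\<exists>k<0. eigenvalue A0 k) \<and> (\<exists>k<0. eigenvalue A1 k) \<and>
     (\<exists>\<gamma>\<ge>0. pos_def (pencil A0 A1 \<gamma>)) \<and>
     spectral_norm A0 \<le> 1 \<and> spectral_norm A1 \<le> 1 \<and>
     vec_norm2 b0 \<le> 1 \<and> vec_norm2 b1 \<le> 1 \<and> \<bar>c1\<bar> \<le> 1"

definition Gamma_set :: "real mat \<Rightarrow> real mat \<Rightarrow> real set" where
  "Gamma_set A0 A1 = {\<gamma>. 0 \<le> \<gamma> \<and> pos_semidef (pencil A0 A1 \<gamma>)}"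

definition gamma_plus :: "real mat \<Rightarrow> real mat \<Rightarrow> real" where
  "gamma_plus A0 A1 = Sup (Gamma_set A0 A1)"

definition xi_star :: "real mat \<Rightarrow> real mat \<Rightarrow> real" where
  "xi_star A0 A1 = min 1 (SUP \<gamma>\<in>{0..}. lambda_min (pencil A0 A1 \<gamma>))"

definition zeta_star :: "real mat \<Rightarrow> real mat \<Rightarrow> real" where
  "zeta_star A0 A1 = max 1 (gamma_plus A0 A1)"

definition nonzeros :: "real mat \<Rightarrow> (nat \<times> nat) set" where
  "nonzeros A = {(i, j). i < dim_row A \<and> j < dim_col A \<and> A $$ (i, j) \<noteq> 0}"

section \<open>A randomized real RAM\<close>

text \<open>
  Algorithms are programs of a while language over a unit-cost real RAM.  Memory consists of
  named natural-number and real registers and of named, unbounded arrays of either kind.  Real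
  arithmetic is exact.  Naturals (used as addresses and counters) support only addition and
  truncated subtraction, there is no rounding from reals to naturals, and program constants are
  integers, so that neither real constants nor integer arithmetic can smuggle in extra power.
  Division by zero and square roots of negative numbers follow the totalised HOL functions.
\<close>

type_synonym vname = string

datatype nexp =
    NConst nat
  | NVar vname
  | NArr vname nexp
  | NAdd nexp nexp
  | NSub nexp nexp

datatype rexp =
    RConst int
  | RVar vname
  | RArr vname nexp
  | RAdd rexp rexp
  | RSub rexp rexp
  | RMul rexp rexp
  | RDiv rexp rexp
  | RSqrt rexp

datatype bexp =
    NLe nexp nexp
  | RLe rexp rexp
  | BNot bexp
  | BAnd bexp bexp

datatype com =
    Skip
  | NAssign vname nexp
  | RAssign vname rexp
  | NStore vname nexp nexp
  | RStore vname nexp rexp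
  | Draw vname
  | Seq com com
  | Cond bexp com com
  | While bexp com

record state =
  nvar :: "vname \<Rightarrow> nat"
  rvar :: "vname \<Rightarrow> real"
  narr :: "vname \<Rightarrow> nat \<Rightarrow> nat"
  rarr :: "vname \<Rightarrow> nat \<Rightarrow> real"
  drawn :: nat

primrec nval :: "nexp \<Rightarrow> state \<Rightarrow> nat" where
  "nval (NConst k) s = k"
| "nval (NVar x) s = nvar s x"
| "nval (NArr a e) s = narr s a (nval e s)"
| "nval (NAdd e f) s = nval e s + nval f s"
| "nval (NSub e f) s = nval e s - nval f s"

primrec rval :: "rexp \<Rightarrow> state \<Rightarrow> real" where
  "rval (RConst k) s = of_int k"
| "rval (RVar x) s = rvar s x"
| "rval (RArr a e) s = rarr s a (nval e s)"
| "rval (RAdd e f) s = rval e s + rval f s"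
| "rval (RSub e f) s = rval e s - rval f s"
| "rval (RMul e f) s = rval e s * rval f s"
| "rval (RDiv e f) s = rval e s / rval f s"
| "rval (RSqrt e) s = sqrt (rval e s)"

primrec bval :: "bexp \<Rightarrow> state \<Rightarrow> bool" where
  "bval (NLe e f) s \<longleftrightarrow> nval e s \<le> nval f s"
| "bval (RLe e f) s \<longleftrightarrow> rval e s \<le> rval f s"
| "bval (BNot b) s \<longleftrightarrow> \<not> bval b s"
| "bval (BAnd b c) s \<longleftrightarrow> bval b s \<and> bval c s"

text \<open>Evaluation costs one time unit per memory access, constant, operation and comparison.\<close>

primrec ncost :: "nexp \<Rightarrow> nat" where
  "ncost (NConst k) = 1"
| "ncost (NVar x) = 1"
| "ncost (NArr a e) = 1 + ncost e"
| "ncost (NAdd e f) = 1 + ncost e + ncost f"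
| "ncost (NSub e f) = 1 + ncost e + ncost f"

primrec rcost :: "rexp \<Rightarrow> nat" where
  "rcost (RConst k) = 1"
| "rcost (RVar x) = 1"
| "rcost (RArr a e) = 1 + ncost e"
| "rcost (RAdd e f) = 1 + rcost e + rcost f"
| "rcost (RSub e f) = 1 + rcost e + rcost f"
| "rcost (RMul e f) = 1 + rcost e + rcost f"
| "rcost (RDiv e f) = 1 + rcost e + rcost f"
| "rcost (RSqrt e) = 1 + rcost e"

primrec bcost :: "bexp \<Rightarrow> nat" where
  "bcost (NLe e f) = 1 + ncost e + ncost f"
| "bcost (RLe e f) = 1 + rcost e + rcost f"
| "bcost (BNot b) = 1 + bcost b"
| "bcost (BAnd b c) = 1 + bcost b + bcost c"

text \<open>
  \<open>exec \<omega> c s t s'\<close>: with random tape \<open>\<omega>\<close>, program \<open>c\<close> started in \<open>s\<close> halts in \<open>s'\<close>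
  after \<open>t\<close> time units.  Each \<open>Draw\<close> consumes the next unread tape cell.
\<close>

inductive exec :: "(nat \<Rightarrow> real) \<Rightarrow> com \<Rightarrow> state \<Rightarrow> nat \<Rightarrow> state \<Rightarrow> bool" for \<omega> where
  Skip: "exec \<omega> Skip s 1 s"
| NAssign: "exec \<omega> (NAssign x e) s (1 + ncost e) (s\<lparr>nvar := (nvar s)(x := nval e s)\<rparr>)"
| RAssign: "exec \<omega> (RAssign x e) s (1 + rcost e) (s\<lparr>rvar := (rvar s)(x := rval e s)\<rparr>)"
| NStore: "exec \<omega> (NStore a i e) s (1 + ncost i + ncost e)
    (s\<lparr>narr := (narr s)(a := (narr s a)(nval i s := nval e s))\<rparr>)"
| RStore: "exec \<omega> (RStore a i e) s (1 + ncost i + rcost e)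
    (s\<lparr>rarr := (rarr s)(a := (rarr s a)(nval i s := rval e s))\<rparr>)"
| Draw: "exec \<omega> (Draw x) s 1
    (s\<lparr>rvar := (rvar s)(x := \<omega> (drawn s)), drawn := Suc (drawn s)\<rparr>)"
| Seq: "exec \<omega> c s t s' \<Longrightarrow> exec \<omega> d s' u s'' \<Longrightarrow> exec \<omega> (Seq c d) s (t + u) s''"
| CondTrue: "bval b s \<Longrightarrow> exec \<omega> c s t s' \<Longrightarrow> exec \<omega> (Cond b c d) s (1 + bcost b + t) s'"
| CondFalse: "\<not> bval b s \<Longrightarrow> exec \<omega> d s t s' \<Longrightarrow> exec \<omega> (Cond b c d) s (1 + bcost b + t) s'"
| WhileFalse: "\<not> bval b s \<Longrightarrow> exec \<omega> (While b c) s (1 + bcost b) s"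
| WhileTrue: "bval b s \<Longrightarrow> exec \<omega> c s t s' \<Longrightarrow> exec \<omega> (While b c) s' u s'' \<Longrightarrow>
    exec \<omega> (While b c) s (1 + bcost b + t + u) s''"

inductive_cases exec_SkipE: "exec \<omega> Skip s t s'"
inductive_cases exec_NAssignE: "exec \<omega> (NAssign x e) s t s'"
inductive_cases exec_RAssignE: "exec \<omega> (RAssign x e) s t s'"
inductive_cases exec_NStoreE: "exec \<omega> (NStore a i e) s t s'"
inductive_cases exec_RStoreE: "exec \<omega> (RStore a i e) s t s'"
inductive_cases exec_DrawE: "exec \<omega> (Draw x) s t s'"
inductive_cases exec_SeqE: "exec \<omega> (Seq c d) s t s'"
inductive_cases exec_CondE: "exec \<omega> (Cond b c d) s t s'"
inductive_cases exec_WhileE: "exec \<omega> (While b c) s t s'"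

lemma exec_deterministic:
  "exec \<omega> c s t s' \<Longrightarrow> exec \<omega> c s u s'' \<Longrightarrow> u = t \<and> s'' = s'"
proof (induction arbitrary: u s'' rule: exec.induct)
  case (Skip s)
  then show ?case by (rule exec_SkipE) simp
next
  case (NAssign x e s)
  then show ?case by (rule exec_NAssignE) simp
next
  case (RAssign x e s)
  then show ?case by (rule exec_RAssignE) simp
next
  case (NStore a i e s)
  then show ?case by (rule exec_NStoreE) simp
next
  case (RStore a i e s)
  then show ?case by (rule exec_RStoreE) simp
next
  case (Draw x s)
  then show ?case by (rule exec_DrawE) simp
next
  case (Seq c s t s1 d u1 s2)
  from Seq.prems show ?case
  proof (rule exec_SeqE)
    fix t' s1' u'
    assume u: "u = t' + u'" and c: "exec \<omega> c s t' s1'" and d: "exec \<omega> d s1' u' s''"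
    from Seq.IH(1)[OF c] have "t' = t" "s1' = s1" by simp_all
    with Seq.IH(2) d u show ?thesis by simp
  qed
next
  case (CondTrue b s c t s1 d)
  from CondTrue.prems show ?case
  proof (rule exec_CondE)
    fix t' assume "u = Suc (bcost b + t')" and c: "exec \<omega> c s t' s''"
    then show ?thesis using CondTrue.IH[OF c] by simp
  qed (use CondTrue.hyps in simp)
next
  case (CondFalse b s d t s1 c)
  from CondFalse.prems show ?case
  proof (rule exec_CondE)
    fix t' assume "u = Suc (bcost b + t')" and d: "exec \<omega> d s t' s''"
    then show ?thesis using CondFalse.IH[OF d] by simp
  qed (use CondFalse.hyps in simp)
next
  case (WhileFalse b s c)
  from WhileFalse.prems show ?case
    by (rule exec_WhileE) (use WhileFalse.hyps in simp_all)
next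
  case (WhileTrue b s c t s1 u1 s2)
  from WhileTrue.prems show ?case
  proof (rule exec_WhileE)
    fix t' s1' u'
    assume u: "u = Suc (bcost b + t' + u')" and c: "exec \<omega> c s t' s1'"
      and w: "exec \<omega> (While b c) s1' u' s''"
    from WhileTrue.IH(1)[OF c] have "t' = t" "s1' = s1" by simp_all
    with WhileTrue.IH(2) w u show ?thesis by simp
  qed (use WhileTrue.hyps in simp)
qed

definition random_tape :: "(nat \<Rightarrow> real) measure" where
  "random_tape = (\<Pi>\<^sub>M i\<in>UNIV. uniform_measure lborel {0..1})"

section \<open>Input encoding and running-time bound\<close>

text \<open>
  Matrices are given in coordinate format: the positions of the nonzero entries are listed
  without repetition, in an arbitrary order.
\<close>

definition lists_nonzeros :: "(nat \<times> nat) list \<Rightarrow> real mat \<Rightarrow> bool" where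
  "lists_nonzeros xs A \<longleftrightarrow> distinct xs \<and> set xs = nonzeros A"

definition array_of :: "'a::zero list \<Rightarrow> nat \<Rightarrow> 'a" where
  "array_of xs k = (if k < length xs then xs ! k else 0)"

definition input_state ::
  "nat \<Rightarrow> real mat \<Rightarrow> real vec \<Rightarrow> real \<Rightarrow> real mat \<Rightarrow> real vec \<Rightarrow> real \<Rightarrow>
   (nat \<times> nat) list \<Rightarrow> (nat \<times> nat) list \<Rightarrow> real \<Rightarrow> real \<Rightarrow> state" where
  "input_state n A0 b0 c0 A1 b1 c1 xs0 xs1 \<zeta> p =
     \<lparr>nvar = (\<lambda>_. 0)(''n'' := n, ''nnz0'' := length xs0, ''nnz1'' := length xs1),
      rvar = (\<lambda>_. 0)(''c0'' := c0, ''c1'' := c1, ''zeta'' := \<zeta>, ''p'' := p),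
      narr = (\<lambda>_ _. 0)
        (''row0'' := array_of (map fst xs0), ''col0'' := array_of (map snd xs0),
         ''row1'' := array_of (map fst xs1), ''col1'' := array_of (map snd xs1)),
      rarr = (\<lambda>_ _. 0)
        (''val0'' := array_of (map (($$) A0) xs0), ''val1'' := array_of (map (($$) A1) xs1),
         ''b0'' := array_of (list_of_vec b0), ''b1'' := array_of (list_of_vec b1)),
      drawn = 0\<rparr>"

text \<open>
  Logarithms in a running-time bound are truncated below at 1: \<open>ln \<zeta>\<close> vanishes at \<open>\<zeta> = 1\<close> and
  \<open>ln (1/\<xi>\<^sup>*)\<close> can be arbitrarily close to 0, whereas every running time is positive.
\<close>

definition lg :: "real \<Rightarrow> real" where
  "lg x = max 1 (ln x)"

definition time_bound :: "nat \<Rightarrow> nat \<Rightarrow> real \<Rightarrow> real \<Rightarrow> real \<Rightarrow> real" where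
  "time_bound N n \<zeta> \<xi> p =
     real N * sqrt (\<zeta> / \<xi>) * lg (real n / p) * lg \<zeta> * lg (1 / \<xi>) ^ 3"

text \<open>The quantity of which a power is hidden by the soft-O notation.\<close>

definition loglog_factor :: "nat \<Rightarrow> real \<Rightarrow> real \<Rightarrow> real \<Rightarrow> real" where
  "loglog_factor n \<zeta> \<xi> p = lg (lg (real n / p)) * lg (lg \<zeta>) * lg (lg (1 / \<xi>))"

end

theory Submission
  imports Defs
begin

text \<open>
  Guess \<open>\<xi> = 1, 1/2, 1/4, \<dots>\<close> and, for each guess, bisect \<open>[0, \<zeta>]\<close> for a \<open>\<gamma>\<close> with
  \<open>\<lambda>\<^sub>m\<^sub>i\<^sub>n(A(\<gamma>)) \<ge> \<xi>\<close>.  At the midpoint \<open>\<gamma>\<close>, a random vector \<open>g\<close> is filtered by a polynomial in \<open>A(\<gamma>)\<close>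
  that is large below \<open>\<xi>\<close>.  If the result \<open>y\<close> has \<open>y\<^sup>T A(\<gamma>) y < (3/2) \<xi> y\<^sup>T y\<close>, the sign of
  \<open>y\<^sup>T A\<^sub>1 y\<close> tells on which side of \<open>\<gamma>\<close> every better multiplier lies; otherwise \<open>\<gamma>\<close> is accepted.
  Rejections are always justified, so the running time and the bound \<open>\<xi>\<^sup>*/4 \<le> \<xi>\<close> are deterministic.
  Acceptance can be wrong only if \<open>g\<close> is nearly orthogonal to an extremal eigenvector.  As \<open>g\<close> is
  fresh and the search state takes finitely many values, the failure probabilities just add up.

  The filter is the Chebyshev polynomial of the fourth kind
  \<open>W\<^sub>m(cos \<theta>) = sin ((m + 1/2) \<theta>) / sin (\<theta>/2)\<close>.  Since \<open>(1 - b) W\<^sub>m(b)\<^sup>2 \<le> 2\<close> on \<open>[-1, 1]\<close>, the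
  quadratic form of \<open>A(\<gamma>) - (3/2) \<xi>\<close> at the unwanted part of \<open>y\<close> is bounded by a multiple of
  \<open>(1 + \<gamma>) g\<^sup>T g\<close>, and the degree \<open>O(sqrt (\<zeta>/\<xi>) log (n/p))\<close> needs no further factor \<open>log (\<zeta>/\<xi>)\<close>.
\<close>

section \<open>Quadratic forms and extremal eigenvalues\<close>

text \<open>Neither the number of tests nor the filter degree can be fixed beforehand, since
  \<open>\<xi>s\<close> is unknown and the machine has neither logarithms nor rounding. Hence the
  failure probability of test \<open>k\<close> is a summable function of \<open>k\<close> alone, and
  the degree is found by running the scalar Chebyshev recurrence next to the vector one. The
  threshold is polynomial in \<open>k\<close> and enters the degree only through its logarithm; this
  is where the loglog factor comes from. Three levels separate the two kinds of error. The filter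
  sees eigenvalues below \<xi>, the test compares with 3\<xi>/2, and the bracket protects
  multipliers of value at least 2\<xi>. The gap from 2\<xi> to 3\<xi>/2 leaves a margin \<xi>/2
  around each of them. A refuted guess gives \<open>\<xi>s\<close> \<le> 2\<xi>, so the halved guess
  is still at least \<open>\<xi>s\<close>/4: this is the factor 4 of the theorem. No spectral
  decomposition is needed: one extremal eigenvector is split off, and an operator identity for the
  Chebyshev pair controls its whole complement.\<close>

definition dot :: "nat \<Rightarrow> (nat \<Rightarrow> real) \<Rightarrow> (nat \<Rightarrow> real) \<Rightarrow> real" where
  "dot n x y = (\<Sum>i<n. x i * y i)"

definition mv :: "nat \<Rightarrow> (nat \<Rightarrow> nat \<Rightarrow> real) \<Rightarrow> (nat \<Rightarrow> real) \<Rightarrow> nat \<Rightarrow> real" where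
  "mv n A x = (\<lambda>i. \<Sum>j<n. A i j * x j)"

lemma dot_commute: "dot n x y = dot n y x"
  by (simp add: dot_def mult.commute)

lemma dot_add_left: "dot n (\<lambda>i. x i + y i) z = dot n x z + dot n y z"
  by (simp add: dot_def algebra_simps sum.distrib)

lemma dot_diff_left: "dot n (\<lambda>i. x i - y i) z = dot n x z - dot n y z"
  by (simp add: dot_def algebra_simps sum_subtractf)

lemma dot_scale_left: "dot n (\<lambda>i. c * x i) z = c * dot n x z"
  by (simp add: dot_def sum_distrib_left mult.assoc)

lemma dot_add_right: "dot n z (\<lambda>i. x i + y i) = dot n z x + dot n z y"
  by (simp add: dot_def algebra_simps sum.distrib)

lemma dot_diff_right: "dot n z (\<lambda>i. x i - y i) = dot n z x - dot n z y"
  by (simp add: dot_def algebra_simps sum_subtractf)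

lemma dot_scale_right: "dot n z (\<lambda>i. c * x i) = c * dot n z x"
  by (simp add: dot_def sum_distrib_left mult.left_commute)

lemmas dot_linear = dot_add_left dot_diff_left dot_scale_left
  dot_add_right dot_diff_right dot_scale_right

lemma dot_cong:
  "(\<And>i. i < n \<Longrightarrow> x i = x' i) \<Longrightarrow> (\<And>i. i < n \<Longrightarrow> y i = y' i) \<Longrightarrow> dot n x y = dot n x' y'"
  by (simp add: dot_def)

lemma dot_self_nonneg: "dot n x x \<ge> 0"
  by (simp add: dot_def sum_nonneg)

lemma dot_self_eq_0_iff: "dot n x x = 0 \<longleftrightarrow> (\<forall>i<n. x i = 0)"
  by (auto simp: dot_def sum_nonneg_eq_0_iff)

lemma dot_Cauchy_Schwarz: "(dot n x y)\<^sup>2 \<le> dot n x x * dot n y y"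
  using Cauchy_Schwarz_ineq_sum[of x y "{..<n}"] by (simp add: dot_def power2_eq_square)

lemma mv_cong: "(\<And>i. i < n \<Longrightarrow> x i = x' i) \<Longrightarrow> mv n A x = mv n A x'"
  by (simp add: mv_def)

lemma mv_add: "mv n A (\<lambda>i. x i + y i) = (\<lambda>i. mv n A x i + mv n A y i)"
  by (simp add: mv_def algebra_simps sum.distrib)

lemma mv_diff: "mv n A (\<lambda>i. x i - y i) = (\<lambda>i. mv n A x i - mv n A y i)"
  by (simp add: mv_def algebra_simps sum_subtractf)

lemma mv_scale: "mv n A (\<lambda>i. c * x i) = (\<lambda>i. c * mv n A x i)"
  by (simp add: mv_def sum_distrib_left mult.left_commute)

definition symmetric_on :: "nat \<Rightarrow> (nat \<Rightarrow> nat \<Rightarrow> real) \<Rightarrow> bool" where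
  "symmetric_on n A \<longleftrightarrow> (\<forall>i<n. \<forall>j<n. A i j = A j i)"

lemma dot_mv_symmetric:
  assumes "symmetric_on n A"
  shows "dot n (mv n A x) y = dot n x (mv n A y)"
proof -
  have "dot n (mv n A x) y = (\<Sum>i<n. \<Sum>j<n. A i j * x j * y i)"
    by (simp add: dot_def mv_def sum_distrib_right)
  also have "\<dots> = (\<Sum>j<n. \<Sum>i<n. A i j * x j * y i)"
    by (rule sum.swap)
  also have "\<dots> = (\<Sum>j<n. \<Sum>i<n. A j i * x j * y i)"
    using assms by (intro sum.cong refl) (auto simp: symmetric_on_def)
  also have "\<dots> = dot n x (mv n A y)"
    by (simp add: dot_def mv_def sum_distrib_left mult_ac)
  finally show ?thesis .
qed

text \<open>Cauchy-Schwarz in every row; \<open>K\<close> is the squared Frobenius norm plus 1,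
  which makes it positive.\<close>

lemma mv_bounded: "\<exists>K>0. \<forall>x. dot n (mv n A x) (mv n A x) \<le> K * dot n x x"
proof (intro exI conjI allI)
  let ?S = "\<Sum>i<n. \<Sum>j<n. A i j * A i j"
  show "0 < 1 + ?S"
    by (simp add: sum_nonneg add_pos_nonneg)
  fix x
  have "dot n (mv n A x) (mv n A x) = (\<Sum>i<n. (dot n (A i) x)\<^sup>2)"
    by (simp add: dot_def mv_def power2_eq_square)
  also have "\<dots> \<le> (\<Sum>i<n. dot n (A i) (A i) * dot n x x)"
    by (intro sum_mono dot_Cauchy_Schwarz)
  also have "\<dots> = ?S * dot n x x"
    by (simp add: sum_distrib_right dot_def)
  also have "\<dots> \<le> (1 + ?S) * dot n x x"
    by (intro mult_right_mono dot_self_nonneg) simp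
  finally show "dot n (mv n A x) (mv n A x) \<le> (1 + ?S) * dot n x x" .
qed

lemma quadratic_form_bounded: "\<exists>K>0. \<forall>x. \<bar>dot n x (mv n A x)\<bar> \<le> K * dot n x x"
proof -
  obtain K where K: "K > 0" "\<And>x. dot n (mv n A x) (mv n A x) \<le> K * dot n x x"
    using mv_bounded by blast
  have "\<bar>dot n x (mv n A x)\<bar> \<le> sqrt K * dot n x x" for x
  proof -
    have "(dot n x (mv n A x))\<^sup>2 \<le> dot n x x * (K * dot n x x)"
      by (rule order_trans[OF dot_Cauchy_Schwarz mult_left_mono[OF K(2) dot_self_nonneg]])
    also have "\<dots> = (sqrt K * dot n x x)\<^sup>2"
      using K(1) by (simp add: power_mult_distrib) (simp add: power2_eq_square)
    finally show ?thesis
      using K(1) by (simp add: abs_le_square_iff[symmetric] abs_mult dot_self_nonneg)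
  qed
  then show ?thesis using K(1) by (intro exI[of _ "sqrt K"]) simp
qed

section \<open>From matrices to functions on indices\<close>

text \<open>The analysis runs on plain functions of indices: no carrier conditions arise, and the
  unbounded arrays of the machine are of the same type. Values at indices from \<open>n\<close> on
  are ignored by \<open>dot n\<close> and \<open>mv n\<close>.\<close>

definition mfun :: "real mat \<Rightarrow> nat \<Rightarrow> nat \<Rightarrow> real" where
  "mfun M i j = M $$ (i, j)"

lemma mult_mat_vec_index:
  assumes "M \<in> carrier_mat n n" "x \<in> carrier_vec n" "i < n"
  shows "(M *\<^sub>v x) $ i = mv n (mfun M) (vec_index x) i"
  using assms by (auto simp: mv_def mfun_def scalar_prod_def atLeast0LessThan)

lemma scalar_prod_eq_dot:
  assumes "x \<in> carrier_vec n" "y \<in> carrier_vec n"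
  shows "x \<bullet> y = dot n (vec_index x) (vec_index y)"
  using assms by (auto simp: dot_def scalar_prod_def atLeast0LessThan)

lemma quadratic_form_eq_dot:
  assumes "M \<in> carrier_mat n n" "x \<in> carrier_vec n"
  shows "x \<bullet> (M *\<^sub>v x) = dot n (vec_index x) (mv n (mfun M) (vec_index x))"
proof -
  have "M *\<^sub>v x \<in> carrier_vec n" using assms by auto
  then show ?thesis
    using assms by (simp add: scalar_prod_eq_dot)
      (auto intro!: dot_cong simp: mult_mat_vec_index simp del: index_mult_mat_vec)
qed

lemma symmetric_on_mfun:
  assumes "M \<in> carrier_mat n n" "M\<^sup>T = M"
  shows "symmetric_on n (mfun M)"
  unfolding symmetric_on_def mfun_def
  by (metis assms carrier_matD index_transpose_mat(1))

lemma eigenvalue_iff_mv: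
  assumes M: "M \<in> carrier_mat n n"
  shows "eigenvalue M k \<longleftrightarrow> (\<exists>e. dot n e e = 1 \<and> (\<forall>i<n. mv n (mfun M) e i = k * e i))"
proof
  assume "eigenvalue M k"
  then obtain v where v: "v \<in> carrier_vec n" "v \<noteq> 0\<^sub>v n" "M *\<^sub>v v = k \<cdot>\<^sub>v v"
    using M by (auto simp: eigenvalue_def eigenvector_def)
  let ?d = "dot n (vec_index v) (vec_index v)"
  have "\<exists>i<n. v $ i \<noteq> 0"
    using v by (auto simp: vec_eq_iff)
  then have "?d \<noteq> 0" by (auto simp: dot_self_eq_0_iff)
  then have d: "?d > 0" using dot_self_nonneg[of n "vec_index v"] by linarith
  have mv: "mv n (mfun M) (vec_index v) i = k * v $ i" if "i < n" for i
    using mult_mat_vec_index[OF M v(1) that] v that by simp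
  let ?e = "\<lambda>i. (1 / sqrt ?d) * v $ i"
  have "dot n ?e ?e = 1"
    unfolding dot_linear using d by (simp add: real_sqrt_mult_self field_simps)
  moreover have "\<forall>i<n. mv n (mfun M) ?e i = k * ?e i"
    unfolding mv_scale using mv by simp
  ultimately show "\<exists>e. dot n e e = 1 \<and> (\<forall>i<n. mv n (mfun M) e i = k * e i)" by blast
next
  assume "\<exists>e. dot n e e = 1 \<and> (\<forall>i<n. mv n (mfun M) e i = k * e i)"
  then obtain e where e: "dot n e e = 1" "\<And>i. i < n \<Longrightarrow> mv n (mfun M) e i = k * e i" by blast
  let ?v = "vec n e"
  have "mv n (mfun M) (vec_index ?v) = mv n (mfun M) e"
    by (rule mv_cong) simp
  then have "M *\<^sub>v ?v = k \<cdot>\<^sub>v ?v"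
    using M e(2) by (intro eq_vecI)
      (auto simp: mult_mat_vec_index[OF M] simp del: index_mult_mat_vec)
  moreover have "?v \<noteq> 0\<^sub>v n"
  proof
    assume "?v = 0\<^sub>v n"
    then have "\<forall>i<n. e i = 0" by (metis index_vec index_zero_vec(1))
    then show False using e(1) by (simp add: dot_def)
  qed
  ultimately show "eigenvalue M k"
    using M by (auto simp: eigenvalue_def eigenvector_def intro!: exI[of _ ?v])
qed

lemma eigenvalue_quadratic_form:
  assumes "dot n e e = 1" "\<forall>i<n. mv n A e i = k * e i"
  shows "dot n e (mv n A e) = k"
proof -
  have "dot n e (mv n A e) = dot n e (\<lambda>i. k * e i)"
    using assms(2) by (intro dot_cong) auto
  then show ?thesis using assms(1) by (simp add: dot_linear)
qed

text \<open>If the infimum \<open>\<mu>\<close> of the Rayleigh quotient were not an eigenvalue, then \<open>M - \<mu>\<close> would be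
  positive semidefinite and invertible, hence bounded below by a positive constant.\<close>

lemma minimal_eigenvalue_exists:
  assumes M: "M \<in> carrier_mat n n" and sym: "M\<^sup>T = M" and n: "n > 0"
  shows "\<exists>\<mu>. eigenvalue M \<mu> \<and> (\<forall>x. \<mu> * dot n x x \<le> dot n x (mv n (mfun M) x))"
proof -
  define R where "R = {dot n x (mv n (mfun M) x) | x. dot n x x = 1}"
  define \<mu> where "\<mu> = Inf R"
  let ?u = "\<lambda>i::nat. if i = 0 then 1 else 0 :: real"
  have "dot n ?u ?u = (\<Sum>i<n. if i = 0 then 1 else 0)"
    unfolding dot_def by (intro sum.cong) auto
  then have "dot n ?u ?u = 1" using n by (simp add: sum.delta)
  then have Rne: "R \<noteq> {}" unfolding R_def by blast
  obtain K where K: "\<And>x. \<bar>dot n x (mv n (mfun M) x)\<bar> \<le> K * dot n x x"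
    using quadratic_form_bounded by blast
  have bdd: "bdd_below R"
  proof (rule bdd_belowI)
    fix r assume "r \<in> R"
    then obtain x where "r = dot n x (mv n (mfun M) x)" "dot n x x = 1" by (auto simp: R_def)
    then show "- K \<le> r" using K[of x] by simp
  qed
  have low: "\<mu> * dot n x x \<le> dot n x (mv n (mfun M) x)" for x
  proof (cases "dot n x x = 0")
    case True
    then show ?thesis using K[of x] by simp
  next
    case False
    then have d: "dot n x x > 0" using dot_self_nonneg[of n x] by linarith
    let ?e = "\<lambda>i. (1 / sqrt (dot n x x)) * x i"
    have "dot n ?e ?e = 1"
      unfolding dot_linear using d by (simp add: field_simps)
    then have "dot n ?e (mv n (mfun M) ?e) \<in> R" by (auto simp: R_def)
    then have "\<mu> \<le> dot n ?e (mv n (mfun M) ?e)"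
      unfolding \<mu>_def by (rule cInf_lower[OF _ bdd])
    also have "\<dots> = dot n x (mv n (mfun M) x) / dot n x x"
      unfolding mv_scale dot_linear using d by (simp add: field_simps)
    finally show ?thesis using d by (simp add: field_simps)
  qed
  have "eigenvalue M \<mu>"
  proof (rule ccontr)
    assume neg: "\<not> eigenvalue M \<mu>"
    define C where "C = char_matrix M \<mu>"
    have C: "C \<in> carrier_mat n n" using M by (simp add: C_def char_matrix_def)
    have "det C \<noteq> 0" using neg eigenvalue_det[OF M] by (simp add: C_def)
    from det_non_zero_imp_unit[OF C this, of "()"]
    obtain S where S: "S \<in> carrier_mat n n" "S * C = 1\<^sub>m n"
      by (auto simp: Units_def ring_mat_def)
    have mvC: "mv n (mfun C) x i = mv n (mfun M) x i - \<mu> * x i" if "i < n" for x i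
    proof -
      have "mv n (mfun C) x i = (\<Sum>j<n. mfun M i j * x j - (if j = i then \<mu> * x j else 0))"
        unfolding mv_def using M that
        by (intro sum.cong) (auto simp: C_def char_matrix_def mfun_def algebra_simps)
      then show ?thesis using that by (simp add: sum_subtractf mv_def)
    qed
    have symC: "symmetric_on n (mfun C)"
      using symmetric_on_mfun[OF M sym] M
      by (auto simp: symmetric_on_def C_def char_matrix_def mfun_def)
    have qC: "dot n x (mv n (mfun C) x) = dot n x (mv n (mfun M) x) - \<mu> * dot n x x" for x
      by (subst dot_cong[OF refl mvC], assumption) (simp add: dot_linear)
    have inv: "mv n (mfun S) (mv n (mfun C) x) i = x i" if "i < n" for x i
    proof -
      have "S *\<^sub>v (C *\<^sub>v vec n x) = (S * C) *\<^sub>v vec n x"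
        using S C by (intro assoc_mult_mat_vec[symmetric]) auto
      then have "S *\<^sub>v (C *\<^sub>v vec n x) = vec n x" using S by simp
      then have "(S *\<^sub>v (C *\<^sub>v vec n x)) $ i = x i" using that by simp
      moreover have "(S *\<^sub>v (C *\<^sub>v vec n x)) $ i = mv n (mfun S) (vec_index (C *\<^sub>v vec n x)) i"
        using C S that by (intro mult_mat_vec_index) auto
      moreover have "mv n (mfun S) (vec_index (C *\<^sub>v vec n x)) = mv n (mfun S) (mv n (mfun C) x)"
      proof (rule mv_cong)
        fix j assume "j < n"
        then have "(C *\<^sub>v vec n x) $ j = mv n (mfun C) (vec_index (vec n x)) j"
          using C by (intro mult_mat_vec_index) auto
        also have "mv n (mfun C) (vec_index (vec n x)) = mv n (mfun C) x"
          by (rule mv_cong) simp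
        finally show "(C *\<^sub>v vec n x) $ j = mv n (mfun C) x j" .
      qed
      ultimately show ?thesis by simp
    qed
    obtain K1 where K1: "K1 > 0" "\<And>x. dot n (mv n (mfun S) x) (mv n (mfun S) x) \<le> K1 * dot n x x"
      using mv_bounded by blast
    obtain K2 where K2: "K2 > 0" "\<And>x. \<bar>dot n x (mv n (mfun C) x)\<bar> \<le> K2 * dot n x x"
      using quadratic_form_bounded by blast
    have coercive: "dot n x x \<le> (K1 * K2) * dot n x (mv n (mfun C) x)" for x
    proof -
      let ?y = "mv n (mfun C) x"
      \<comment> \<open>A gradient step of length \<open>1 / K2\<close>: positive semidefiniteness
        at \<open>?z\<close> bounds the squared norm of \<open>?y\<close> by \<open>K2\<close> times
        the form at \<open>x\<close>. Since \<open>S\<close> recovers \<open>x\<close> from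
        \<open>?y\<close>, coercivity follows.\<close>
      let ?z = "\<lambda>i. x i - (1 / K2) * ?y i"
      have "0 \<le> dot n ?z (mv n (mfun C) ?z)"
        using low[of ?z] by (simp only: qC diff_ge_0_iff_ge)
      also have "\<dots> = dot n x ?y - 2 / K2 * dot n ?y ?y + (1 / K2)\<^sup>2 * dot n ?y (mv n (mfun C) ?y)"
        unfolding mv_diff mv_scale dot_linear
        using dot_mv_symmetric[OF symC, of x ?y]
        by (simp add: algebra_simps power2_eq_square)
      also have "\<dots> \<le> dot n x ?y - 2 / K2 * dot n ?y ?y + (1 / K2)\<^sup>2 * (K2 * dot n ?y ?y)"
        using K2(2)[of ?y] by (intro add_left_mono mult_left_mono) auto
      also have "\<dots> = dot n x ?y - dot n ?y ?y / K2"
        using K2(1) by (simp add: field_simps power2_eq_square)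
      finally have "dot n ?y ?y \<le> K2 * dot n x ?y"
        using K2(1) by (simp add: field_simps)
      moreover have "dot n x x = dot n (mv n (mfun S) ?y) (mv n (mfun S) ?y)"
        by (intro dot_cong) (simp_all add: inv)
      ultimately show ?thesis
        using K1(2)[of ?y] K1(1) by (smt (verit) mult.assoc mult_left_mono)
    qed
    have "\<mu> + 1 / (K1 * K2) \<le> Inf R"
    proof (rule cInf_greatest[OF Rne])
      fix r assume "r \<in> R"
      then obtain x where x: "r = dot n x (mv n (mfun M) x)" "dot n x x = 1" by (auto simp: R_def)
      have "1 \<le> (K1 * K2) * (r - \<mu>)" using coercive[of x] x by (simp add: qC)
      moreover have "K1 * K2 > 0" using K1(1) K2(1) by simp
      ultimately have "1 / (K1 * K2) \<le> r - \<mu>"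
        by (simp add: pos_divide_le_eq mult.commute)
      then show "\<mu> + 1 / (K1 * K2) \<le> r" by simp
    qed
    moreover have "1 / (K1 * K2) > 0" using K1(1) K2(1) by simp
    ultimately show False unfolding \<mu>_def by simp
  qed
  with low show ?thesis by blast
qed

text \<open>An eigenvalue is a value of the Rayleigh quotient, hence at least \<mu>, and \<mu> is
  itself an eigenvalue. \<open>Min\<close> needs a finite set, which the roots of the characteristic
  polynomial provide.\<close>

lemma lambda_min_properties:
  assumes M: "M \<in> carrier_mat n n" and sym: "M\<^sup>T = M" and n: "n > 0"
  shows "eigenvalue M (lambda_min M)"
    and "lambda_min M * dot n x x \<le> dot n x (mv n (mfun M) x)"
proof -
  obtain \<mu> where \<mu>: "eigenvalue M \<mu>" "\<And>x. \<mu> * dot n x x \<le> dot n x (mv n (mfun M) x)"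
    using minimal_eigenvalue_exists[OF assms] by blast
  have "char_poly M \<noteq> 0" using degree_monic_char_poly[OF M] n by auto
  then have fin: "finite {k. eigenvalue M k}"
    unfolding eigenvalue_root_char_poly[OF M] by (rule poly_roots_finite)
  have "lambda_min M = \<mu>"
    unfolding lambda_min_def
  proof (rule Min_eqI[OF fin])
    fix k assume "k \<in> {k. eigenvalue M k}"
    then obtain e where "dot n e e = 1" "\<forall>i<n. mv n (mfun M) e i = k * e i"
      using eigenvalue_iff_mv[OF M] by auto
    then show "\<mu> \<le> k" using \<mu>(2)[of e] eigenvalue_quadratic_form[of n e "mfun M" k] by simp
  qed (use \<mu> in simp)
  with \<mu> show "eigenvalue M (lambda_min M)"
    "lambda_min M * dot n x x \<le> dot n x (mv n (mfun M) x)" by simp_all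
qed

text \<open>Cauchy-Schwarz applied to \<open>x\<close> and its image, after normalising
  \<open>x\<close>. The set under \<open>Sup\<close> must first be shown bounded, as otherwise its
  \<open>Sup\<close> would bound nothing.\<close>

lemma spectral_norm_quadratic_form:
  assumes M: "M \<in> carrier_mat n n" and norm: "spectral_norm M \<le> 1"
  shows "\<bar>dot n x (mv n (mfun M) x)\<bar> \<le> dot n x x"
proof (cases "dot n x x = 0")
  case True
  then show ?thesis using quadratic_form_bounded[of n "mfun M"] by (metis mult_zero_right)
next
  case False
  then have d: "dot n x x > 0" using dot_self_nonneg[of n x] by linarith
  let ?e = "\<lambda>i. (1 / sqrt (dot n x x)) * x i"
  let ?S = "{vec_norm2 (M *\<^sub>v x) | x. x \<in> carrier_vec (dim_col M) \<and> vec_norm2 x = 1}"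
  have norm2: "vec_norm2 y = sqrt (dot n (vec_index y) (vec_index y))" if "y \<in> carrier_vec n" for y
    using that by (simp add: vec_norm2_def scalar_prod_eq_dot)
  have normM: "vec_norm2 (M *\<^sub>v y)
      = sqrt (dot n (mv n (mfun M) (vec_index y)) (mv n (mfun M) (vec_index y)))"
    if "y \<in> carrier_vec n" for y
    using M that by (subst norm2)
      (auto intro!: dot_cong simp: mult_mat_vec_index simp del: index_mult_mat_vec)
  obtain K where K: "K > 0" "\<And>x. dot n (mv n (mfun M) x) (mv n (mfun M) x) \<le> K * dot n x x"
    using mv_bounded by blast
  have bdd: "bdd_above ?S"
  proof (rule bdd_aboveI)
    fix r assume "r \<in> ?S"
    then obtain y where y: "r = vec_norm2 (M *\<^sub>v y)" "y \<in> carrier_vec n" "vec_norm2 y = 1"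
      using M by auto
    then have "dot n (vec_index y) (vec_index y) = 1" by (simp add: norm2)
    then show "r \<le> sqrt K"
      using K(2)[of "vec_index y"] y by (simp add: normM)
  qed
  have e: "dot n ?e ?e = 1"
    unfolding dot_linear using d by (simp add: field_simps)
  have ve: "dot n (vec_index (vec n ?e)) (vec_index (vec n ?e)) = dot n ?e ?e"
    by (intro dot_cong) auto
  have "vec_norm2 (vec n ?e) = 1" by (simp only: norm2[OF vec_carrier] ve e real_sqrt_one)
  then have "vec_norm2 (M *\<^sub>v vec n ?e) \<in> ?S" using M by (intro CollectI exI[of _ "vec n ?e"]) simp
  from cSup_upper[OF this bdd] norm
  have "vec_norm2 (M *\<^sub>v vec n ?e) \<le> 1" by (simp add: spectral_norm_def)
  moreover have "mv n (mfun M) (vec_index (vec n ?e)) = mv n (mfun M) ?e"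
    by (rule mv_cong) simp
  ultimately have le1: "dot n (mv n (mfun M) ?e) (mv n (mfun M) ?e) \<le> 1"
    by (simp only: normM[OF vec_carrier]) simp
  have "(dot n ?e (mv n (mfun M) ?e))\<^sup>2 \<le> 1"
    using dot_Cauchy_Schwarz[of n ?e "mv n (mfun M) ?e"] le1 by (simp only: e mult_1)
  then have "\<bar>dot n ?e (mv n (mfun M) ?e)\<bar> \<le> 1"
    by (simp add: abs_square_le_1)
  moreover have "dot n ?e (mv n (mfun M) ?e) = dot n x (mv n (mfun M) x) / dot n x x"
    unfolding mv_scale dot_linear using d by (simp add: field_simps)
  ultimately show ?thesis using d by (simp only: abs_divide) (simp add: divide_le_eq)
qed

section \<open>Chebyshev iteration\<close>

text \<open>The components are the polynomials W and V of third-and-fourth-kind type in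
  \<open>B\<close>, applied to \<open>g\<close>. The addition formulas for sine and cosine express
  the next pair through the single product of \<open>B\<close> with \<open>w + v\<close>, so a step
  costs one multiplication by \<open>B\<close>.\<close>

fun cheb :: "nat \<Rightarrow> (nat \<Rightarrow> nat \<Rightarrow> real) \<Rightarrow> (nat \<Rightarrow> real) \<Rightarrow> nat \<Rightarrow> (nat \<Rightarrow> real) \<times> (nat \<Rightarrow> real)" where
  "cheb n B g 0 = (g, g)"
| "cheb n B g (Suc m) =
    (let (w, v) = cheb n B g m; b = mv n B (\<lambda>i. w i + v i)
     in (\<lambda>i. b i + v i, \<lambda>i. b i - w i))"

text \<open>The recurrence of \<open>cheb\<close> with a number for \<open>B\<close>: the factors by
  which an eigenvector is multiplied. The program runs it too, to know when the filter is strong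
  enough.\<close>

fun cheb_scalar :: "real \<Rightarrow> nat \<Rightarrow> real \<times> real" where
  "cheb_scalar \<beta> 0 = (1, 1)"
| "cheb_scalar \<beta> (Suc m) =
    (let (w, v) = cheb_scalar \<beta> m; b = \<beta> * (w + v) in (b + v, b - w))"

lemma cheb_add:
  "cheb n B (\<lambda>i. g i + h i) m =
    (\<lambda>i. fst (cheb n B g m) i + fst (cheb n B h m) i, \<lambda>i. snd (cheb n B g m) i + snd (cheb n B h m) i)"
proof (induction m)
  case (Suc m)
  have "(\<lambda>i. fst (cheb n B g m) i + fst (cheb n B h m) i +
             (snd (cheb n B g m) i + snd (cheb n B h m) i)) =
        (\<lambda>i. (fst (cheb n B g m) i + snd (cheb n B g m) i) +
             (fst (cheb n B h m) i + snd (cheb n B h m) i))"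
    by (simp add: algebra_simps)
  then show ?case using Suc by (simp add: Let_def case_prod_beta mv_add) (simp add: algebra_simps)
qed simp

lemma cheb_eigenvector:
  assumes "\<forall>i<n. mv n B e i = \<beta> * e i" "i < n"
  shows "fst (cheb n B (\<lambda>i. a * e i) m) i = a * fst (cheb_scalar \<beta> m) * e i \<and>
         snd (cheb n B (\<lambda>i. a * e i) m) i = a * snd (cheb_scalar \<beta> m) * e i"
  using assms(2)
proof (induction m arbitrary: i)
  case (Suc m)
  let ?w = "fst (cheb n B (\<lambda>i. a * e i) m)" and ?v = "snd (cheb n B (\<lambda>i. a * e i) m)"
  let ?W = "fst (cheb_scalar \<beta> m)" and ?V = "snd (cheb_scalar \<beta> m)"
  have "mv n B (\<lambda>j. ?w j + ?v j) = mv n B (\<lambda>j. (a * (?W + ?V)) * e j)"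
    using Suc.IH by (intro mv_cong) (simp add: algebra_simps)
  also have "\<dots> = (\<lambda>j. (a * (?W + ?V)) * mv n B e j)" by (rule mv_scale)
  finally have "mv n B (\<lambda>j. ?w j + ?v j) i = (a * (?W + ?V)) * (\<beta> * e i)"
    using assms(1) Suc.prems by simp
  then show ?case using Suc.IH[OF Suc.prems]
    by (simp add: Let_def case_prod_beta algebra_simps)
qed simp

lemma cheb_orthogonal:
  assumes sym: "symmetric_on n B" and e: "\<forall>i<n. mv n B e i = \<beta> * e i" and "dot n h e = 0"
  shows "dot n (fst (cheb n B h m)) e = 0 \<and> dot n (snd (cheb n B h m)) e = 0"
proof (induction m)
  case (Suc m)
  have "dot n (mv n B x) e = \<beta> * dot n x e" for x
  proof -
    have "dot n (mv n B x) e = dot n x (\<lambda>i. \<beta> * e i)"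
      unfolding dot_mv_symmetric[OF sym] using e by (intro dot_cong) auto
    then show ?thesis by (simp add: dot_linear)
  qed
  then show ?case using Suc by (simp add: Let_def case_prod_beta dot_linear)
qed (simp add: assms)

text \<open>The operator form of \<open>(1 - cos \<theta>) W\<^sub>m\<^sup>2 + (1 + cos \<theta>) V\<^sub>m\<^sup>2 = 2\<close> for the Chebyshev polynomials
  \<open>W\<^sub>m = sin ((m + 1/2) \<theta>) / sin (\<theta>/2)\<close> and \<open>V\<^sub>m = cos ((m + 1/2) \<theta>) / cos (\<theta>/2)\<close>.\<close>

lemma cheb_invariant:
  assumes sym: "symmetric_on n B"
  shows "(let (w, v) = cheb n B h m in
      dot n w w - dot n w (mv n B w) + dot n v v + dot n v (mv n B v)) = 2 * dot n h h"
proof (induction m)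
  case (Suc m)
  obtain w v where wv: "cheb n B h m = (w, v)" by fastforce
  define b where "b = mv n B (\<lambda>i. w i + v i)"
  have b: "mv n B w = (\<lambda>i. b i - mv n B v i)"
    unfolding b_def by (simp add: mv_add)
  have wBv: "dot n (mv n B w) v = dot n w (mv n B v)" "dot n w (mv n B b) = dot n (mv n B w) b"
    "dot n v (mv n B b) = dot n (mv n B v) b"
    by (simp_all add: dot_mv_symmetric[OF sym])
  have vb: "dot n b v = dot n w (mv n B v) + dot n v (mv n B v)"
    unfolding b_def mv_add dot_linear using wBv(1) by (simp add: dot_commute)
  have wb: "dot n b w = dot n w (mv n B w) + dot n w (mv n B v)"
    unfolding b_def mv_add dot_linear using wBv(1) by (simp add: dot_commute)
  have bb: "dot n (mv n B w) b + dot n (mv n B v) b = dot n b b"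
    by (simp add: b dot_linear)
  have "dot n (\<lambda>i. b i + v i) (\<lambda>i. b i + v i) - dot n (\<lambda>i. b i + v i) (mv n B (\<lambda>i. b i + v i))
      + dot n (\<lambda>i. b i - w i) (\<lambda>i. b i - w i) + dot n (\<lambda>i. b i - w i) (mv n B (\<lambda>i. b i - w i))
      = dot n w w - dot n w (mv n B w) + dot n v v + dot n v (mv n B v)"
    unfolding mv_add mv_diff dot_linear
    using vb wb bb wBv dot_commute[of n b "mv n B v"] dot_commute[of n b "mv n B w"]
      dot_commute[of n b v] dot_commute[of n b w]
    by linarith
  then show ?case using Suc by (simp add: wv Let_def b_def[symmetric])
qed simp

text \<open>The program does not know the eigenvalue \<beta>, only a lower bound for it.
  Monotonicity beyond 1 transfers the growth measured at that bound to the true \<beta>.\<close>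

lemma cheb_scalar_mono:
  assumes "1 \<le> \<beta>" "\<beta> \<le> \<beta>'"
  shows "1 \<le> fst (cheb_scalar \<beta> m) \<and> 1 \<le> snd (cheb_scalar \<beta> m) \<and>
    fst (cheb_scalar \<beta> m) \<le> fst (cheb_scalar \<beta>' m) \<and> snd (cheb_scalar \<beta> m) \<le> snd (cheb_scalar \<beta>' m)"
proof (induction m)
  case (Suc m)
  obtain w v w' v' where c: "cheb_scalar \<beta> m = (w, v)" "cheb_scalar \<beta>' m = (w', v')" by fastforce
  with Suc have h: "1 \<le> w" "1 \<le> v" "w \<le> w'" "v \<le> v'" by simp_all
  have a: "\<beta> * v \<le> \<beta>' * v'" "\<beta> * w \<le> \<beta>' * w'" "(\<beta> - 1) * w \<le> (\<beta>' - 1) * w'"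
    using h assms by (auto intro!: mult_mono)
  have b: "1 * 1 \<le> \<beta> * v" "1 * 1 \<le> \<beta> * w" "1 * w \<le> \<beta> * w"
    using h assms mult_mono[of 1 \<beta> 1 v] mult_mono[of 1 \<beta> 1 w] mult_right_mono[of 1 \<beta> w]
    by simp_all
  have "1 \<le> \<beta> * (w + v) + v \<and> 1 \<le> \<beta> * (w + v) - w \<and>
      \<beta> * (w + v) + v \<le> \<beta>' * (w' + v') + v' \<and> \<beta> * (w + v) - w \<le> \<beta>' * (w' + v') - w'"
    using a b h unfolding distrib_left left_diff_distrib by linarith
  then show ?case by (simp add: c Let_def)
qed simp

text \<open>Write \<open>g\<close> as \<open>a\<close> times \<open>e\<close> plus \<open>h\<close>
  with \<open>h\<close> orthogonal to \<open>e\<close>. The filtered parts stay orthogonal, so the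
  mixed terms vanish. The part along \<open>e\<close> contributes minus its squared size times
  \<open>\<beta> - 1\<close>, while the complement contributes at most twice the squared norm of
  \<open>h\<close>, even if \<open>B\<close> has further eigenvalues above 1 there.\<close>

lemma cheb_negative_direction:
  assumes sym: "symmetric_on n B" and low: "\<And>x. - dot n x x \<le> dot n x (mv n B x)"
    and e: "dot n e e = 1" "\<forall>i<n. mv n B e i = \<beta> * e i"
    and big: "2 * dot n g g < (dot n g e)\<^sup>2 * ((\<beta> - 1) * (fst (cheb_scalar \<beta> m))\<^sup>2)"
  shows "dot n (fst (cheb n B g m)) (fst (cheb n B g m))
       < dot n (fst (cheb n B g m)) (mv n B (fst (cheb n B g m)))"
proof -
  define a where "a = dot n g e"
  define h where "h = (\<lambda>i. g i - a * e i)"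
  define W where "W = fst (cheb_scalar \<beta> m)"
  define y where "y = fst (cheb n B h m)"
  let ?z = "\<lambda>i. a * W * e i"
  have he: "dot n h e = 0" by (simp add: h_def dot_linear a_def e)
  have hh: "dot n h h \<le> dot n g g"
  proof -
    have "dot n h h = dot n g g - a\<^sup>2"
      unfolding h_def dot_linear using e(1) dot_commute[of n e g]
      by (simp add: a_def power2_eq_square)
    then show ?thesis by simp
  qed
  have "g = (\<lambda>i. a * e i + h i)" by (simp add: h_def)
  then have g: "fst (cheb n B g m) = (\<lambda>i. fst (cheb n B (\<lambda>i. a * e i) m) i + y i)"
    by (simp add: cheb_add[of n B "\<lambda>i. a * e i" h] y_def)
  have gz: "fst (cheb n B g m) i = ?z i + y i" if "i < n" for i
    using cheb_eigenvector[OF e(2) that, of a m] by (simp add: g W_def)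
  have ye: "dot n y e = 0" unfolding y_def using cheb_orthogonal[OF sym e(2) he] by blast
  have Be: "dot n x (mv n B e) = \<beta> * dot n x e" for x
    by (subst dot_cong[of n x x "mv n B e" "\<lambda>i. \<beta> * e i"]) (simp_all add: e(2) dot_linear)
  have yBy: "dot n y y - dot n y (mv n B y) \<le> 2 * dot n h h"
  proof -
    obtain v where "cheb n B h m = (y, v)" unfolding y_def by (metis prod.collapse)
    then show ?thesis using cheb_invariant[OF sym, of h m] low[of v] by simp
  qed
  have "dot n (fst (cheb n B g m)) (fst (cheb n B g m))
      - dot n (fst (cheb n B g m)) (mv n B (fst (cheb n B g m)))
      = dot n (\<lambda>i. ?z i + y i) (\<lambda>i. ?z i + y i)
      - dot n (\<lambda>i. ?z i + y i) (mv n B (\<lambda>i. ?z i + y i))"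
    using dot_cong[OF gz gz] mv_cong[where A = B, OF gz] dot_cong[OF gz refl] by simp
  also have "\<dots> = (dot n y y - dot n y (mv n B y)) - (a * W)\<^sup>2 * (\<beta> - 1)"
    unfolding mv_add mv_scale dot_linear Be
    using ye dot_commute[of n e y] e(1) dot_mv_symmetric[OF sym, of e y] Be[of y]
      dot_commute[of n "mv n B e" y]
    by (simp add: algebra_simps power2_eq_square)
  also have "\<dots> < 0"
    using yBy hh big by (simp add: a_def[symmetric] W_def[symmetric] power_mult_distrib algebra_simps)
  finally show ?thesis by simp
qed

text \<open>With 1 + \<eta> = cosh t, \<open>U m\<close> and \<open>Z m\<close> are sqrt 2 times
  sinh and cosh of (m + 1/2) t. Hence \<open>diff\<close> is the hyperbolic Pythagorean identity,
  and \<open>U m + Z m\<close> is multiplied in each step by exp t, which is at least 1 + sqrt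
  \<eta>.\<close>

lemma cheb_scalar_growth:
  assumes \<eta>: "0 < \<eta>" "\<eta> \<le> 1" and T: "0 \<le> T" and m: "ln (2 * T + 2) * 2 / sqrt \<eta> \<le> real m"
  shows "T\<^sup>2 \<le> \<eta> * (fst (cheb_scalar (1 + \<eta>) m))\<^sup>2"
proof -
  define \<rho> where "\<rho> = 1 + sqrt \<eta>"
  define U where "U = (\<lambda>m. sqrt \<eta> * fst (cheb_scalar (1 + \<eta>) m))"
  define Z where "Z = (\<lambda>m. sqrt (2 + \<eta>) * snd (cheb_scalar (1 + \<eta>) m))"
  have pos: "0 \<le> U m" "0 \<le> Z m" for m
    using cheb_scalar_mono[of "1 + \<eta>" "1 + \<eta>" m] \<eta> by (simp_all add: U_def Z_def)
  have rec: "U (Suc m) = (1 + \<eta>) * U m + sqrt \<eta> * sqrt (2 + \<eta>) * Z m"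
    "Z (Suc m) = (1 + \<eta>) * Z m + sqrt \<eta> * sqrt (2 + \<eta>) * U m" for m
  proof -
    have s: "sqrt (2 + \<eta>) * sqrt (2 + \<eta>) = 2 + \<eta>" "sqrt \<eta> * sqrt \<eta> = \<eta>" using \<eta> by simp_all
    obtain w v where c: "cheb_scalar (1 + \<eta>) m = (w, v)" by fastforce
    have "sqrt \<eta> * sqrt (2 + \<eta>) * (sqrt (2 + \<eta>) * v) = sqrt \<eta> * (2 + \<eta>) * v"
      "sqrt \<eta> * sqrt (2 + \<eta>) * (sqrt \<eta> * w) = sqrt (2 + \<eta>) * \<eta> * w"
      using s by (metis mult.assoc mult.commute)+
    then show "U (Suc m) = (1 + \<eta>) * U m + sqrt \<eta> * sqrt (2 + \<eta>) * Z m"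
      "Z (Suc m) = (1 + \<eta>) * Z m + sqrt \<eta> * sqrt (2 + \<eta>) * U m"
      using \<eta> by (simp_all add: U_def Z_def c Let_def algebra_simps)
  qed
  have diff: "(Z m)\<^sup>2 - (U m)\<^sup>2 = 2" for m
  proof (induction m)
    case 0
    then show ?case using \<eta> by (simp add: U_def Z_def)
  next
    case (Suc m)
    have "(sqrt \<eta> * sqrt (2 + \<eta>))\<^sup>2 = \<eta> * (2 + \<eta>)" using \<eta> by (simp add: power_mult_distrib)
    moreover have "((1 + \<eta>) * z + c * u)\<^sup>2 - ((1 + \<eta>) * u + c * z)\<^sup>2
      = ((1 + \<eta>)\<^sup>2 - c\<^sup>2) * (z\<^sup>2 - u\<^sup>2)" for z c u :: real
      by (simp add: power2_eq_square algebra_simps)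
    ultimately have "(Z (Suc m))\<^sup>2 - (U (Suc m))\<^sup>2 = ((1 + \<eta>)\<^sup>2 - \<eta> * (2 + \<eta>)) * 2"
      unfolding rec Suc[symmetric] by presburger
    then show ?case by (simp add: power2_eq_square algebra_simps)
  qed
  have sum: "\<rho> ^ m \<le> U m + Z m" for m
  proof (induction m)
    case 0
    then show ?case using \<eta> by (simp add: U_def Z_def add_increasing)
  next
    case (Suc m)
    have "1 * sqrt \<eta> \<le> sqrt (2 + \<eta>) * sqrt \<eta>" using \<eta> by (intro mult_right_mono) auto
    then have "\<rho> \<le> 1 + \<eta> + sqrt \<eta> * sqrt (2 + \<eta>)"
      using \<eta> unfolding \<rho>_def mult.commute[of "sqrt \<eta>"] by linarith
    then have "\<rho> * \<rho> ^ m \<le> (1 + \<eta> + sqrt \<eta> * sqrt (2 + \<eta>)) * (U m + Z m)"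
      using Suc pos \<eta> by (intro mult_mono) (auto simp: \<rho>_def)
    then show ?case by (simp add: rec algebra_simps)
  qed
  have "Z m \<le> U m + 2"
  proof -
    have "(Z m)\<^sup>2 \<le> (U m + 2)\<^sup>2" using diff[of m] pos[of m] by (simp add: power2_eq_square algebra_simps)
    then show ?thesis using pos[of m] by (simp add: abs_le_square_iff[symmetric])
  qed
  \<comment> \<open>\<open>U m + Z m\<close> is at most \<open>2 * U m + 2\<close>, so this lower
    bound on the power yields \<open>T \<le> U m\<close>. The estimate of \<open>ln \<rho>\<close>
    is ln (1 + x) \<ge> x / (1 + x) \<ge> x / 2 for 0 \<le> x \<le> 1.\<close>
  moreover have "2 * T + 2 \<le> \<rho> ^ m"
  proof -
    have "sqrt \<eta> / 2 \<le> ln \<rho>"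
    proof -
      have x: "1 + sqrt \<eta> > 0" using \<eta> by (simp add: add_pos_pos)
      then have "ln (inverse (1 + sqrt \<eta>)) \<le> inverse (1 + sqrt \<eta>) - 1"
        by (intro ln_le_minus_one) simp
      moreover have "inverse (1 + sqrt \<eta>) - 1 = - (sqrt \<eta> / (1 + sqrt \<eta>))"
        using x by (simp add: field_simps)
      ultimately have "sqrt \<eta> / (1 + sqrt \<eta>) \<le> ln (1 + sqrt \<eta>)"
        using x by (simp add: ln_inverse)
      moreover have "sqrt \<eta> / 2 \<le> sqrt \<eta> / (1 + sqrt \<eta>)"
        using \<eta> by (intro divide_left_mono) (auto simp: add_pos_pos)
      ultimately show ?thesis unfolding \<rho>_def by linarith
    qed
    then have "real m * (sqrt \<eta> / 2) \<le> real m * ln \<rho>" by (intro mult_left_mono) auto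
    moreover have "ln (2 * T + 2) \<le> real m * (sqrt \<eta> / 2)" using m \<eta> by (simp add: field_simps)
    ultimately have "ln (2 * T + 2) \<le> ln (\<rho> ^ m)"
      using \<eta> by (simp add: ln_realpow \<rho>_def add_pos_pos)
    then show ?thesis using T \<eta> by (subst (asm) ln_le_cancel_iff) (auto simp: \<rho>_def add_pos_pos)
  qed
  ultimately have "T \<le> U m" using sum[of m] by linarith
  then have "T\<^sup>2 \<le> (U m)\<^sup>2" using T by (intro power_mono)
  then show ?thesis using \<eta> by (simp add: U_def power_mult_distrib)
qed

section \<open>Small-ball estimates on the random tape\<close>

interpretation uniform_unit: prob_space "uniform_measure lborel {0..1::real}"
  by (rule prob_space_uniform_measure) auto

interpretation random_tape: prob_space random_tape
  unfolding random_tape_def by (rule prob_space_PiM) (rule uniform_unit.prob_space_axioms)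

lemma space_random_tape [simp]: "space random_tape = UNIV"
  by (simp add: random_tape_def space_PiM)

lemma measurable_random_tape_component [measurable]: "(\<lambda>\<omega>. \<omega> i) \<in> borel_measurable random_tape"
proof -
  have "(\<lambda>\<omega>. \<omega> i) \<in> measurable random_tape (uniform_measure lborel {0..1::real})"
    unfolding random_tape_def by measurable
  then show ?thesis by (simp cong: measurable_cong_sets)
qed

lemma AE_random_tape: "AE \<omega> in random_tape. \<forall>i. \<omega> i \<in> {0..1}"
proof -
  have "AE x in uniform_measure lborel {0..1::real}. x \<in> {0..1}"
    by (rule AE_uniform_measureI) auto
  then have "AE \<omega> in random_tape. \<omega> i \<in> {0..1}" for i
    unfolding random_tape_def
    by (intro AE_PiM_component uniform_unit.prob_space_axioms) auto
  then show ?thesis by (simp add: AE_all_countable)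
qed

text \<open>The set is an interval of length 2\<tau>/|a|, and the density is at most 1.\<close>

lemma emeasure_uniform_small_interval:
  fixes a b \<tau> :: real
  assumes a: "a \<noteq> 0" and \<tau>: "\<tau> \<ge> 0"
  shows "emeasure (uniform_measure lborel {0..1}) {x. \<bar>b + a * x\<bar> \<le> \<tau>} \<le> ennreal (2 * \<tau> / \<bar>a\<bar>)"
proof -
  have "{x. \<bar>b + a * x\<bar> \<le> \<tau>} = cball (- b / a) (\<tau> / \<bar>a\<bar>)"
  proof -
    have "\<bar>b + a * x\<bar> \<le> \<tau> \<longleftrightarrow> dist (- b / a) x \<le> \<tau> / \<bar>a\<bar>" for x
    proof -
      have "b + a * x = - (a * (- b / a - x))" using a by (simp add: algebra_simps)
      then have "\<bar>b + a * x\<bar> = \<bar>a\<bar> * \<bar>- b / a - x\<bar>" by (simp only: abs_minus abs_mult)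
      then show ?thesis using a by (simp add: dist_real_def pos_le_divide_eq mult.commute)
    qed
    then show ?thesis unfolding cball_def by (rule Collect_cong)
  qed
  also have "\<dots> = {- b / a - \<tau> / \<bar>a\<bar> .. - b / a + \<tau> / \<bar>a\<bar>}"
    by (rule cball_eq_atLeastAtMost)
  finally have eq: "{x. \<bar>b + a * x\<bar> \<le> \<tau>} = {- b / a - \<tau> / \<bar>a\<bar> .. - b / a + \<tau> / \<bar>a\<bar>}" .
  have "emeasure (uniform_measure lborel {0..1}) {x. \<bar>b + a * x\<bar> \<le> \<tau>}
      \<le> emeasure lborel {x. \<bar>b + a * x\<bar> \<le> \<tau>}"
    by (auto simp: eq divide_ennreal_def intro!: emeasure_mono)
  also have "\<dots> = ennreal (2 * \<tau> / \<bar>a\<bar>)"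
  proof -
    have "\<tau> / \<bar>a\<bar> \<ge> 0" using \<tau> by simp
    then show ?thesis unfolding eq by (subst emeasure_lborel_Icc) simp_all
  qed
  finally show ?thesis .
qed

text \<open>By Fubini: resampling the tape cell \<open>m\<close> changes neither \<open>A\<close> nor \<open>f\<close>.\<close>

lemma random_tape_small_ball_cell:
  assumes A: "A \<in> sets random_tape" "\<And>\<omega> x. fun_upd \<omega> m x \<in> A \<longleftrightarrow> \<omega> \<in> A"
    and f: "f \<in> borel_measurable random_tape" "\<And>\<omega> x. f (fun_upd \<omega> m x) = f \<omega>"
    and a: "a \<noteq> 0" and \<tau>: "\<tau> \<ge> 0"
  shows "measure random_tape {\<omega>\<in>A. \<bar>f \<omega> + a * \<omega> m\<bar> \<le> \<tau>} \<le> 2 * \<tau> / \<bar>a\<bar> * measure random_tape A"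
proof -
  let ?U = "uniform_measure lborel {0..1::real}"
  let ?F = "\<lambda>(x, \<omega>::nat \<Rightarrow> real). fun_upd \<omega> m x"
  let ?D = "{\<omega>\<in>A. \<bar>f \<omega> + a * \<omega> m\<bar> \<le> \<tau>}"
  interpret pair_prob_space ?U random_tape ..
  have D: "?D \<in> sets random_tape"
  proof -
    have "{\<omega>\<in>space random_tape. \<omega> \<in> A \<and> \<bar>f \<omega> + a * \<omega> m\<bar> \<le> \<tau>} \<in> sets random_tape"
      using A(1) f(1) by measurable
    then show ?thesis by simp
  qed
  have F: "?F \<in> measurable (?U \<Otimes>\<^sub>M random_tape) random_tape"
    unfolding random_tape_def
  proof (rule measurable_PiM_single')
    fix i
    show "(\<lambda>\<omega>. ?F \<omega> i) \<in> measurable (?U \<Otimes>\<^sub>M Pi\<^sub>M UNIV (\<lambda>i. ?U)) ?U"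
      by (cases "i = m") (simp_all add: case_prod_beta)
  qed simp
  \<comment> \<open>Overwriting cell \<open>m\<close> by an independent uniform draw leaves the law
    of the tape unchanged.\<close>
  have "random_tape = distr (?U \<Otimes>\<^sub>M random_tape) random_tape ?F"
    unfolding random_tape_def
    using distr_pair_PiM_eq_PiM[of UNIV "\<lambda>_. ?U" m, symmetric, OF uniform_unit.prob_space_axioms
        uniform_unit.prob_space_axioms] by (simp only: insert_UNIV)
  then have "emeasure random_tape ?D = emeasure (distr (?U \<Otimes>\<^sub>M random_tape) random_tape ?F) ?D"
    by (rule arg_cong)
  also have "\<dots> = emeasure (?U \<Otimes>\<^sub>M random_tape) (?F -` ?D \<inter> space (?U \<Otimes>\<^sub>M random_tape))"
    by (rule emeasure_distr[OF F D])
  also have "\<dots> = (\<integral>\<^sup>+\<omega>. emeasure ?U ((\<lambda>x. (x, \<omega>)) -` (?F -` ?D \<inter> space (?U \<Otimes>\<^sub>M random_tape))) \<partial>random_tape)"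
    by (rule emeasure_pair_measure_alt2) (rule measurable_sets[OF F D])
  also have "\<dots> \<le> (\<integral>\<^sup>+\<omega>. ennreal (2 * \<tau> / \<bar>a\<bar>) * indicator A \<omega> \<partial>random_tape)"
  proof (rule nn_integral_mono)
    fix \<omega>
    have "(\<lambda>x. (x, \<omega>)) -` (?F -` ?D \<inter> space (?U \<Otimes>\<^sub>M random_tape))
        = (if \<omega> \<in> A then {x. \<bar>f \<omega> + a * x\<bar> \<le> \<tau>} else {})"
      using A(2) f(2) by (auto simp: space_pair_measure)
    then show "emeasure ?U ((\<lambda>x. (x, \<omega>)) -` (?F -` ?D \<inter> space (?U \<Otimes>\<^sub>M random_tape)))
        \<le> ennreal (2 * \<tau> / \<bar>a\<bar>) * indicator A \<omega>"
      using emeasure_uniform_small_interval[OF a \<tau>] by simp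
  qed
  also have "\<dots> = ennreal (2 * \<tau> / \<bar>a\<bar>) * emeasure random_tape A"
    using A(1) by (simp add: nn_integral_cmult_indicator)
  finally have "ennreal (measure random_tape ?D) \<le> ennreal (2 * \<tau> / \<bar>a\<bar> * measure random_tape A)"
    using \<tau> by (subst ennreal_mult) (simp_all add: random_tape.emeasure_eq_measure)
  then show ?thesis
    using \<tau> by (subst (asm) ennreal_le_iff) auto
qed

text \<open>Some coordinate of a unit vector has absolute value at least 1 / sqrt n, and resampling
  that cell alone is enough. The factor \<open>measure random_tape A\<close> on the right allows
  summation over disjoint events.\<close>

lemma random_tape_small_ball_block:
  assumes A: "A \<in> sets random_tape"
    and indep: "\<And>\<omega> \<omega>'. (\<forall>i<c. \<omega> i = \<omega>' i) \<Longrightarrow> \<omega> \<in> A \<longleftrightarrow> \<omega>' \<in> A"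
    and e: "dot n e e = 1" and \<tau>: "\<tau> \<ge> 0"
  shows "measure random_tape {\<omega>\<in>A. \<bar>dot n (\<lambda>i. \<omega> (c + i)) e\<bar> \<le> \<tau>}
    \<le> 2 * \<tau> * sqrt (real n) * measure random_tape A"
proof -
  have "\<exists>i<n. 1 / real n \<le> e i * e i"
  proof (rule ccontr)
    assume "\<not> ?thesis"
    then have less: "\<And>i. i < n \<Longrightarrow> e i * e i < 1 / real n" by force
    have n: "n > 0" using e by (cases n) (auto simp: dot_def)
    then have "dot n e e < (\<Sum>i<n. 1 / real n)"
      unfolding dot_def using less by (intro sum_strict_mono) auto
    then show False using e n by simp
  qed
  then obtain i where i: "i < n" "1 / real n \<le> e i * e i" by blast
  then have npos: "real n > 0" by simp
  have ei: "1 / sqrt (real n) \<le> \<bar>e i\<bar>"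
  proof -
    have "(1 / sqrt (real n))\<^sup>2 \<le> (e i)\<^sup>2"
      using i npos by (simp add: power_divide power2_eq_square)
    then show ?thesis using npos by (simp add: abs_le_square_iff[symmetric])
  qed
  moreover have pos: "0 < 1 / sqrt (real n)" using npos by simp
  ultimately have ei0: "\<bar>e i\<bar> > 0" by linarith
  have split: "dot n (\<lambda>i. \<omega> (c + i)) e = (\<Sum>j\<in>{..<n} - {i}. \<omega> (c + j) * e j) + e i * \<omega> (c + i)" for \<omega>
    unfolding dot_def using i(1) by (subst sum.remove[of _ i]) (auto simp: mult.commute)
  have "measure random_tape {\<omega>\<in>A. \<bar>(\<Sum>j\<in>{..<n} - {i}. \<omega> (c + j) * e j) + e i * \<omega> (c + i)\<bar> \<le> \<tau>}
    \<le> 2 * \<tau> / \<bar>e i\<bar> * measure random_tape A"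
  proof (rule random_tape_small_ball_cell[OF A])
    show "fun_upd \<omega> (c + i) x \<in> A \<longleftrightarrow> \<omega> \<in> A" for \<omega> x by (rule indep) auto
    show "(\<lambda>\<omega>. \<Sum>j\<in>{..<n} - {i}. \<omega> (c + j) * e j) \<in> borel_measurable random_tape" by measurable
    show "(\<Sum>j\<in>{..<n} - {i}. (fun_upd \<omega> (c + i) x) (c + j) * e j) = (\<Sum>j\<in>{..<n} - {i}. \<omega> (c + j) * e j)"
      for \<omega> x by (intro sum.cong) auto
  qed (use ei0 \<tau> in auto)
  also have "\<dots> \<le> 2 * \<tau> * sqrt (real n) * measure random_tape A"
  proof (rule mult_right_mono)
    have "2 * \<tau> / \<bar>e i\<bar> \<le> 2 * \<tau> / (1 / sqrt (real n))"
      using ei ei0 pos \<tau> by (intro divide_left_mono mult_pos_pos) auto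
    then show "2 * \<tau> / \<bar>e i\<bar> \<le> 2 * \<tau> * sqrt (real n)" by simp
  qed simp
  finally show ?thesis by (simp only: split)
qed

text \<open>The direction may depend on the past through \<sigma>: condition on each of its values.
  The bounds carry the probabilities of these values as weights, which sum to at most 1, so the
  number of values does not enter.\<close>

lemma random_tape_small_ball_adaptive:
  fixes \<sigma> :: "(nat \<Rightarrow> real) \<Rightarrow> 's"
  assumes fin: "finite (range \<sigma>)" and meas: "\<And>s. {\<omega>. \<sigma> \<omega> = s} \<in> sets random_tape"
    and indep: "\<And>\<omega> \<omega>'. (\<forall>i<c. \<omega> i = \<omega>' i) \<Longrightarrow> \<sigma> \<omega> = \<sigma> \<omega>'"
    and e: "\<And>s. G s \<Longrightarrow> dot n (e s) (e s) = 1" and \<tau>: "\<tau> \<ge> 0"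
  shows "{\<omega>. G (\<sigma> \<omega>) \<and> \<bar>dot n (\<lambda>i. \<omega> (c + i)) (e (\<sigma> \<omega>))\<bar> \<le> \<tau>} \<in> sets random_tape"
    and "measure random_tape {\<omega>. G (\<sigma> \<omega>) \<and> \<bar>dot n (\<lambda>i. \<omega> (c + i)) (e (\<sigma> \<omega>))\<bar> \<le> \<tau>}
      \<le> 2 * \<tau> * sqrt (real n)"
proof -
  let ?D = "\<lambda>s. {\<omega>\<in>{\<omega>. \<sigma> \<omega> = s}. \<bar>dot n (\<lambda>i. \<omega> (c + i)) (e s)\<bar> \<le> \<tau>}"
  let ?S = "{s\<in>range \<sigma>. G s}"
  have finS: "finite ?S" using fin by simp
  have D: "?D s \<in> sets random_tape" for s
  proof -
    have "{\<omega>\<in>space random_tape. \<omega> \<in> {\<omega>. \<sigma> \<omega> = s} \<and> \<bar>dot n (\<lambda>i. \<omega> (c + i)) (e s)\<bar> \<le> \<tau>}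
      \<in> sets random_tape"
      using meas[of s] unfolding dot_def by measurable
    then show ?thesis by simp
  qed
  have eq: "{\<omega>. G (\<sigma> \<omega>) \<and> \<bar>dot n (\<lambda>i. \<omega> (c + i)) (e (\<sigma> \<omega>))\<bar> \<le> \<tau>} = (\<Union>s\<in>?S. ?D s)"
    by auto
  show "{\<omega>. G (\<sigma> \<omega>) \<and> \<bar>dot n (\<lambda>i. \<omega> (c + i)) (e (\<sigma> \<omega>))\<bar> \<le> \<tau>} \<in> sets random_tape"
    unfolding eq using D finS by (intro sets.finite_UN) auto
  have "measure random_tape (\<Union>s\<in>?S. ?D s) \<le> (\<Sum>s\<in>?S. measure random_tape (?D s))"
    using finS D by (intro random_tape.finite_measure_subadditive_finite) auto
  also have "\<dots> \<le> (\<Sum>s\<in>?S. 2 * \<tau> * sqrt (real n) * measure random_tape {\<omega>. \<sigma> \<omega> = s})"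
  proof (rule sum_mono)
    fix s assume "s \<in> ?S"
    then have "G s" by simp
    show "measure random_tape (?D s) \<le> 2 * \<tau> * sqrt (real n) * measure random_tape {\<omega>. \<sigma> \<omega> = s}"
    proof (rule random_tape_small_ball_block[OF meas _ e[OF \<open>G s\<close>] \<tau>])
      fix \<omega> \<omega>' :: "nat \<Rightarrow> real" assume "\<forall>i<c. \<omega> i = \<omega>' i"
      then have "\<sigma> \<omega> = \<sigma> \<omega>'" by (rule indep)
      then show "\<omega> \<in> {\<omega>. \<sigma> \<omega> = s} \<longleftrightarrow> \<omega>' \<in> {\<omega>. \<sigma> \<omega> = s}" by simp
    qed
  qed
  also have "\<dots> = 2 * \<tau> * sqrt (real n) * (\<Sum>s\<in>?S. measure random_tape {\<omega>. \<sigma> \<omega> = s})"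
    by (simp add: sum_distrib_left)
  also have "(\<Sum>s\<in>?S. measure random_tape {\<omega>. \<sigma> \<omega> = s}) = measure random_tape (\<Union>s\<in>?S. {\<omega>. \<sigma> \<omega> = s})"
    using finS meas
    by (intro random_tape.finite_measure_finite_Union[symmetric]) (auto simp: disjoint_family_on_def)
  also have "2 * \<tau> * sqrt (real n) * measure random_tape (\<Union>s\<in>?S. {\<omega>. \<sigma> \<omega> = s}) \<le> 2 * \<tau> * sqrt (real n) * 1"
    using \<tau> by (intro mult_left_mono random_tape.prob_le_1) auto
  finally show "measure random_tape {\<omega>. G (\<sigma> \<omega>) \<and> \<bar>dot n (\<lambda>i. \<omega> (c + i)) (e (\<sigma> \<omega>))\<bar> \<le> \<tau>}
      \<le> 2 * \<tau> * sqrt (real n)"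
    unfolding eq by simp
qed

section \<open>The search\<close>

text \<open>The case \<open>p \<ge> 1\<close> is trivial and left to the theorem; here
  \<open>p < 1\<close> ensures that n/p is at least 1.\<close>

locale gtrs_instance =
  fixes n :: nat and A0 A1 :: "real mat" and b0 b1 :: "real vec" and c0 c1 \<zeta> p :: real
  assumes assm_A: "assumption_A n A0 b0 c0 A1 b1 c1"
    and zeta_star_le: "zeta_star A0 A1 \<le> \<zeta>"
    and p_pos: "0 < p" and p_less_1: "p < 1"
begin

abbreviation a0 where "a0 \<equiv> mfun A0"
abbreviation a1 where "a1 \<equiv> mfun A1"
abbreviation lam where "lam \<gamma> \<equiv> lambda_min (pencil A0 A1 \<gamma>)"
abbreviation \<xi>s where "\<xi>s \<equiv> xi_star A0 A1"

definition form :: "real \<Rightarrow> (nat \<Rightarrow> real) \<Rightarrow> real" where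
  "form \<gamma> x = dot n x (mv n a0 x) + \<gamma> * dot n x (mv n a1 x)"

lemma A0: "A0 \<in> carrier_mat n n" "A0\<^sup>T = A0" and A1: "A1 \<in> carrier_mat n n" "A1\<^sup>T = A1"
  using assm_A by (auto simp: assumption_A_def)

lemma n_pos: "n > 0"
  using assm_A eigenvalue_imp_nonzero_dim[OF A0(1)] by (auto simp: assumption_A_def)

lemma form_A0_bound: "\<bar>dot n x (mv n a0 x)\<bar> \<le> dot n x x"
  using assm_A by (intro spectral_norm_quadratic_form) (auto simp: assumption_A_def)

lemma form_A1_bound: "\<bar>dot n x (mv n a1 x)\<bar> \<le> dot n x x"
  using assm_A by (intro spectral_norm_quadratic_form) (auto simp: assumption_A_def)

lemma pencil_carrier: "pencil A0 A1 \<gamma> \<in> carrier_mat n n"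
  using A0 A1 by (auto simp: pencil_def)

lemma mfun_pencil: "i < n \<Longrightarrow> j < n \<Longrightarrow> mfun (pencil A0 A1 \<gamma>) i j = a0 i j + \<gamma> * a1 i j"
  using A0 A1 by (auto simp: pencil_def mfun_def)

lemma pencil_symmetric: "(pencil A0 A1 \<gamma>)\<^sup>T = pencil A0 A1 \<gamma>"
proof (rule eq_matI)
  fix i j assume "i < dim_row (pencil A0 A1 \<gamma>)" "j < dim_col (pencil A0 A1 \<gamma>)"
  then have ij: "i < n" "j < n" using pencil_carrier[of \<gamma>] by auto
  then have "mfun (pencil A0 A1 \<gamma>) j i = mfun (pencil A0 A1 \<gamma>) i j"
    using symmetric_on_mfun[OF A0] symmetric_on_mfun[OF A1]
    by (simp add: mfun_pencil symmetric_on_def)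
  then show "(pencil A0 A1 \<gamma>)\<^sup>T $$ (i, j) = pencil A0 A1 \<gamma> $$ (i, j)"
    using ij pencil_carrier[of \<gamma>] by (auto simp: mfun_def)
qed (use pencil_carrier[of \<gamma>] in auto)

lemma mv_pencil: "i < n \<Longrightarrow> mv n (mfun (pencil A0 A1 \<gamma>)) x i = mv n a0 x i + \<gamma> * mv n a1 x i"
  by (simp add: mv_def mfun_pencil algebra_simps sum.distrib sum_distrib_left)

lemma dot_mv_pencil: "dot n x (mv n (mfun (pencil A0 A1 \<gamma>)) x) = form \<gamma> x"
proof -
  have "dot n x (mv n (mfun (pencil A0 A1 \<gamma>)) x) = dot n x (\<lambda>i. mv n a0 x i + \<gamma> * mv n a1 x i)"
    by (intro dot_cong) (simp_all add: mv_pencil)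
  then show ?thesis by (simp add: dot_linear form_def)
qed

lemma lam_le_form: "lam \<gamma> * dot n x x \<le> form \<gamma> x"
  using lambda_min_properties(2)[OF pencil_carrier pencil_symmetric n_pos, of \<gamma> x]
  by (simp add: dot_mv_pencil)

lemma lam_eigenvector:
  "\<exists>e. dot n e e = 1 \<and> (\<forall>i<n. mv n a0 e i + \<gamma> * mv n a1 e i = lam \<gamma> * e i)"
  using lambda_min_properties(1)[OF pencil_carrier pencil_symmetric n_pos, of \<gamma>]
  by (auto simp: eigenvalue_iff_mv[OF pencil_carrier] mv_pencil cong: conj_cong)

lemma lam_form_attained: "\<exists>e. dot n e e = 1 \<and> form \<gamma> e = lam \<gamma>"
proof -
  obtain e where e: "dot n e e = 1" "\<forall>i<n. mv n (mfun (pencil A0 A1 \<gamma>)) e i = lam \<gamma> * e i"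
    using lam_eigenvector[of \<gamma>] by (auto simp: mv_pencil)
  then show ?thesis
    using eigenvalue_quadratic_form[OF e] by (auto simp: dot_mv_pencil)
qed

lemma pencil_quadratic_form: "vec n x \<bullet> (pencil A0 A1 \<gamma> *\<^sub>v vec n x) = form \<gamma> x"
proof -
  have "mv n A (vec_index (vec n x)) = mv n A x" for A by (rule mv_cong) simp
  moreover have "dot n (vec_index (vec n x)) y = dot n x y" for y by (rule dot_cong) auto
  ultimately show ?thesis
    by (subst quadratic_form_eq_dot[OF pencil_carrier]) (simp_all add: dot_mv_pencil)
qed

lemma Gamma_set_iff: "\<gamma> \<in> Gamma_set A0 A1 \<longleftrightarrow> 0 \<le> \<gamma> \<and> (\<forall>x. 0 \<le> form \<gamma> x)"
proof -
  have dim: "dim_row (pencil A0 A1 \<gamma>) = n" using pencil_carrier[of \<gamma>] by auto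
  have "pos_semidef (pencil A0 A1 \<gamma>) \<longleftrightarrow> (\<forall>x. 0 \<le> form \<gamma> x)"
  proof
    assume "pos_semidef (pencil A0 A1 \<gamma>)"
    then have "0 \<le> vec n x \<bullet> (pencil A0 A1 \<gamma> *\<^sub>v vec n x)" for x
      unfolding pos_semidef_def dim by auto
    then show "\<forall>x. 0 \<le> form \<gamma> x" by (simp add: pencil_quadratic_form)
  next
    assume "\<forall>x. 0 \<le> form \<gamma> x"
    then show "pos_semidef (pencil A0 A1 \<gamma>)"
      by (auto simp: pos_semidef_def pencil_symmetric dim quadratic_form_eq_dot[OF pencil_carrier]
          dot_mv_pencil)
  qed
  then show ?thesis by (simp add: Gamma_set_def)
qed

lemma negative_direction_A0: "\<exists>e. dot n e e = 1 \<and> form 0 e < 0"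
proof -
  obtain k e where k: "k < 0" and e: "dot n e e = 1" "\<forall>i<n. mv n a0 e i = k * e i"
    using assm_A eigenvalue_iff_mv[OF A0(1)] by (auto simp: assumption_A_def)
  then show ?thesis using eigenvalue_quadratic_form[OF e] by (auto simp: form_def)
qed

text \<open>Along this direction the form falls linearly in \<gamma>. This bounds
  \<open>Gamma_set\<close>, so that its \<open>Sup\<close> is meaningful, and it keeps
  \<open>lam\<close> at most 1, so that the supremum in \<open>xi_star\<close> is taken over a
  bounded set.\<close>

lemma negative_direction_A1: "\<exists>e k. k < 0 \<and> dot n e e = 1 \<and> (\<forall>\<gamma>. form \<gamma> e \<le> 1 + \<gamma> * k)"
proof -
  obtain k e where k: "k < 0" and e: "dot n e e = 1" "\<forall>i<n. mv n a1 e i = k * e i"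
    using assm_A eigenvalue_iff_mv[OF A1(1)] by (auto simp: assumption_A_def)
  then have "form \<gamma> e \<le> 1 + \<gamma> * k" for \<gamma>
    using eigenvalue_quadratic_form[OF e] form_A0_bound[of e] by (simp add: form_def)
  with k e show ?thesis by blast
qed

lemma zeta_ge_1: "1 \<le> \<zeta>"
  using zeta_star_le by (simp add: zeta_star_def)

lemma psd_le_zeta:
  assumes "0 \<le> \<gamma>" "\<And>x. 0 \<le> form \<gamma> x"
  shows "\<gamma> \<le> \<zeta>"
proof -
  obtain e k where k: "k < 0" "\<And>\<gamma>. form \<gamma> e \<le> 1 + \<gamma> * k" using negative_direction_A1 by blast
  have "bdd_above (Gamma_set A0 A1)"
  proof (rule bdd_aboveI)
    fix \<gamma> assume "\<gamma> \<in> Gamma_set A0 A1"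
    then have "0 \<le> 1 + \<gamma> * k" using k(2)[of \<gamma>] by (auto simp: Gamma_set_iff intro: order_trans)
    then show "\<gamma> \<le> 1 / (- k)" using k(1) by (subst pos_le_divide_eq) auto
  qed
  then have "\<gamma> \<le> gamma_plus A0 A1"
    unfolding gamma_plus_def using assms by (intro cSup_upper) (auto simp: Gamma_set_iff)
  then show ?thesis using zeta_star_le by (simp add: zeta_star_def)
qed

lemma lam_le_1:
  assumes "0 \<le> \<gamma>"
  shows "lam \<gamma> \<le> 1"
proof -
  obtain e k where k: "k < 0" "dot n e e = 1" "\<And>\<gamma>. form \<gamma> e \<le> 1 + \<gamma> * k"
    using negative_direction_A1 by blast
  have "\<gamma> * k \<le> 0" using assms k(1) by (simp add: mult_nonneg_nonpos)
  then show ?thesis using lam_le_form[of \<gamma> e] k(2) k(3)[of \<gamma>] by simp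
qed

lemma xi_star_le_1: "\<xi>s \<le> 1"
  by (simp add: xi_star_def)

lemma le_xi_star:
  assumes "0 \<le> \<gamma>" "c \<le> lam \<gamma>"
  shows "c \<le> \<xi>s"
proof -
  have "bdd_above (lam ` {0..})" using lam_le_1 by (intro bdd_aboveI[of _ 1]) auto
  then have "lam \<gamma> \<le> (SUP \<gamma>\<in>{0..}. lam \<gamma>)" using assms by (intro cSUP_upper) auto
  then show ?thesis using assms lam_le_1[OF assms(1)] by (simp add: xi_star_def)
qed

lemma xi_star_le:
  assumes "\<And>\<gamma>. 0 \<le> \<gamma> \<Longrightarrow> lam \<gamma> \<le> c"
  shows "\<xi>s \<le> c"
proof -
  have "(SUP \<gamma>\<in>{0..}. lam \<gamma>) \<le> c" using assms by (intro cSUP_least) auto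
  then show ?thesis by (simp add: xi_star_def)
qed

lemma lam_positive: "\<exists>\<gamma>\<ge>0. lam \<gamma> > 0"
proof -
  obtain \<gamma> where \<gamma>: "0 \<le> \<gamma>" "pos_def (pencil A0 A1 \<gamma>)" using assm_A by (auto simp: assumption_A_def)
  obtain e where e: "dot n e e = 1" "form \<gamma> e = lam \<gamma>" using lam_form_attained by blast
  have "vec n e \<noteq> 0\<^sub>v n"
  proof
    assume "vec n e = 0\<^sub>v n"
    then have "\<forall>i<n. e i = 0" by (metis index_vec index_zero_vec(1))
    then show False using e(1) by (simp add: dot_def)
  qed
  moreover have "dim_row (pencil A0 A1 \<gamma>) = n" using pencil_carrier[of \<gamma>] by auto
  ultimately have "0 < vec n e \<bullet> (pencil A0 A1 \<gamma> *\<^sub>v vec n e)"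
    using \<gamma>(2) unfolding pos_def_def by auto
  then show ?thesis using \<gamma>(1) e(2) by (auto simp: pencil_quadratic_form)
qed

lemma xi_star_pos: "0 < \<xi>s"
proof -
  obtain \<gamma> where "0 \<le> \<gamma>" "lam \<gamma> > 0" using lam_positive by blast
  then show ?thesis using le_xi_star[of \<gamma> "lam \<gamma>"] by simp
qed

text \<open>A positive definite matrix has a positive diagonal, so each position (i, i) is nonzero
  in \<open>A0\<close> or \<open>A1\<close>. The work on vectors of length \<open>n\<close> is
  thereby paid for by the number of nonzero entries.\<close>

lemma n_le_nonzeros: "n \<le> card (nonzeros A0) + card (nonzeros A1)"
proof -
  obtain \<gamma> where \<gamma>: "0 \<le> \<gamma>" "lam \<gamma> > 0" using lam_positive by blast
  have fin: "finite (nonzeros A)" if "A \<in> carrier_mat n n" for A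
    using that by (intro finite_subset[of "nonzeros A" "{..<n} \<times> {..<n}"]) (auto simp: nonzeros_def)
  have "(i, i) \<in> nonzeros A0 \<union> nonzeros A1" if i: "i < n" for i
  proof -
    let ?u = "\<lambda>j. if j = i then 1 else 0 :: real"
    have dot: "dot n ?u x = x i" for x
    proof -
      have "dot n ?u x = (\<Sum>j<n. if j = i then x j else 0)" unfolding dot_def by (intro sum.cong) auto
      then show ?thesis using i by simp
    qed
    have mv: "mv n A ?u i = A i i" for A
    proof -
      have "mv n A ?u i = (\<Sum>j<n. if j = i then A i j else 0)" unfolding mv_def by (intro sum.cong) auto
      then show ?thesis using i by simp
    qed
    have "0 < a0 i i + \<gamma> * a1 i i"
      using lam_le_form[of \<gamma> ?u] \<gamma>(2) by (simp add: form_def dot mv)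
    then have "a0 i i \<noteq> 0 \<or> a1 i i \<noteq> 0" by auto
    then show ?thesis using i A0(1) A1(1) by (auto simp: nonzeros_def mfun_def)
  qed
  then have "(\<lambda>i. (i, i)) ` {..<n} \<subseteq> nonzeros A0 \<union> nonzeros A1" by auto
  then have "card ((\<lambda>i. (i, i)) ` {..<n}) \<le> card (nonzeros A0 \<union> nonzeros A1)"
    using fin[OF A0(1)] fin[OF A1(1)] by (intro card_mono) auto
  also have "\<dots> \<le> card (nonzeros A0) + card (nonzeros A1)" by (rule card_Un_le)
  finally show ?thesis by (simp add: card_image inj_on_def)
qed

text \<open>The affine image of \<open>A(\<gamma>)\<close> that moves the eigenvalue \<open>3\<xi>/2\<close> to 1 and larger ones into
  \<open>[-1, 1]\<close>; an eigenvalue below \<open>\<xi>\<close> is moved beyond \<open>1 + \<xi>/(1 + \<gamma>)\<close>.\<close>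

definition iter_mat :: "real \<Rightarrow> real \<Rightarrow> nat \<Rightarrow> nat \<Rightarrow> real" where
  "iter_mat \<xi> \<gamma> = (\<lambda>i j. (if j = i then 1 + 3 * \<xi> / (1 + \<gamma>) else 0) - 2 / (1 + \<gamma>) * (a0 i j + \<gamma> * a1 i j))"

lemma mv_iter_mat:
  assumes "i < n"
  shows "mv n (iter_mat \<xi> \<gamma>) x i =
    (1 + 3 * \<xi> / (1 + \<gamma>)) * x i - 2 / (1 + \<gamma>) * (mv n a0 x i + \<gamma> * mv n a1 x i)"
proof -
  have "mv n (iter_mat \<xi> \<gamma>) x i = (\<Sum>j<n. (if j = i then (1 + 3 * \<xi> / (1 + \<gamma>)) * x j else 0)
      - 2 / (1 + \<gamma>) * (a0 i j * x j + \<gamma> * (a1 i j * x j)))"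
    unfolding mv_def iter_mat_def by (intro sum.cong) (auto simp: algebra_simps)
  also have "(\<Sum>j<n. (if j = i then d * x j else 0) - c * (a0 i j * x j + \<gamma> * (a1 i j * x j)))
      = d * x i - c * (mv n a0 x i + \<gamma> * mv n a1 x i)" for c d
    using assms by (simp add: sum_subtractf sum.distrib sum_distrib_left[symmetric] mv_def)
  finally show ?thesis .
qed

lemma dot_mv_iter_mat:
  "dot n x (mv n (iter_mat \<xi> \<gamma>) x) = (1 + 3 * \<xi> / (1 + \<gamma>)) * dot n x x - 2 / (1 + \<gamma>) * form \<gamma> x"
proof -
  have "dot n x (mv n (iter_mat \<xi> \<gamma>) x) =
     dot n x (\<lambda>i. (1 + 3 * \<xi> / (1 + \<gamma>)) * x i - 2 / (1 + \<gamma>) * (mv n a0 x i + \<gamma> * mv n a1 x i))"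
    by (intro dot_cong) (simp_all add: mv_iter_mat)
  then show ?thesis by (simp only: dot_linear form_def)
qed

lemma symmetric_iter_mat: "symmetric_on n (iter_mat \<xi> \<gamma>)"
  using symmetric_on_mfun[OF A0] symmetric_on_mfun[OF A1]
  by (auto simp: symmetric_on_def iter_mat_def)

text \<open>\<open>T\<close> separates the two requirements: \<open>big\<close> is about the luck of
  the draw, and the bound on \<open>T\<close> is about the degree. In terms of
  \<open>iter_mat\<close>, the conclusion says that its form at \<open>y\<close> exceeds the squared
  norm of \<open>y\<close>.\<close>

lemma witness_if_lam_less:
  assumes \<gamma>: "0 \<le> \<gamma>" and \<xi>: "0 < \<xi>" and lam: "lam \<gamma> < \<xi>"
    and e: "dot n e e = 1" "\<forall>i<n. mv n a0 e i + \<gamma> * mv n a1 e i = lam \<gamma> * e i"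
    and big: "2 * dot n g g < (dot n g e)\<^sup>2 * T\<^sup>2"
    and T: "T\<^sup>2 \<le> \<xi> / (1 + \<gamma>) * (fst (cheb_scalar (1 + \<xi> / (1 + \<gamma>)) m))\<^sup>2"
    and y: "y = fst (cheb n (iter_mat \<xi> \<gamma>) g m)"
  shows "2 * form \<gamma> y < 3 * \<xi> * dot n y y"
proof -
  let ?B = "iter_mat \<xi> \<gamma>"
  define \<beta> where "\<beta> = 1 + 3 * \<xi> / (1 + \<gamma>) - 2 / (1 + \<gamma>) * lam \<gamma>"
  have g1: "1 + \<gamma> > 0" using \<gamma> by simp
  have "2 / (1 + \<gamma>) * lam \<gamma> \<le> 2 / (1 + \<gamma>) * \<xi>" using lam g1 by (intro mult_left_mono) auto
  moreover have "3 * \<xi> / (1 + \<gamma>) = \<xi> / (1 + \<gamma>) + 2 / (1 + \<gamma>) * \<xi>"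
    by (simp add: add_divide_distrib[symmetric])
  ultimately have \<beta>: "1 + \<xi> / (1 + \<gamma>) \<le> \<beta>" unfolding \<beta>_def by linarith
  have \<eta>: "0 < \<xi> / (1 + \<gamma>)" using \<xi> g1 by simp
  have eB: "\<forall>i<n. mv n ?B e i = \<beta> * e i"
    using e(2) by (simp add: mv_iter_mat \<beta>_def algebra_simps)
  have low: "- dot n x x \<le> dot n x (mv n ?B x)" for x
  proof -
    have "\<gamma> * dot n x (mv n a1 x) \<le> \<gamma> * dot n x x"
      using form_A1_bound[of x] \<gamma> by (intro mult_left_mono) auto
    then have "form \<gamma> x \<le> (1 + \<gamma>) * dot n x x"
      using form_A0_bound[of x] by (simp add: form_def algebra_simps)
    then have "2 / (1 + \<gamma>) * form \<gamma> x \<le> 2 / (1 + \<gamma>) * ((1 + \<gamma>) * dot n x x)"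
      using g1 by (intro mult_left_mono) auto
    also have "\<dots> = 2 * dot n x x" using g1 by simp
    finally have "2 / (1 + \<gamma>) * form \<gamma> x \<le> 2 * dot n x x" .
    moreover have "0 \<le> 3 * \<xi> / (1 + \<gamma>) * dot n x x"
      using \<xi> g1 dot_self_nonneg[of n x] by simp
    ultimately show ?thesis by (simp only: dot_mv_iter_mat distrib_right)
  qed
  have W: "1 \<le> fst (cheb_scalar (1 + \<xi> / (1 + \<gamma>)) m)"
    "fst (cheb_scalar (1 + \<xi> / (1 + \<gamma>)) m) \<le> fst (cheb_scalar \<beta> m)"
    using cheb_scalar_mono[OF _ \<beta>, of m] \<eta> by simp_all
  have "T\<^sup>2 \<le> (\<beta> - 1) * (fst (cheb_scalar \<beta> m))\<^sup>2"
    using T by (rule order_trans) (use W \<beta> \<eta> in \<open>intro mult_mono power_mono, auto\<close>)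
  then have "(dot n g e)\<^sup>2 * T\<^sup>2 \<le> (dot n g e)\<^sup>2 * ((\<beta> - 1) * (fst (cheb_scalar \<beta> m))\<^sup>2)"
    by (intro mult_left_mono) auto
  with big have "2 * dot n g g < (dot n g e)\<^sup>2 * ((\<beta> - 1) * (fst (cheb_scalar \<beta> m))\<^sup>2)"
    by linarith
  from cheb_negative_direction[OF symmetric_iter_mat low e(1) eB this]
  have "dot n y y < dot n y (mv n ?B y)" by (simp add: y)
  also have "\<dots> = dot n y y + (3 * \<xi> * dot n y y - 2 * form \<gamma> y) / (1 + \<gamma>)"
    unfolding dot_mv_iter_mat by (simp add: diff_divide_distrib algebra_simps)
  finally show ?thesis using g1 by (simp add: zero_less_divide_iff)
qed

text \<open>Test number \<open>k\<close> may fail with probability \<open>\<delta> = p / ((k+1)(k+2))\<close>, and these sum up to \<open>p\<close>; the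
  threshold is \<open>3n/\<delta>\<close>.\<close>

definition threshold :: "nat \<Rightarrow> real" where
  "threshold k = 3 * real n * (real k + 1) * (real k + 2) / p"

text \<open>Defined by the stopping test, which the program can evaluate with real arithmetic alone;
  a closed formula would need a logarithm and a ceiling.\<close>

definition steps :: "real \<Rightarrow> real \<Rightarrow> real \<Rightarrow> nat" where
  "steps \<xi> \<gamma> T = (LEAST m. T\<^sup>2 \<le> \<xi> / (1 + \<gamma>) * (fst (cheb_scalar (1 + \<xi> / (1 + \<gamma>)) m))\<^sup>2)"

text \<open>Search states are triples: the guess for \<open>\<xi>\<^sup>*\<close> and the endpoints of the bracket for \<open>\<gamma>\<close>.\<close>

definition lo :: "real \<times> real \<times> real \<Rightarrow> real" where "lo s = fst (snd s)"
definition hi :: "real \<times> real \<times> real \<Rightarrow> real" where "hi s = snd (snd s)"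
definition mid :: "real \<times> real \<times> real \<Rightarrow> real" where "mid s = (lo s + hi s) / 2"

definition reset :: "real \<times> real \<times> real \<Rightarrow> real \<times> real \<times> real" where
  "reset s = (if hi s - lo s < fst s then (fst s / 2, 0, \<zeta>) else s)"

definition probe :: "nat \<Rightarrow> (nat \<Rightarrow> real) \<Rightarrow> real \<times> real \<times> real \<Rightarrow> nat \<Rightarrow> real" where
  "probe k \<omega> s = fst (cheb n (iter_mat (fst s) (mid s)) (\<lambda>i. \<omega> (k * n + i))
     (steps (fst s) (mid s) (threshold k)))"

definition bisect :: "real \<times> real \<times> real \<Rightarrow> (nat \<Rightarrow> real) \<Rightarrow> real \<times> real \<times> real" where
  "bisect s y = (if dot n y (mv n a1 y) \<le> 0 then (fst s, lo s, mid s) else (fst s, mid s, hi s))"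

text \<open>Every test is treated as if it had produced a witness, so the search goes on for all
  \<open>k\<close>. This makes the state after \<open>k\<close> tests a total function of the first
  \<open>k * n\<close> tape cells; the program follows it up to the first test without a
  witness.\<close>

fun search :: "nat \<Rightarrow> (nat \<Rightarrow> real) \<Rightarrow> real \<times> real \<times> real" where
  "search 0 \<omega> = (1, 0, \<zeta>)"
| "search (Suc k) \<omega> = (let s = reset (search k \<omega>) in bisect s (probe k \<omega> s))"

definition witness :: "nat \<Rightarrow> (nat \<Rightarrow> real) \<Rightarrow> bool" where
  "witness k \<omega> = (let s = reset (search k \<omega>); y = probe k \<omega> s
     in 2 * form (mid s) y < 3 * fst s * dot n y y)"

text \<open>While tests are made, \<zeta> / 2^i is at least the guess, and the guess 1 / 2^j is at
  least \<open>\<xi>s / 4\<close>. The two logarithms are the resulting bounds on i and j.\<close>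

definition max_bisections :: nat where "max_bisections = nat \<lfloor>log 2 (4 * \<zeta> / \<xi>s)\<rfloor>"
definition max_halvings :: nat where "max_halvings = nat \<lfloor>log 2 (4 / \<xi>s)\<rfloor>"

text \<open>Here \<open>j\<close> counts the halvings of the guess and \<open>i\<close> the bisections since the last one.  A
  successful \<open>\<gamma>\<close> stays at distance at least \<open>\<xi>/2\<close> from both ends of the bracket, because
  \<open>\<gamma> \<mapsto> \<lambda>\<^sub>m\<^sub>i\<^sub>n(A(\<gamma>))\<close> is 1-Lipschitz; so a bracket shorter than \<open>\<xi>\<close> refutes the guess.\<close>

definition search_inv :: "nat \<Rightarrow> real \<times> real \<times> real \<Rightarrow> bool" where
  "search_inv k s \<longleftrightarrow> (\<exists>j i. fst s = 1 / 2 ^ j \<and> hi s - lo s = \<zeta> / 2 ^ i \<and> 0 \<le> lo s \<and> hi s \<le> \<zeta> \<and>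
     \<xi>s / 4 \<le> fst s \<and> i \<le> Suc max_bisections \<and> k \<le> j * Suc max_bisections + i \<and>
     (\<forall>\<gamma>\<ge>0. 2 * fst s \<le> lam \<gamma> \<longrightarrow> lo s \<le> \<gamma> - fst s / 2 \<and> \<gamma> + fst s / 2 \<le> hi s))"

section \<open>Soundness and termination of the bisection\<close>

text \<open>By the norm bound on \<open>A1\<close> the form changes by at most |\<gamma>' -
  \<gamma>| times the squared norm of \<open>x\<close>, and 2\<xi> - \<xi>/2 = 3\<xi>/2. This is the
  level used in \<open>witness\<close>.\<close>

lemma form_nearby:
  assumes "2 * \<xi> \<le> lam \<gamma>" "\<bar>\<gamma>' - \<gamma>\<bar> \<le> \<xi> / 2"
  shows "3 * \<xi> / 2 * dot n x x \<le> form \<gamma>' x"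
proof -
  define d where "d = \<xi> * dot n x x"
  have "2 * \<xi> * dot n x x \<le> lam \<gamma> * dot n x x"
    using assms(1) dot_self_nonneg[of n x] by (intro mult_right_mono)
  then have "2 * d \<le> form \<gamma> x" using lam_le_form[of \<gamma> x] by (simp add: d_def)
  moreover have "0 \<le> \<xi>" using assms(2) by linarith
  then have "\<bar>(\<gamma>' - \<gamma>) * dot n x (mv n a1 x)\<bar> \<le> \<xi> / 2 * dot n x x"
    unfolding abs_mult using assms(2) form_A1_bound[of x] by (intro mult_mono) auto
  then have "- (d / 2) \<le> (\<gamma>' - \<gamma>) * dot n x (mv n a1 x)" by (simp only: d_def)
  moreover have "form \<gamma>' x = form \<gamma> x + (\<gamma>' - \<gamma>) * dot n x (mv n a1 x)"
    by (simp add: form_def algebra_simps)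
  ultimately have "3 / 2 * d \<le> form \<gamma>' x" by linarith
  then show ?thesis by (simp add: d_def)
qed

text \<open>If \<gamma> were within \<xi>/2 of 0, then \<open>A0\<close> would be positive definite,
  against its negative eigenvalue. On the other side the pencil is still positive semidefinite at
  \<gamma> + \<xi>/2, which is therefore at most \<open>gamma_plus\<close>.\<close>

lemma initial_bracket:
  assumes \<gamma>: "0 \<le> \<gamma>" and \<xi>: "0 < \<xi>" "2 * \<xi> \<le> lam \<gamma>"
  shows "0 \<le> \<gamma> - \<xi> / 2 \<and> \<gamma> + \<xi> / 2 \<le> \<zeta>"
proof
  show "0 \<le> \<gamma> - \<xi> / 2"
  proof (rule ccontr)
    assume "\<not> 0 \<le> \<gamma> - \<xi> / 2"
    then have "\<bar>0 - \<gamma>\<bar> \<le> \<xi> / 2" using \<gamma> by simp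
    moreover obtain e where "dot n e e = 1" "form 0 e < 0" using negative_direction_A0 by blast
    ultimately show False using form_nearby[OF \<xi>(2), of 0 e] \<xi>(1) by simp
  qed
  show "\<gamma> + \<xi> / 2 \<le> \<zeta>"
  proof (rule psd_le_zeta)
    fix x
    have "0 \<le> 3 * \<xi> / 2 * dot n x x" using \<xi>(1) dot_self_nonneg[of n x] by simp
    then show "0 \<le> form (\<gamma> + \<xi> / 2) x" using form_nearby[OF \<xi>(2), of "\<gamma> + \<xi> / 2" x] \<xi>(1) by simp
  qed (use \<gamma> \<xi>(1) in simp)
qed

lemma search_inv_init: "search_inv 0 (1, 0, \<zeta>)"
  unfolding search_inv_def lo_def hi_def using xi_star_le_1 xi_star_pos initial_bracket[of _ 1]
  by (intro exI[of _ 0]) auto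

lemma search_inv_reset:
  assumes "search_inv k s"
  shows "search_inv k (reset s)" "fst (reset s) \<le> hi (reset s) - lo (reset s)"
proof -
  from assms obtain j i where s: "fst s = 1 / 2 ^ j" "hi s - lo s = \<zeta> / 2 ^ i" "\<xi>s / 4 \<le> fst s"
    "i \<le> Suc max_bisections" "k \<le> j * Suc max_bisections + i"
    and bracket: "\<And>\<gamma>. 0 \<le> \<gamma> \<Longrightarrow> 2 * fst s \<le> lam \<gamma> \<Longrightarrow> lo s \<le> \<gamma> - fst s / 2 \<and> \<gamma> + fst s / 2 \<le> hi s"
    unfolding search_inv_def by blast
  have "search_inv k (reset s) \<and> fst (reset s) \<le> hi (reset s) - lo (reset s)"
  proof (cases "hi s - lo s < fst s")
    case True
    \<comment> \<open>A multiplier of value above twice the guess would need a bracket of length at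
      least the guess. The new guess, half the old one, is thus still at least
      \<open>\<xi>s / 4\<close>.\<close>
    have "\<xi>s \<le> 2 * fst s"
    proof (rule xi_star_le)
      fix \<gamma> :: real assume "0 \<le> \<gamma>"
      show "lam \<gamma> \<le> 2 * fst s"
      proof (rule ccontr)
        assume "\<not> ?thesis"
        then have "lo s \<le> \<gamma> - fst s / 2" "\<gamma> + fst s / 2 \<le> hi s" using bracket[OF \<open>0 \<le> \<gamma>\<close>] by auto
        with True show False by linarith
      qed
    qed
    moreover have pos: "0 < fst s" using s by simp
    moreover have "fst s \<le> 1" using s by (simp add: divide_le_eq)
    moreover from calculation have "fst s / 2 \<le> \<zeta>" using zeta_ge_1 by linarith
    moreover have "k \<le> Suc j * Suc max_bisections + 0" using s by simp
    moreover have "0 \<le> \<gamma> - fst s / 2 / 2 \<and> \<gamma> + fst s / 2 / 2 \<le> \<zeta>"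
      if "0 \<le> \<gamma>" "2 * (fst s / 2) \<le> lam \<gamma>" for \<gamma>
      using initial_bracket[OF that(1) _ that(2)] pos by simp
    moreover have "reset s = (fst s / 2, 0, \<zeta>)" using True by (simp add: reset_def)
    moreover have "fst s / 2 = 1 / 2 ^ Suc j" using s(1) by simp
    ultimately show ?thesis
      unfolding search_inv_def
      by - (rule conjI, rule exI[of _ "Suc j"], rule exI[of _ 0], simp_all add: lo_def hi_def)
  next
    case False
    then show ?thesis using assms by (simp add: reset_def)
  qed
  then show "search_inv k (reset s)" "fst (reset s) \<le> hi (reset s) - lo (reset s)" by simp_all
qed

lemma search_inv_bounds:
  assumes "search_inv k s"
  shows "0 < fst s" "fst s \<le> 1" "0 \<le> mid s" "mid s \<le> \<zeta>" "\<xi>s / 4 \<le> fst s"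
proof -
  from assms obtain j i where s: "fst s = 1 / 2 ^ j" "hi s - lo s = \<zeta> / 2 ^ i" "0 \<le> lo s" "hi s \<le> \<zeta>"
    "\<xi>s / 4 \<le> fst s"
    unfolding search_inv_def by blast
  have "0 \<le> \<zeta> / 2 ^ i" using zeta_ge_1 by simp
  then show "0 < fst s" "fst s \<le> 1" "0 \<le> mid s" "mid s \<le> \<zeta>" "\<xi>s / 4 \<le> fst s"
    using s by (auto simp: mid_def divide_le_eq)
qed

lemma le_nat_floor_log2:
  assumes "2 ^ i \<le> x"
  shows "i \<le> nat \<lfloor>log 2 x\<rfloor>"
proof -
  have "real i \<le> log 2 x" using assms by (simp add: le_log_iff powr_realpow less_le_trans[of 0 "2 ^ i"])
  then show ?thesis by (simp add: le_nat_floor le_floor_iff nat_le_iff)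
qed

text \<open>The form at \<open>y\<close> is affine in the multiplier, with slope the form of
  \<open>A1\<close>. It is smaller at the midpoint than anywhere within half the guess of a good
  multiplier, so this whole neighbourhood lies on the side on which the form increases.\<close>

lemma search_inv_bisect:
  assumes inv: "search_inv k s" and wide: "fst s \<le> hi s - lo s"
    and wit: "2 * form (mid s) y < 3 * fst s * dot n y y"
  shows "search_inv (Suc k) (bisect s y)"
proof -
  from inv obtain j i where s: "fst s = 1 / 2 ^ j" "hi s - lo s = \<zeta> / 2 ^ i" "0 \<le> lo s" "hi s \<le> \<zeta>"
    "\<xi>s / 4 \<le> fst s" "k \<le> j * Suc max_bisections + i"
    and bracket: "\<And>\<gamma>. 0 \<le> \<gamma> \<Longrightarrow> 2 * fst s \<le> lam \<gamma> \<Longrightarrow> lo s \<le> \<gamma> - fst s / 2 \<and> \<gamma> + fst s / 2 \<le> hi s"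
    unfolding search_inv_def by blast
  have "\<xi>s / 4 \<le> \<zeta> / 2 ^ i" using s wide by linarith
  then have "2 ^ i \<le> 4 * \<zeta> / \<xi>s" using xi_star_pos by (simp add: field_simps)
  \<comment> \<open>The bracket is still wide before this bisection, hence no \<open>Suc\<close>
    here. The invariant allows \<open>Suc max_bisections\<close> because the last bisection may
    leave a short bracket, to be discarded by the next \<open>reset\<close>.\<close>
  then have i: "i \<le> max_bisections" unfolding max_bisections_def by (rule le_nat_floor_log2)
  have pos: "0 < fst s" using s by simp
  have cut: "form (mid s) y < form \<gamma>' y" if "2 * fst s \<le> lam \<gamma>" "\<bar>\<gamma>' - \<gamma>\<bar> \<le> fst s / 2" for \<gamma> \<gamma>'
    using form_nearby[OF that, of y] wit by simp
  have new: "(if dot n y (mv n a1 y) \<le> 0 then \<gamma> + fst s / 2 \<le> mid s else mid s \<le> \<gamma> - fst s / 2)"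
    if "2 * fst s \<le> lam \<gamma>" for \<gamma>
  proof (cases "dot n y (mv n a1 y) \<le> 0")
    case True
    have "(\<gamma> + fst s / 2 - mid s) * dot n y (mv n a1 y) > 0"
      using cut[OF that, of "\<gamma> + fst s / 2"] pos by (simp add: form_def algebra_simps)
    then show ?thesis using True by (auto simp: zero_less_mult_iff)
  next
    case False
    have "(\<gamma> - fst s / 2 - mid s) * dot n y (mv n a1 y) > 0"
      using cut[OF that, of "\<gamma> - fst s / 2"] pos by (simp add: form_def algebra_simps)
    then show ?thesis using False by (auto simp: zero_less_mult_iff)
  qed
  have half: "mid s - lo s = \<zeta> / 2 ^ Suc i" "hi s - mid s = \<zeta> / 2 ^ Suc i"
    using s(2) by (simp_all add: mid_def field_simps)
  have z: "0 \<le> \<zeta> / 2 ^ Suc i" using zeta_ge_1 by simp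
  then have m: "0 \<le> mid s" "mid s \<le> \<zeta>" using half s by linarith+
  have "Suc i \<le> Suc max_bisections" "Suc k \<le> j * Suc max_bisections + Suc i" using i s by simp_all
  then show ?thesis
    unfolding search_inv_def bisect_def
    using s(1,3-5) half m bracket new
    by (intro exI[of _ j] exI[of _ "Suc i"]) (auto simp: lo_def hi_def)
qed

lemma search_inv_index_bound:
  assumes inv: "search_inv k s" and wide: "fst s \<le> hi s - lo s"
  shows "k < Suc max_halvings * Suc max_bisections"
proof -
  from inv obtain j i where s: "fst s = 1 / 2 ^ j" "hi s - lo s = \<zeta> / 2 ^ i"
    "\<xi>s / 4 \<le> fst s" "k \<le> j * Suc max_bisections + i"
    unfolding search_inv_def by blast
  have "\<xi>s / 4 \<le> \<zeta> / 2 ^ i" using s wide by linarith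
  then have "2 ^ i \<le> 4 * \<zeta> / \<xi>s" using xi_star_pos by (simp add: field_simps)
  then have i: "i \<le> max_bisections" unfolding max_bisections_def by (rule le_nat_floor_log2)
  have "\<xi>s / 4 \<le> 1 / 2 ^ j" using s(1,3) by simp
  then have "2 ^ j \<le> 4 / \<xi>s" using xi_star_pos by (simp add: field_simps)
  then have j: "j \<le> max_halvings" unfolding max_halvings_def by (rule le_nat_floor_log2)
  have "k \<le> max_halvings * Suc max_bisections + max_bisections"
    using s(4) i mult_le_mono1[OF j, of "Suc max_bisections"] by linarith
  then show ?thesis by simp
qed

lemma search_inv_search: "(\<And>k'. k' < k \<Longrightarrow> witness k' \<omega>) \<Longrightarrow> search_inv k (search k \<omega>)"
proof (induction k)
  case (Suc k)
  then have "search_inv k (search k \<omega>)" "witness k \<omega>" by simp_all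
  then show ?case
    using search_inv_bisect[OF search_inv_reset] by (simp add: witness_def Let_def)
qed (simp add: search_inv_init)

text \<open>Witnesses keep the invariant alive, and the invariant bounds the number of tests.
  Nothing is assumed of the tape, so termination is deterministic.\<close>

lemma first_certificate:
  obtains K where "K < Suc max_halvings * Suc max_bisections" "\<not> witness K \<omega>" "\<And>k. k < K \<Longrightarrow> witness k \<omega>"
proof -
  have ex: "\<exists>k. \<not> witness k \<omega>"
  proof (rule ccontr)
    assume "\<not> ?thesis"
    then have "search_inv k (search k \<omega>)" for k by (intro search_inv_search) auto
    from search_inv_index_bound[OF search_inv_reset[OF this]] show False by blast
  qed
  define K where "K = (LEAST k. \<not> witness k \<omega>)"
  have K: "\<not> witness K \<omega>" unfolding K_def by (rule LeastI_ex[OF ex])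
  have wit: "witness k \<omega>" if "k < K" for k using that not_less_Least unfolding K_def by blast
  then have "search_inv K (search K \<omega>)" by (rule search_inv_search)
  from that[OF search_inv_index_bound[OF search_inv_reset[OF this]] K wit] show ?thesis .
qed

lemma steps_bound:
  assumes \<xi>: "0 < \<xi>" "\<xi> \<le> 1" and \<gamma>: "0 \<le> \<gamma>" and T: "0 \<le> T"
  shows "T\<^sup>2 \<le> \<xi> / (1 + \<gamma>) * (fst (cheb_scalar (1 + \<xi> / (1 + \<gamma>)) (steps \<xi> \<gamma> T)))\<^sup>2"
    and "real (steps \<xi> \<gamma> T) \<le> 1 + ln (2 * T + 2) * 2 * sqrt ((1 + \<gamma>) / \<xi>)"
proof -
  define \<eta> where "\<eta> = \<xi> / (1 + \<gamma>)"
  define m where "m = nat \<lceil>ln (2 * T + 2) * 2 / sqrt \<eta>\<rceil>"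
  have \<eta>: "0 < \<eta>" "\<eta> \<le> 1" using \<xi> \<gamma> by (simp_all add: \<eta>_def divide_le_eq)
  have m: "ln (2 * T + 2) * 2 / sqrt \<eta> \<le> real m" unfolding m_def by (rule real_nat_ceiling_ge)
  note grow = cheb_scalar_growth[OF \<eta> T m]
  from LeastI[of "\<lambda>m. T\<^sup>2 \<le> \<eta> * (fst (cheb_scalar (1 + \<eta>) m))\<^sup>2", OF grow]
  show "T\<^sup>2 \<le> \<xi> / (1 + \<gamma>) * (fst (cheb_scalar (1 + \<xi> / (1 + \<gamma>)) (steps \<xi> \<gamma> T)))\<^sup>2"
    by (simp add: steps_def \<eta>_def)
  have "steps \<xi> \<gamma> T \<le> m"
    using Least_le[of "\<lambda>m. T\<^sup>2 \<le> \<eta> * (fst (cheb_scalar (1 + \<eta>) m))\<^sup>2", OF grow]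
    by (simp add: steps_def \<eta>_def)
  moreover have "0 \<le> ln (2 * T + 2) * 2 / sqrt \<eta>" using T \<eta> by simp
  then have "real m \<le> 1 + ln (2 * T + 2) * 2 / sqrt \<eta>" unfolding m_def by linarith
  moreover have "ln (2 * T + 2) * 2 / sqrt \<eta> = ln (2 * T + 2) * 2 * sqrt ((1 + \<gamma>) / \<xi>)"
    by (simp add: \<eta>_def real_sqrt_divide)
  ultimately show "real (steps \<xi> \<gamma> T) \<le> 1 + ln (2 * T + 2) * 2 * sqrt ((1 + \<gamma>) / \<xi>)"
    by linarith
qed

lemma steps_minimal:
  "m < steps \<xi> \<gamma> T \<Longrightarrow> \<xi> / (1 + \<gamma>) * (fst (cheb_scalar (1 + \<xi> / (1 + \<gamma>)) m))\<^sup>2 < T\<^sup>2"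
  using not_less_Least unfolding steps_def by force

section \<open>The event on which acceptance is correct\<close>

lemma cheb_measurable [measurable]:
  "(\<lambda>\<omega>. fst (cheb n B (\<lambda>i. \<omega> (c + i)) m) i) \<in> borel_measurable random_tape"
  "(\<lambda>\<omega>. snd (cheb n B (\<lambda>i. \<omega> (c + i)) m) i) \<in> borel_measurable random_tape"
proof -
  have "(\<lambda>\<omega>. fst (cheb n B (\<lambda>i. \<omega> (c + i)) m) i) \<in> borel_measurable random_tape \<and>
    (\<lambda>\<omega>. snd (cheb n B (\<lambda>i. \<omega> (c + i)) m) i) \<in> borel_measurable random_tape"
  proof (induction m arbitrary: i)
    case (Suc m)
    have [measurable]: "(\<lambda>\<omega>. fst (cheb n B (\<lambda>i. \<omega> (c + i)) m) i) \<in> borel_measurable random_tape"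
      "(\<lambda>\<omega>. snd (cheb n B (\<lambda>i. \<omega> (c + i)) m) i) \<in> borel_measurable random_tape" for i
      using Suc by simp_all
    show ?case by (simp add: Let_def case_prod_beta mv_def)
  qed simp
  then show "(\<lambda>\<omega>. fst (cheb n B (\<lambda>i. \<omega> (c + i)) m) i) \<in> borel_measurable random_tape"
    "(\<lambda>\<omega>. snd (cheb n B (\<lambda>i. \<omega> (c + i)) m) i) \<in> borel_measurable random_tape" by simp_all
qed

lemma finite_range_search: "finite (range (search k))"
proof (induction k)
  case 0
  have "range (search 0) = {(1, 0, \<zeta>)}" by auto
  then show ?case by simp
next
  case (Suc k)
  have "range (search (Suc k)) \<subseteq>
      (\<Union>s\<in>reset ` range (search k). {(fst s, lo s, mid s), (fst s, mid s, hi s)})"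
    by (auto simp: Let_def bisect_def)
  moreover have "finite \<dots>" by (intro finite_UN_I finite_imageI Suc) simp
  ultimately show ?case by (rule finite_subset)
qed

lemma search_measurable: "{\<omega>. search k \<omega> = s} \<in> sets random_tape"
proof (induction k arbitrary: s)
  case 0
  have "{\<omega>. search 0 \<omega> = s} = (if s = (1, 0, \<zeta>) then space random_tape else {})" by auto
  then show ?case by (metis sets.empty_sets sets.top)
next
  case (Suc k)
  have step: "{\<omega>. bisect s' (probe k \<omega> s') = s} \<in> sets random_tape" for s'
  proof -
    let ?Q = "\<lambda>\<omega>. dot n (probe k \<omega> s') (mv n a1 (probe k \<omega> s'))"
    have Q: "?Q \<in> borel_measurable random_tape" unfolding dot_def mv_def probe_def by measurable
    have le: "{\<omega>\<in>space random_tape. ?Q \<omega> \<le> 0} \<in> sets random_tape"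
      "{\<omega>\<in>space random_tape. \<not> ?Q \<omega> \<le> 0} \<in> sets random_tape"
      using Q by measurable
    have "{\<omega>. bisect s' (probe k \<omega> s') = s} =
        (if (fst s', lo s', mid s') = s then {\<omega>\<in>space random_tape. ?Q \<omega> \<le> 0} else {}) \<union>
        (if (fst s', mid s', hi s') = s then {\<omega>\<in>space random_tape. \<not> ?Q \<omega> \<le> 0} else {})"
      unfolding bisect_def by auto
    then show ?thesis using le by simp
  qed
  have "{\<omega>. search (Suc k) \<omega> = s} =
      (\<Union>s'\<in>range (search k). {\<omega>. search k \<omega> = s'} \<inter> {\<omega>. bisect (reset s') (probe k \<omega> (reset s')) = s})"
    by (auto simp: Let_def)
  also have "\<dots> \<in> sets random_tape"
    using finite_range_search Suc step by (intro sets.finite_UN sets.Int) auto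
  finally show ?case .
qed

lemma cheb_cong:
  assumes "\<And>i. i < n \<Longrightarrow> g i = g' i" "i < n"
  shows "fst (cheb n B g m) i = fst (cheb n B g' m) i \<and> snd (cheb n B g m) i = snd (cheb n B g' m) i"
  using assms(2)
proof (induction m arbitrary: i)
  case (Suc m)
  have "mv n B (\<lambda>i. fst (cheb n B g m) i + snd (cheb n B g m) i) =
      mv n B (\<lambda>i. fst (cheb n B g' m) i + snd (cheb n B g' m) i)"
    using Suc.IH by (intro mv_cong) simp
  then show ?case using Suc.IH[OF Suc.prems] by (simp add: Let_def case_prod_beta)
qed (simp add: assms)

text \<open>Earlier tests read only earlier blocks, so the block of test \<open>k\<close> is fresh
  with respect to the state that fixes its midpoint.\<close>

lemma search_depends: "(\<forall>i<k * n. \<omega> i = \<omega>' i) \<Longrightarrow> search k \<omega> = search k \<omega>'"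
proof (induction k)
  case (Suc k)
  then have IH: "search k \<omega> = search k \<omega>'" by simp
  have P: "probe k \<omega> s i = probe k \<omega>' s i" if "i < n" for s i
    unfolding probe_def using Suc.prems that by (intro cheb_cong[THEN conjunct1]) auto
  have "mv n A (probe k \<omega> s) = mv n A (probe k \<omega>' s)"
    "dot n (probe k \<omega> s) y = dot n (probe k \<omega>' s) y" for A s y
    by (rule mv_cong, rule P, assumption) (rule dot_cong[OF P refl])
  then show ?case by (simp add: IH Let_def bisect_def)
qed simp

text \<open>Chosen as a function of \<gamma> alone, so that the direction to be hit by the random
  vector is determined by the search state.\<close>

definition eigvec :: "real \<Rightarrow> nat \<Rightarrow> real" where
  "eigvec \<gamma> = (SOME e. dot n e e = 1 \<and> (\<forall>i<n. mv n a0 e i + \<gamma> * mv n a1 e i = lam \<gamma> * e i))"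

lemma eigvec:
  "dot n (eigvec \<gamma>) (eigvec \<gamma>) = 1"
  "\<forall>i<n. mv n a0 (eigvec \<gamma>) i + \<gamma> * mv n a1 (eigvec \<gamma>) i = lam \<gamma> * eigvec \<gamma> i"
  using someI_ex[OF lam_eigenvector[of \<gamma>]] unfolding eigvec_def by blast+

text \<open>The radius is the failure probability of test \<open>k\<close> divided by 2 sqrt n, so
  that the small-ball bound returns exactly that probability.\<close>

definition unlucky :: "nat \<Rightarrow> (nat \<Rightarrow> real) set" where
  "unlucky k = {\<omega>. \<bar>dot n (\<lambda>i. \<omega> (k * n + i)) (eigvec (mid (reset (search k \<omega>))))\<bar>
     \<le> p / ((real k + 1) * (real k + 2)) / (2 * sqrt (real n))}"

lemma unlucky_measure:
  "unlucky k \<in> sets random_tape"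
  "measure random_tape (unlucky k) \<le> p / ((real k + 1) * (real k + 2))"
proof -
  let ?\<tau> = "p / ((real k + 1) * (real k + 2)) / (2 * sqrt (real n))"
  have \<tau>: "0 \<le> ?\<tau>" using p_pos by simp
  note * = random_tape_small_ball_adaptive[where \<sigma> = "search k" and c = "k * n" and G = "\<lambda>_. True"
      and n = n and e = "\<lambda>s. eigvec (mid (reset s))", OF finite_range_search search_measurable
      search_depends eigvec(1) \<tau>]
  show "unlucky k \<in> sets random_tape" using *(1) by (simp add: unlucky_def)
  have "2 * ?\<tau> * sqrt (real n) = p / ((real k + 1) * (real k + 2))" using n_pos by simp
  then show "measure random_tape (unlucky k) \<le> p / ((real k + 1) * (real k + 2))"
    using *(2) by (simp add: unlucky_def)
qed

text \<open>Confining all cells to the unit interval costs no probability and bounds the squared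
  norm of each random vector by \<open>n\<close>.\<close>

definition lucky :: "(nat \<Rightarrow> real) set" where
  "lucky = {\<omega>. \<forall>i. \<omega> i \<in> {0..1}} - (\<Union>k. unlucky k)"

lemma unit_cube_tape: "{\<omega>. \<forall>i. \<omega> i \<in> {0..1}} \<in> sets random_tape"
proof -
  have "{\<omega>\<in>space random_tape. \<forall>i. \<omega> i \<in> {0..1}} \<in> sets random_tape" by measurable
  then show ?thesis by simp
qed

lemma lucky_sets: "lucky \<in> sets random_tape"
  unfolding lucky_def using unlucky_measure(1) unit_cube_tape by (intro sets.Diff sets.countable_UN) auto

lemma lucky_measure: "1 - p \<le> measure random_tape lucky"
proof -
  let ?C = "{\<omega>. \<forall>i. \<omega> i \<in> {0..1}} :: (nat \<Rightarrow> real) set"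
  have cube: "measure random_tape ?C = 1"
    using AE_random_tape by (intro random_tape.prob_eq_1[THEN iffD2] unit_cube_tape) simp
  have sums: "(\<lambda>k. p / ((real k + 1) * (real k + 2))) sums p"
  proof -
    have "(\<lambda>k. p / (real k + 1) - p / (real (Suc k) + 1)) sums (p / (real 0 + 1) - 0)"
      by (rule telescope_sums') real_asymp
    moreover have "p / (real k + 1) - p / (real (Suc k) + 1) = p / ((real k + 1) * (real k + 2))" for k
      by (simp add: field_simps)
    ultimately show ?thesis by simp
  qed
  have sumU: "summable (\<lambda>k. measure random_tape (unlucky k))"
    using sums unlucky_measure(2)
    by (intro summable_comparison_test'[OF sums_summable[OF sums], of 0]) auto
  have "measure random_tape (\<Union>k. unlucky k) \<le> (\<Sum>k. measure random_tape (unlucky k))"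
    using unlucky_measure(1) sumU by (intro random_tape.finite_measure_subadditive_countably) auto
  also have "\<dots> \<le> (\<Sum>k. p / ((real k + 1) * (real k + 2)))"
    by (intro suminf_le unlucky_measure(2) sumU sums_summable[OF sums])
  also have "\<dots> = p" using sums by (rule sums_unique[symmetric])
  finally have U: "measure random_tape (\<Union>k. unlucky k) \<le> p" .
  have UN: "(\<Union>k. unlucky k) \<in> sets random_tape" using unlucky_measure(1) by (intro sets.countable_UN) auto
  have "measure random_tape ?C \<le> measure random_tape (lucky \<union> (\<Union>k. unlucky k))"
    using lucky_sets UN by (intro random_tape.finite_measure_mono sets.Un) (auto simp: lucky_def)
  also have "\<dots> \<le> measure random_tape lucky + measure random_tape (\<Union>k. unlucky k)"
    using lucky_sets UN by (rule measure_Un_le)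
  finally show ?thesis using cube U by linarith
qed

lemma certificate_correct:
  assumes \<omega>: "\<omega> \<in> lucky" and inv: "search_inv k (reset (search k \<omega>))" and cert: "\<not> witness k \<omega>"
  shows "fst (reset (search k \<omega>)) \<le> lam (mid (reset (search k \<omega>)))"
proof (rule ccontr)
  define s where "s = reset (search k \<omega>)"
  assume "\<not> ?thesis"
  then have lam: "lam (mid s) < fst s" by (simp add: s_def)
  note bounds = search_inv_bounds[OF inv, folded s_def]
  let ?g = "\<lambda>i. \<omega> (k * n + i)"
  let ?\<delta> = "p / ((real k + 1) * (real k + 2))"
  have kpos: "(real k + 1) * (real k + 2) > 0" by (simp add: add_pos_pos)
  have \<delta>: "?\<delta> > 0" using p_pos kpos by simp
  have T: "threshold k = 3 * real n / ?\<delta>" by (simp add: threshold_def)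
  have T0: "0 \<le> threshold k" using p_pos by (simp add: threshold_def)
  have cell: "0 \<le> \<omega> i" "\<omega> i \<le> 1" for i using \<omega> by (auto simp: lucky_def)
  have "dot n ?g ?g \<le> (\<Sum>i<n. 1 * 1)"
    unfolding dot_def using cell by (intro sum_mono mult_mono) auto
  then have gg: "dot n ?g ?g \<le> real n" by simp
  have "\<omega> \<notin> unlucky k" using \<omega> by (auto simp: lucky_def)
  then have "?\<delta> / (2 * sqrt (real n)) \<le> \<bar>dot n ?g (eigvec (mid s))\<bar>"
    by (simp add: unlucky_def s_def)
  then have "(?\<delta> / (2 * sqrt (real n)))\<^sup>2 \<le> (dot n ?g (eigvec (mid s)))\<^sup>2"
    using p_pos by (subst abs_le_square_iff[symmetric]) simp
  then have "(?\<delta> / (2 * sqrt (real n)))\<^sup>2 * (threshold k)\<^sup>2 \<le> (dot n ?g (eigvec (mid s)))\<^sup>2 * (threshold k)\<^sup>2"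
    by (intro mult_right_mono) auto
  \<comment> \<open>The origin of the 3 in \<open>threshold\<close>: (3/2)^2 = 9/4 exceeds the 2
    required by \<open>witness_if_lam_less\<close>.\<close>
  moreover have "(?\<delta> / (2 * sqrt (real n)))\<^sup>2 * (threshold k)\<^sup>2 = 9 / 4 * real n"
  proof -
    have "(d / (2 * sqrt (real n)))\<^sup>2 * (3 * real n / d)\<^sup>2 = 9 / 4 * real n" if "d > 0" for d
      using that n_pos by (simp add: power_divide power_mult_distrib) (simp add: power2_eq_square)
    from this[OF \<delta>] show ?thesis by (simp only: T)
  qed
  ultimately have "9 / 4 * real n \<le> (dot n ?g (eigvec (mid s)))\<^sup>2 * (threshold k)\<^sup>2"
    by (simp only:)
  moreover have "0 < real n" using n_pos by simp
  ultimately have "2 * dot n ?g ?g < (dot n ?g (eigvec (mid s)))\<^sup>2 * (threshold k)\<^sup>2"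
    using gg by linarith
  from witness_if_lam_less[OF bounds(3) bounds(1) lam eigvec this
      steps_bound(1)[OF bounds(1,2,3) T0] refl]
  have "witness k \<omega>" by (simp add: witness_def Let_def probe_def s_def)
  with cert show False by simp
qed

end

section \<open>Time-bounded execution\<close>

text \<open>Total correctness with a time budget. By \<open>exec_deterministic\<close> the execution
  whose existence is claimed is the only one on the tape \<omega>.\<close>

definition runs :: "(nat \<Rightarrow> real) \<Rightarrow> com \<Rightarrow> state \<Rightarrow> nat \<Rightarrow> (state \<Rightarrow> bool) \<Rightarrow> bool" where
  "runs \<omega> c s T P \<longleftrightarrow> (\<exists>t s'. exec \<omega> c s t s' \<and> t \<le> T \<and> P s')"

lemma runs_weaken:
  "runs \<omega> c s T P \<Longrightarrow> T \<le> T' \<Longrightarrow> (\<And>s'. P s' \<Longrightarrow> P' s') \<Longrightarrow> runs \<omega> c s T' P'"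
  unfolding runs_def using le_trans by blast

lemma runs_SeqI:
  assumes "runs \<omega> c s T P" "\<And>s'. P s' \<Longrightarrow> runs \<omega> d s' U Q" "T + U \<le> V"
  shows "runs \<omega> (Seq c d) s V Q"
proof -
  from assms(1) obtain t s' where 1: "exec \<omega> c s t s'" "t \<le> T" "P s'" by (auto simp: runs_def)
  from assms(2)[OF 1(3)] obtain u s'' where 2: "exec \<omega> d s' u s''" "u \<le> U" "Q s''"
    by (auto simp: runs_def)
  from exec.Seq[OF 1(1) 2(1)] 1(2) 2(2,3) assms(3) show ?thesis
    unfolding runs_def by (intro exI[of _ "t + u"] exI[of _ s'']) auto
qed

lemma runs_atomic:
  "runs \<omega> (NAssign x e) s T P \<longleftrightarrow> Suc (ncost e) \<le> T \<and> P (s\<lparr>nvar := (nvar s)(x := nval e s)\<rparr>)"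
  "runs \<omega> (RAssign x d) s T P \<longleftrightarrow> Suc (rcost d) \<le> T \<and> P (s\<lparr>rvar := (rvar s)(x := rval d s)\<rparr>)"
  "runs \<omega> (RStore a e d) s T P \<longleftrightarrow> Suc (ncost e + rcost d) \<le> T \<and>
     P (s\<lparr>rarr := (rarr s)(a := (rarr s a)(nval e s := rval d s))\<rparr>)"
  "runs \<omega> (Draw x) s T P \<longleftrightarrow> Suc 0 \<le> T \<and>
     P (s\<lparr>rvar := (rvar s)(x := \<omega> (drawn s)), drawn := Suc (drawn s)\<rparr>)"
  "runs \<omega> Skip s T P \<longleftrightarrow> Suc 0 \<le> T \<and> P s"
  unfolding runs_def
  by (auto elim!: exec_NAssignE exec_RAssignE exec_RStoreE exec_DrawE exec_SkipE
      intro: exec.NAssign[simplified] exec.RAssign[simplified] exec.RStore[simplified]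
        exec.Draw[simplified] exec.Skip[simplified])

lemma runs_Seq_if_exact:
  assumes "exec \<omega> c s t s'" "t \<le> T" "runs \<omega> d s' (T - t) P"
  shows "runs \<omega> (Seq c d) s T P"
proof -
  from assms(3) obtain u s'' where "exec \<omega> d s' u s''" "u \<le> T - t" "P s''" by (auto simp: runs_def)
  with exec.Seq[OF assms(1)] assms(2) show ?thesis
    unfolding runs_def by (intro exI[of _ "t + u"] exI[of _ s'']) auto
qed

lemma runs_Seq_atomic:
  "Suc (ncost e) \<le> T \<and> runs \<omega> c (s\<lparr>nvar := (nvar s)(x := nval e s)\<rparr>) (T - Suc (ncost e)) P \<Longrightarrow>
     runs \<omega> (Seq (NAssign x e) c) s T P"
  "Suc (rcost d) \<le> T \<and> runs \<omega> c (s\<lparr>rvar := (rvar s)(x := rval d s)\<rparr>) (T - Suc (rcost d)) P \<Longrightarrow>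
     runs \<omega> (Seq (RAssign x d) c) s T P"
  "Suc (ncost e + rcost d) \<le> T \<and>
     runs \<omega> c (s\<lparr>rarr := (rarr s)(a := (rarr s a)(nval e s := rval d s))\<rparr>) (T - Suc (ncost e + rcost d)) P \<Longrightarrow>
     runs \<omega> (Seq (RStore a e d) c) s T P"
  "Suc 0 \<le> T \<and> runs \<omega> c (s\<lparr>rvar := (rvar s)(x := \<omega> (drawn s)), drawn := Suc (drawn s)\<rparr>) (T - Suc 0) P \<Longrightarrow>
     runs \<omega> (Seq (Draw x) c) s T P"
  using exec.NAssign[of \<omega> x e s] exec.RAssign[of \<omega> x d s] exec.RStore[of \<omega> a e d s] exec.Draw[of \<omega> x s]
  by (auto intro: runs_Seq_if_exact)

lemma runs_Cond:
  assumes "bval b s \<Longrightarrow> runs \<omega> c s T P" "\<not> bval b s \<Longrightarrow> runs \<omega> d s T P" "1 + bcost b + T \<le> U"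
  shows "runs \<omega> (Cond b c d) s U P"
proof (cases "bval b s")
  case True
  with assms(1) obtain t s' where "exec \<omega> c s t s'" "t \<le> T" "P s'" by (auto simp: runs_def)
  with exec.CondTrue[OF True this(1)] assms(3) show ?thesis
    unfolding runs_def by (intro exI[of _ "1 + bcost b + t"] exI[of _ s']) auto
next
  case False
  with assms(2) obtain t s' where "exec \<omega> d s t s'" "t \<le> T" "P s'" by (auto simp: runs_def)
  with exec.CondFalse[OF False this(1)] assms(3) show ?thesis
    unfolding runs_def by (intro exI[of _ "1 + bcost b + t"] exI[of _ s']) auto
qed

text \<open>The invariant is indexed by the iteration and \<open>N\<close> is the exact number of
  iterations, so loops with a data-dependent exit are covered as well as counted ones.\<close>

lemma runs_While:
  assumes init: "I 0 s"
    and step: "\<And>m s. m < N \<Longrightarrow> I m s \<Longrightarrow> bval b s \<and> runs \<omega> c s T (I (Suc m))"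
    and stop: "\<And>s. I N s \<Longrightarrow> \<not> bval b s"
    and time: "N * (1 + bcost b + T) + (1 + bcost b) \<le> U"
  shows "runs \<omega> (While b c) s U (I N)"
proof -
  have "I (N - j) s \<Longrightarrow> runs \<omega> (While b c) s (j * (1 + bcost b + T) + (1 + bcost b)) (I N)"
    if "j \<le> N" for j s
    using that
  proof (induction j arbitrary: s)
    case 0
    then show ?case
      using exec.WhileFalse[OF stop, of s] by (auto simp: runs_def)
  next
    case (Suc j)
    then have "N - Suc j < N" by simp
    from step[OF this Suc.prems(1)] have b: "bval b s" and r: "runs \<omega> c s T (I (Suc (N - Suc j)))"
      by auto
    have "Suc (N - Suc j) = N - j" using Suc.prems(2) by simp
    with r obtain t s' where c: "exec \<omega> c s t s'" "t \<le> T" "I (N - j) s'" by (auto simp: runs_def)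
    from Suc.IH[OF c(3)] Suc.prems(2) obtain u s'' where
      w: "exec \<omega> (While b c) s' u s''" "u \<le> j * (1 + bcost b + T) + (1 + bcost b)" "I N s''"
      by (auto simp: runs_def)
    from exec.WhileTrue[OF b c(1) w(1)] c(2) w(2,3) show ?case
      unfolding runs_def by (intro exI[of _ "1 + bcost b + t + u"] exI[of _ s'']) auto
  qed
  from this[of N s] init have "runs \<omega> (While b c) s (N * (1 + bcost b + T) + (1 + bcost b)) (I N)" by simp
  then show ?thesis using time by (rule runs_weaken)
qed

definition for_loop :: "vname \<Rightarrow> com \<Rightarrow> com" where
  "for_loop bnd body = Seq (NAssign ''i'' (NConst 0))
     (While (NLe (NAdd (NVar ''i'') (NConst 1)) (NVar bnd))
       (Seq body (NAssign ''i'' (NAdd (NVar ''i'') (NConst 1)))))"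

lemma runs_for_loop:
  assumes init: "I 0 (s\<lparr>nvar := (nvar s)(''i'' := 0)\<rparr>)"
    and ctr: "\<And>m s. I m s \<Longrightarrow> nvar s ''i'' = m \<and> nvar s bnd = N"
    and step: "\<And>m s. m < N \<Longrightarrow> I m s \<Longrightarrow>
      runs \<omega> body s 90 (\<lambda>s'. I (Suc m) (s'\<lparr>nvar := (nvar s')(''i'' := Suc (nvar s' ''i''))\<rparr>))"
  shows "runs \<omega> (for_loop bnd body) s (100 * Suc N) (I N)"
  unfolding for_loop_def
proof (rule runs_Seq_atomic(1), intro conjI)
  show "runs \<omega> (While (NLe (NAdd (NVar ''i'') (NConst 1)) (NVar bnd))
      (Seq body (NAssign ''i'' (NAdd (NVar ''i'') (NConst 1)))))
    (s\<lparr>nvar := (nvar s)(''i'' := nval (NConst 0) s)\<rparr>) (100 * Suc N - Suc (ncost (NConst 0))) (I N)"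
  \<comment> \<open>The body takes at most 90 units and the increment 4; each test of the guard adds
    6, which makes 100 per iteration.\<close>
  proof (rule runs_While[where T = 94])
    fix m s assume m: "m < N" and I: "I m s"
    have "runs \<omega> (Seq body (NAssign ''i'' (NAdd (NVar ''i'') (NConst 1)))) s 94 (I (Suc m))"
      by (rule runs_SeqI[OF step[OF m I], where U = 4]) (simp_all add: runs_atomic)
    then show "bval (NLe (NAdd (NVar ''i'') (NConst 1)) (NVar bnd)) s \<and>
        runs \<omega> (Seq body (NAssign ''i'' (NAdd (NVar ''i'') (NConst 1)))) s 94 (I (Suc m))"
      using ctr[OF I] m by simp
  next
    fix s assume "I N s"
    from ctr[OF this] show "\<not> bval (NLe (NAdd (NVar ''i'') (NConst 1)) (NVar bnd)) s" by simp
  qed (use init in auto)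
qed simp

definition frame :: "vname set \<Rightarrow> vname set \<Rightarrow> vname set \<Rightarrow> state \<Rightarrow> state \<Rightarrow> bool" where
  "frame NV RV RA s s' \<longleftrightarrow> (\<forall>x. x \<notin> NV \<longrightarrow> nvar s' x = nvar s x) \<and>
     (\<forall>x. x \<notin> RV \<longrightarrow> rvar s' x = rvar s x) \<and> narr s' = narr s \<and>
     (\<forall>a. a \<notin> RA \<longrightarrow> rarr s' a = rarr s a)"

section \<open>Subroutines on arrays\<close>

definition zero_u :: com where
  "zero_u = for_loop ''n'' (RStore ''u'' (NVar ''i'') (RConst 0))"

lemma runs_zero_u:
  "runs \<omega> zero_u s (100 * Suc (nvar s ''n'')) (\<lambda>s'. frame {''i''} {} {''u''} s s' \<and> drawn s' = drawn s \<and>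
     (\<forall>i<nvar s ''n''. rarr s' ''u'' i = 0))"
  unfolding zero_u_def
  by (rule runs_weaken[OF runs_for_loop[where N = "nvar s ''n''" and I = "\<lambda>m s'. nvar s' ''i'' = m \<and>
      frame {''i''} {} {''u''} s s' \<and> drawn s' = drawn s \<and> (\<forall>i<m. rarr s' ''u'' i = 0)"]])
    (auto simp: runs_atomic frame_def less_Suc_eq)

definition add_product :: "vname \<Rightarrow> vname \<Rightarrow> vname \<Rightarrow> vname \<Rightarrow> rexp \<Rightarrow> com" where
  "add_product nnz rw cl val c = for_loop nnz
     (RStore ''u'' (NArr rw (NVar ''i'')) (RAdd (RArr ''u'' (NArr rw (NVar ''i'')))
        (RMul c (RMul (RArr val (NVar ''i''))
          (RAdd (RArr ''w'' (NArr cl (NVar ''i''))) (RArr ''v'' (NArr cl (NVar ''i''))))))))"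

text \<open>Summing over the coordinate list, in whatever order, agrees with the full double sum for
  any summand vanishing at zero entries; both the matrix-vector product and the quadratic form are
  of this kind.\<close>

lemma sum_nonzeros:
  assumes xs: "lists_nonzeros xs A" and A: "A \<in> carrier_mat n n"
    and F: "\<And>i j. A $$ (i, j) = 0 \<Longrightarrow> F (i, j) = 0"
  shows "(\<Sum>k<length xs. F (xs ! k)) = (\<Sum>i<n. \<Sum>j<n. F (i, j) :: real)"
proof -
  have "(\<Sum>k<length xs. F (xs ! k)) = sum_list (map F xs)"
    by (simp add: sum_list_sum_nth atLeast0LessThan)
  also have "\<dots> = sum F (nonzeros A)"
    using xs by (simp add: lists_nonzeros_def sum_list_distinct_conv_sum_set)
  also have "\<dots> = sum F ({..<n} \<times> {..<n})"
    using A F by (intro sum.mono_neutral_left) (auto simp: nonzeros_def)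
  also have "\<dots> = (\<Sum>i<n. \<Sum>j<n. F (i, j))"
    by (simp add: sum.cartesian_product)
  finally show ?thesis .
qed

lemma sum_nonzeros_row:
  assumes xs: "lists_nonzeros xs A" and A: "A \<in> carrier_mat n n" and i: "i < n"
  shows "(\<Sum>k<length xs. if fst (xs ! k) = i then A $$ (xs ! k) * z (snd (xs ! k)) else 0)
    = mv n (mfun A) z i"
proof -
  have "(\<Sum>k<length xs. if fst (xs ! k) = i then A $$ (xs ! k) * z (snd (xs ! k)) else 0)
      = (\<Sum>i'<n. \<Sum>j<n. if fst (i', j) = i then A $$ (i', j) * z (snd (i', j)) else 0)"
    by (rule sum_nonzeros[OF xs A]) auto
  also have "\<dots> = (\<Sum>i'<n. if i' = i then (\<Sum>j<n. A $$ (i', j) * z j) else 0)"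
    by (intro sum.cong) auto
  also have "\<dots> = mv n (mfun A) z i" using i by (simp add: mv_def mfun_def)
  finally show ?thesis .
qed

lemma sum_nonzeros_form:
  assumes xs: "lists_nonzeros xs A" and A: "A \<in> carrier_mat n n"
  shows "(\<Sum>k<length xs. A $$ (xs ! k) * (z (fst (xs ! k)) * z (snd (xs ! k)))) = dot n z (mv n (mfun A) z)"
proof -
  have "(\<Sum>k<length xs. A $$ (xs ! k) * (z (fst (xs ! k)) * z (snd (xs ! k))))
      = (\<Sum>i<n. \<Sum>j<n. A $$ (i, j) * (z (fst (i, j)) * z (snd (i, j))))"
    by (rule sum_nonzeros[OF xs A]) auto
  then show ?thesis by (simp add: dot_def mv_def mfun_def sum_distrib_left mult_ac)
qed

definition holds_matrix :: "state \<Rightarrow> vname \<Rightarrow> vname \<Rightarrow> vname \<Rightarrow> vname \<Rightarrow> (nat \<times> nat) list \<Rightarrow> real mat \<Rightarrow> bool" where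
  "holds_matrix s nnz rw cl val xs A \<longleftrightarrow> nvar s nnz = length xs \<and>
     (\<forall>k<length xs. narr s rw k = fst (xs ! k) \<and> narr s cl k = snd (xs ! k) \<and> rarr s val k = A $$ (xs ! k))"

lemma runs_add_product:
  assumes hold: "holds_matrix s nnz rw cl val xs A" and names: "nnz \<noteq> ''i''" "val \<noteq> ''u''"
    and xs: "lists_nonzeros xs A" and A: "A \<in> carrier_mat n n"
    and c: "\<And>s'. rvar s' = rvar s \<Longrightarrow> rval c s' = cv" "rcost c = 1"
  shows "runs \<omega> (add_product nnz rw cl val c) s (100 * Suc (length xs))
    (\<lambda>s'. frame {''i''} {} {''u''} s s' \<and> drawn s' = drawn s \<and>
      (\<forall>i<n. rarr s' ''u'' i = rarr s ''u'' i + cv * mv n (mfun A) (\<lambda>j. rarr s ''w'' j + rarr s ''v'' j) i))"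
proof -
  let ?z = "\<lambda>j. rarr s ''w'' j + rarr s ''v'' j"
  \<comment> \<open>The entries come in arbitrary order, so the partial sums of all rows are tracked
    at once.\<close>
  let ?I = "\<lambda>m s'. nvar s' ''i'' = m \<and> frame {''i''} {} {''u''} s s' \<and> drawn s' = drawn s \<and>
    (\<forall>i. rarr s' ''u'' i = rarr s ''u'' i +
      cv * (\<Sum>k<m. if fst (xs ! k) = i then A $$ (xs ! k) * ?z (snd (xs ! k)) else 0))"
  have "runs \<omega> (add_product nnz rw cl val c) s (100 * Suc (length xs)) (?I (length xs))"
    unfolding add_product_def
  proof (rule runs_for_loop)
    fix m s' assume m: "m < length xs" and I: "?I m s'"
    have rv: "rvar s' = rvar s" using I by (auto simp: frame_def)
    have val: "narr s' rw m = fst (xs ! m)" "narr s' cl m = snd (xs ! m)" "rarr s' val m = A $$ (xs ! m)"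
      "rarr s' ''w'' = rarr s ''w''" "rarr s' ''v'' = rarr s ''v''"
      using I hold m names by (auto simp: frame_def holds_matrix_def)
    show "runs \<omega> (RStore ''u'' (NArr rw (NVar ''i'')) (RAdd (RArr ''u'' (NArr rw (NVar ''i'')))
        (RMul c (RMul (RArr val (NVar ''i''))
          (RAdd (RArr ''w'' (NArr cl (NVar ''i''))) (RArr ''v'' (NArr cl (NVar ''i'')))))))) s' 90
      (\<lambda>s'. ?I (Suc m) (s'\<lparr>nvar := (nvar s')(''i'' := Suc (nvar s' ''i''))\<rparr>))"
      using I val c(1)[OF rv] c(2) by (auto simp: runs_atomic frame_def algebra_simps)
  qed (use hold names in \<open>auto simp: frame_def holds_matrix_def\<close>)
  then show ?thesis
    by (rule runs_weaken) (auto simp: sum_nonzeros_row[OF xs A, of _ ?z])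
qed

definition add_form :: "vname \<Rightarrow> vname \<Rightarrow> vname \<Rightarrow> vname \<Rightarrow> vname \<Rightarrow> com" where
  "add_form nnz rw cl val acc = Seq (RAssign acc (RConst 0)) (for_loop nnz
     (RAssign acc (RAdd (RVar acc) (RMul (RArr val (NVar ''i''))
        (RMul (RArr ''w'' (NArr rw (NVar ''i''))) (RArr ''w'' (NArr cl (NVar ''i''))))))))"

lemma runs_add_form:
  assumes hold: "holds_matrix s nnz rw cl val xs A" and names: "nnz \<noteq> ''i''"
    and xs: "lists_nonzeros xs A" and A: "A \<in> carrier_mat n n"
  shows "runs \<omega> (add_form nnz rw cl val acc) s (2 + 100 * Suc (length xs))
    (\<lambda>s'. frame {''i''} {acc} {} s s' \<and> drawn s' = drawn s \<and>
      rvar s' acc = dot n (rarr s ''w'') (mv n (mfun A) (rarr s ''w'')))"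
proof -
  let ?z = "rarr s ''w''"
  let ?I = "\<lambda>m s'. nvar s' ''i'' = m \<and> frame {''i''} {acc} {} s s' \<and> drawn s' = drawn s \<and>
    rvar s' acc = (\<Sum>k<m. A $$ (xs ! k) * (?z (fst (xs ! k)) * ?z (snd (xs ! k))))"
  have "runs \<omega> (for_loop nnz
     (RAssign acc (RAdd (RVar acc) (RMul (RArr val (NVar ''i''))
        (RMul (RArr ''w'' (NArr rw (NVar ''i''))) (RArr ''w'' (NArr cl (NVar ''i'')))))))) 
     (s\<lparr>rvar := (rvar s)(acc := 0)\<rparr>) (100 * Suc (length xs)) (?I (length xs))"
  proof (rule runs_for_loop)
    fix m s' assume m: "m < length xs" and I: "?I m s'"
    have val: "narr s' rw m = fst (xs ! m)" "narr s' cl m = snd (xs ! m)" "rarr s' val m = A $$ (xs ! m)"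
      "rarr s' ''w'' = rarr s ''w''"
      using I hold m by (auto simp: frame_def holds_matrix_def)
    show "runs \<omega> (RAssign acc (RAdd (RVar acc) (RMul (RArr val (NVar ''i''))
        (RMul (RArr ''w'' (NArr rw (NVar ''i''))) (RArr ''w'' (NArr cl (NVar ''i''))))))) s' 90
      (\<lambda>s'. ?I (Suc m) (s'\<lparr>nvar := (nvar s')(''i'' := Suc (nvar s' ''i''))\<rparr>))"
      using I val by (auto simp: runs_atomic frame_def)
  qed (use hold names in \<open>auto simp: frame_def holds_matrix_def\<close>)
  then have "runs \<omega> (add_form nnz rw cl val acc) s (2 + 100 * Suc (length xs)) (?I (length xs))"
    unfolding add_form_def by (intro runs_Seq_atomic) simp
  then show ?thesis
    by (rule runs_weaken) (auto simp: sum_nonzeros_form[OF xs A])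
qed

definition norm_w :: com where
  "norm_w = Seq (RAssign ''nn'' (RConst 0)) (for_loop ''n''
     (RAssign ''nn'' (RAdd (RVar ''nn'') (RMul (RArr ''w'' (NVar ''i'')) (RArr ''w'' (NVar ''i''))))))"

lemma runs_norm_w:
  "runs \<omega> norm_w s (2 + 100 * Suc (nvar s ''n'')) (\<lambda>s'. frame {''i''} {''nn''} {} s s' \<and> drawn s' = drawn s \<and>
     rvar s' ''nn'' = dot (nvar s ''n'') (rarr s ''w'') (rarr s ''w''))"
proof -
  let ?I = "\<lambda>m s'. nvar s' ''i'' = m \<and> frame {''i''} {''nn''} {} s s' \<and> drawn s' = drawn s \<and>
    rvar s' ''nn'' = dot m (rarr s ''w'') (rarr s ''w'')"
  have "runs \<omega> (for_loop ''n''
     (RAssign ''nn'' (RAdd (RVar ''nn'') (RMul (RArr ''w'' (NVar ''i'')) (RArr ''w'' (NVar ''i''))))))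
     (s\<lparr>rvar := (rvar s)(''nn'' := 0)\<rparr>) (100 * Suc (nvar s ''n'')) (?I (nvar s ''n''))"
    by (rule runs_for_loop) (auto simp: runs_atomic frame_def dot_def)
  then have "runs \<omega> norm_w s (2 + 100 * Suc (nvar s ''n'')) (?I (nvar s ''n''))"
    unfolding norm_w_def by (intro runs_Seq_atomic) simp
  then show ?thesis by (rule runs_weaken) auto
qed

text \<open>The machine cannot convert naturals to reals; \<open>rn\<close> is therefore counted up
  to n by real additions, for use in the threshold.\<close>

definition draw_block :: com where
  "draw_block = Seq (RAssign ''rn'' (RConst 0)) (for_loop ''n''
     (Seq (Draw ''x'') (Seq (RStore ''w'' (NVar ''i'') (RVar ''x'')) (Seq (RStore ''v'' (NVar ''i'') (RVar ''x''))
       (RAssign ''rn'' (RAdd (RVar ''rn'') (RConst 1)))))))"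

lemma runs_draw_block:
  "runs \<omega> draw_block s (2 + 100 * Suc (nvar s ''n'')) (\<lambda>s'. frame {''i''} {''rn'', ''x''} {''w'', ''v''} s s' \<and>
     drawn s' = drawn s + nvar s ''n'' \<and> rvar s' ''rn'' = real (nvar s ''n'') \<and>
     (\<forall>i<nvar s ''n''. rarr s' ''w'' i = \<omega> (drawn s + i) \<and> rarr s' ''v'' i = \<omega> (drawn s + i)))"
proof -
  let ?I = "\<lambda>m s'. nvar s' ''i'' = m \<and> frame {''i''} {''rn'', ''x''} {''w'', ''v''} s s' \<and>
     drawn s' = drawn s + m \<and> rvar s' ''rn'' = real m \<and>
     (\<forall>i<m. rarr s' ''w'' i = \<omega> (drawn s + i) \<and> rarr s' ''v'' i = \<omega> (drawn s + i))"
  have "runs \<omega> (for_loop ''n''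
     (Seq (Draw ''x'') (Seq (RStore ''w'' (NVar ''i'') (RVar ''x'')) (Seq (RStore ''v'' (NVar ''i'') (RVar ''x''))
       (RAssign ''rn'' (RAdd (RVar ''rn'') (RConst 1)))))))
     (s\<lparr>rvar := (rvar s)(''rn'' := 0)\<rparr>) (100 * Suc (nvar s ''n'')) (?I (nvar s ''n''))"
  proof (rule runs_for_loop)
    fix m s' assume "m < nvar s ''n''" "?I m s'"
    then show "runs \<omega> (Seq (Draw ''x'') (Seq (RStore ''w'' (NVar ''i'') (RVar ''x''))
        (Seq (RStore ''v'' (NVar ''i'') (RVar ''x'')) (RAssign ''rn'' (RAdd (RVar ''rn'') (RConst 1)))))) s' 90
      (\<lambda>s'. ?I (Suc m) (s'\<lparr>nvar := (nvar s')(''i'' := Suc (nvar s' ''i''))\<rparr>))"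
      by (intro runs_Seq_atomic conjI) (auto simp: runs_atomic frame_def less_Suc_eq intro!: runs_Seq_atomic)
  qed (auto simp: frame_def)
  then have "runs \<omega> draw_block s (2 + 100 * Suc (nvar s ''n'')) (?I (nvar s ''n''))"
    unfolding draw_block_def by (intro runs_Seq_atomic) simp
  then show ?thesis by (rule runs_weaken) auto
qed

definition update_wv :: com where
  "update_wv = for_loop ''n''
     (Seq (RAssign ''t'' (RSub
         (RMul (RAdd (RConst 1) (RDiv (RMul (RConst 3) (RVar ''xi'')) (RAdd (RConst 1) (RVar ''gamma''))))
               (RAdd (RArr ''w'' (NVar ''i'')) (RArr ''v'' (NVar ''i''))))
         (RMul (RDiv (RConst 2) (RAdd (RConst 1) (RVar ''gamma''))) (RArr ''u'' (NVar ''i'')))))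
     (Seq (RAssign ''x'' (RArr ''w'' (NVar ''i'')))
     (Seq (RStore ''w'' (NVar ''i'') (RAdd (RVar ''t'') (RArr ''v'' (NVar ''i''))))
          (RStore ''v'' (NVar ''i'') (RSub (RVar ''t'') (RVar ''x''))))))"

lemma runs_update_wv:
  defines "b \<equiv> \<lambda>s i. (1 + 3 * rvar s ''xi'' / (1 + rvar s ''gamma'')) * (rarr s ''w'' i + rarr s ''v'' i)
     - 2 / (1 + rvar s ''gamma'') * rarr s ''u'' i"
  shows "runs \<omega> update_wv s (100 * Suc (nvar s ''n'')) (\<lambda>s'. frame {''i''} {''t'', ''x''} {''w'', ''v''} s s' \<and>
     drawn s' = drawn s \<and>
     (\<forall>i<nvar s ''n''. rarr s' ''w'' i = b s i + rarr s ''v'' i \<and> rarr s' ''v'' i = b s i - rarr s ''w'' i))"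
proof -
  \<comment> \<open>The update is in place, so the invariant must also say that entries from
    \<open>m\<close> on still have their old values.\<close>
  let ?I = "\<lambda>m s'. nvar s' ''i'' = m \<and> frame {''i''} {''t'', ''x''} {''w'', ''v''} s s' \<and> drawn s' = drawn s \<and>
     (\<forall>i<m. rarr s' ''w'' i = b s i + rarr s ''v'' i \<and> rarr s' ''v'' i = b s i - rarr s ''w'' i) \<and>
     (\<forall>i\<ge>m. rarr s' ''w'' i = rarr s ''w'' i \<and> rarr s' ''v'' i = rarr s ''v'' i)"
  have "runs \<omega> update_wv s (100 * Suc (nvar s ''n'')) (?I (nvar s ''n''))"
    unfolding update_wv_def
  proof (rule runs_for_loop)
    fix m s' assume m: "m < nvar s ''n''" and I: "?I m s'"
    then have val: "rvar s' ''xi'' = rvar s ''xi''" "rvar s' ''gamma'' = rvar s ''gamma''"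
      "rarr s' ''u'' = rarr s ''u''" "rarr s' ''w'' m = rarr s ''w'' m" "rarr s' ''v'' m = rarr s ''v'' m"
      by (auto simp: frame_def)
    show "runs \<omega> (Seq (RAssign ''t'' (RSub
         (RMul (RAdd (RConst 1) (RDiv (RMul (RConst 3) (RVar ''xi'')) (RAdd (RConst 1) (RVar ''gamma''))))
               (RAdd (RArr ''w'' (NVar ''i'')) (RArr ''v'' (NVar ''i''))))
         (RMul (RDiv (RConst 2) (RAdd (RConst 1) (RVar ''gamma''))) (RArr ''u'' (NVar ''i'')))))
     (Seq (RAssign ''x'' (RArr ''w'' (NVar ''i'')))
     (Seq (RStore ''w'' (NVar ''i'') (RAdd (RVar ''t'') (RArr ''v'' (NVar ''i''))))
          (RStore ''v'' (NVar ''i'') (RSub (RVar ''t'') (RVar ''x'')))))) s' 90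
      (\<lambda>s'. ?I (Suc m) (s'\<lparr>nvar := (nvar s')(''i'' := Suc (nvar s' ''i''))\<rparr>))"
      using I val
      by (intro runs_Seq_atomic conjI)
        (auto simp: runs_atomic frame_def less_Suc_eq b_def intro!: runs_Seq_atomic)
  qed (auto simp: frame_def)
  then show ?thesis by (rule runs_weaken) auto
qed

definition update_scalars :: com where
  "update_scalars =
     Seq (RAssign ''t'' (RMul (RAdd (RConst 1) (RVar ''eta'')) (RAdd (RVar ''cw'') (RVar ''cv''))))
     (Seq (RAssign ''x'' (RVar ''cw''))
     (Seq (RAssign ''cw'' (RAdd (RVar ''t'') (RVar ''cv'')))
          (RAssign ''cv'' (RSub (RVar ''t'') (RVar ''x'')))))"

lemma runs_update_scalars:
  "runs \<omega> update_scalars s 100 (\<lambda>s'. frame {} {''t'', ''x'', ''cw'', ''cv''} {} s s' \<and> drawn s' = drawn s \<and>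
     rvar s' ''cw'' = (1 + rvar s ''eta'') * (rvar s ''cw'' + rvar s ''cv'') + rvar s ''cv'' \<and>
     rvar s' ''cv'' = (1 + rvar s ''eta'') * (rvar s ''cw'' + rvar s ''cv'') - rvar s ''cw'')"
  unfolding update_scalars_def
  by (intro runs_Seq_atomic conjI) (auto simp: runs_atomic frame_def intro!: runs_Seq_atomic)

section \<open>The program\<close>

definition chebyshev_step :: com where
  "chebyshev_step = Seq zero_u (Seq (add_product ''nnz0'' ''row0'' ''col0'' ''val0'' (RConst 1))
     (Seq (add_product ''nnz1'' ''row1'' ''col1'' ''val1'' (RVar ''gamma'')) (Seq update_wv update_scalars)))"

text \<open>The negation of the predicate minimised in \<open>steps\<close>, with \<open>th\<close>
  for the threshold and \<open>cw\<close> for the scalar factor.\<close>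

definition chebyshev_guard :: bexp where
  "chebyshev_guard = BNot (RLe (RMul (RVar ''th'') (RVar ''th''))
     (RMul (RVar ''eta'') (RMul (RVar ''cw'') (RVar ''cw''))))"

definition reset_bracket :: com where
  "reset_bracket = Cond (RLe (RVar ''xi'') (RSub (RVar ''r'') (RVar ''l''))) Skip
     (Seq (RAssign ''xi'' (RDiv (RVar ''xi'') (RConst 2))) (Seq (RAssign ''l'' (RConst 0))
       (RAssign ''r'' (RVar ''zeta''))))"

definition set_midpoint :: com where
  "set_midpoint = RAssign ''gamma'' (RDiv (RAdd (RVar ''l'') (RVar ''r'')) (RConst 2))"

definition init_chebyshev :: com where
  "init_chebyshev =
     Seq (RAssign ''eta'' (RDiv (RVar ''xi'') (RAdd (RConst 1) (RVar ''gamma''))))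
     (Seq (RAssign ''th'' (RDiv (RMul (RMul (RMul (RConst 3) (RVar ''rn'')) (RAdd (RVar ''cnt'') (RConst 1)))
         (RAdd (RVar ''cnt'') (RConst 2))) (RVar ''p'')))
     (Seq (RAssign ''cw'' (RConst 1)) (RAssign ''cv'' (RConst 1))))"

definition decide :: com where
  "decide = Cond (BNot (RLe (RMul (RMul (RConst 3) (RVar ''xi'')) (RVar ''nn''))
       (RMul (RConst 2) (RAdd (RVar ''a0'') (RMul (RVar ''gamma'') (RVar ''a1''))))))
     (Seq (RAssign ''cnt'' (RAdd (RVar ''cnt'') (RConst 1)))
       (Cond (RLe (RVar ''a1'') (RConst 0)) (RAssign ''r'' (RVar ''gamma'')) (RAssign ''l'' (RVar ''gamma''))))
     (NAssign ''done'' (NConst 1))"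

definition search_step :: com where
  "search_step = Seq reset_bracket (Seq set_midpoint (Seq draw_block (Seq init_chebyshev
     (Seq (While chebyshev_guard chebyshev_step)
     (Seq (add_form ''nnz0'' ''row0'' ''col0'' ''val0'' ''a0'')
     (Seq (add_form ''nnz1'' ''row1'' ''col1'' ''val1'' ''a1'') (Seq norm_w decide)))))))"

text \<open>The registers \<open>l\<close>, \<open>cnt\<close> and \<open>done\<close> need no
  assignment, as \<open>input_state\<close> sets every unnamed register to 0.\<close>

definition approx_xi :: com where
  "approx_xi = Seq (RAssign ''xi'' (RConst 1)) (Seq (RAssign ''r'' (RVar ''zeta''))
     (While (NLe (NVar ''done'') (NConst 0)) search_step))"

section \<open>The program carries out the search\<close>

locale gtrs_run = gtrs_instance n A0 A1 b0 b1 c0 c1 \<zeta> p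
  for n :: nat and A0 A1 :: "real mat" and b0 b1 :: "real vec" and c0 c1 \<zeta> p :: real +
  fixes xs0 xs1 :: "(nat \<times> nat) list"
  assumes xs0: "lists_nonzeros xs0 A0" and xs1: "lists_nonzeros xs1 A1"
begin

definition nnz :: nat where "nnz = length xs0 + length xs1"

lemma nnz: "nnz = card (nonzeros A0) + card (nonzeros A1)" "n \<le> nnz" "1 \<le> nnz"
proof -
  show eq: "nnz = card (nonzeros A0) + card (nonzeros A1)"
    unfolding nnz_def using xs0 xs1 by (metis distinct_card lists_nonzeros_def)
  then show "n \<le> nnz" "1 \<le> nnz" using n_le_nonzeros n_pos by simp_all
qed

definition input_ok :: "state \<Rightarrow> bool" where
  "input_ok s \<longleftrightarrow> nvar s ''n'' = n \<and> rvar s ''zeta'' = \<zeta> \<and> rvar s ''p'' = p \<and>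
     holds_matrix s ''nnz0'' ''row0'' ''col0'' ''val0'' xs0 A0 \<and>
     holds_matrix s ''nnz1'' ''row1'' ''col1'' ''val1'' xs1 A1"

lemma input_ok_frame:
  assumes "frame NV RV RA s s'" "input_ok s" "NV \<subseteq> {''i'', ''done''}" "''zeta'' \<notin> RV" "''p'' \<notin> RV"
    "RA \<subseteq> {''u'', ''w'', ''v''}"
  shows "input_ok s'"
proof -
  have "''n'' \<notin> NV" "''nnz0'' \<notin> NV" "''nnz1'' \<notin> NV" "''val0'' \<notin> RA" "''val1'' \<notin> RA"
    using assms(3,6) by auto
  then show ?thesis
    using assms(1,2,4,5) by (simp add: frame_def input_ok_def holds_matrix_def)
qed

lemma input_ok_input_state: "input_ok (input_state n A0 b0 c0 A1 b1 c1 xs0 xs1 \<zeta> p)"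
  by (simp add: input_ok_def input_state_def holds_matrix_def array_of_def)

definition cheb_state :: "real \<Rightarrow> real \<Rightarrow> (nat \<Rightarrow> real) \<Rightarrow> nat \<Rightarrow> state \<Rightarrow> bool" where
  "cheb_state \<xi> \<gamma> g m s \<longleftrightarrow>
     rvar s ''cw'' = fst (cheb_scalar (1 + \<xi> / (1 + \<gamma>)) m) \<and>
     rvar s ''cv'' = snd (cheb_scalar (1 + \<xi> / (1 + \<gamma>)) m) \<and>
     (\<forall>i<n. rarr s ''w'' i = fst (cheb n (iter_mat \<xi> \<gamma>) g m) i \<and>
            rarr s ''v'' i = snd (cheb n (iter_mat \<xi> \<gamma>) g m) i)"

text \<open>Argued backwards: each intermediate fact treats a longer suffix of the step, from any
  state satisfying what the preceding command establishes.\<close>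

lemma runs_chebyshev_step:
  assumes ok: "input_ok s" and vars: "rvar s ''xi'' = \<xi>" "rvar s ''gamma'' = \<gamma>" "rvar s ''eta'' = \<xi> / (1 + \<gamma>)"
    and ch: "cheb_state \<xi> \<gamma> g m s"
  shows "runs \<omega> chebyshev_step s (900 * nnz)
    (\<lambda>s'. frame {''i''} {''t'', ''x'', ''cw'', ''cv''} {''u'', ''w'', ''v''} s s' \<and> drawn s' = drawn s \<and>
       cheb_state \<xi> \<gamma> g (Suc m) s')"
proof -
  define z where "z = (\<lambda>j. rarr s ''w'' j + rarr s ''v'' j)"
  let ?B = "iter_mat \<xi> \<gamma>"
  obtain w v where wv: "cheb n ?B g m = (w, v)" by fastforce
  have wv_i: "rarr s ''w'' i = w i" "rarr s ''v'' i = v i" if "i < n" for i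
    using ch that by (simp_all add: cheb_state_def wv)
  have mvz: "mv n ?B z = mv n ?B (\<lambda>i. w i + v i)"
    by (rule mv_cong) (simp add: z_def wv_i)
  have n: "nvar s ''n'' = n" using ok by (simp add: input_ok_def)
  let ?R = "\<lambda>s'. frame {''i''} {''t'', ''x'', ''cw'', ''cv''} {''u'', ''w'', ''v''} s s' \<and> drawn s' = drawn s \<and>
       cheb_state \<xi> \<gamma> g (Suc m) s'"
  have scalars: "runs \<omega> update_scalars s5 100 ?R"
    if s5: "frame {''i''} {''t'', ''x''} {''u'', ''w'', ''v''} s s5" "drawn s5 = drawn s"
      "\<forall>i<n. rarr s5 ''w'' i = mv n ?B z i + rarr s ''v'' i \<and> rarr s5 ''v'' i = mv n ?B z i - rarr s ''w'' i" for s5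
  proof (rule runs_weaken[OF runs_update_scalars le_refl])
    fix s' assume s': "frame {} {''t'', ''x'', ''cw'', ''cv''} {} s5 s' \<and> drawn s' = drawn s5 \<and>
     rvar s' ''cw'' = (1 + rvar s5 ''eta'') * (rvar s5 ''cw'' + rvar s5 ''cv'') + rvar s5 ''cv'' \<and>
     rvar s' ''cv'' = (1 + rvar s5 ''eta'') * (rvar s5 ''cw'' + rvar s5 ''cv'') - rvar s5 ''cw''"
    have r5: "rvar s5 ''cw'' = rvar s ''cw''" "rvar s5 ''cv'' = rvar s ''cv''" "rvar s5 ''eta'' = \<xi> / (1 + \<gamma>)"
      using s5(1) vars by (simp_all add: frame_def)
    have a: "rarr s' ''w'' = rarr s5 ''w''" "rarr s' ''v'' = rarr s5 ''v''" using s' by (simp_all add: frame_def)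
    have "cheb_state \<xi> \<gamma> g (Suc m) s'"
      using s' s5(3) ch wv_i
      by (simp add: cheb_state_def r5 a wv mvz Let_def case_prod_beta)
    moreover have "frame {''i''} {''t'', ''x'', ''cw'', ''cv''} {''u'', ''w'', ''v''} s s'"
      using s5(1) s' by (simp add: frame_def)
    ultimately show "?R s'" using s' s5(2) by simp
  qed
  have update: "runs \<omega> (Seq update_wv update_scalars) s4 (100 * Suc n + 100) ?R"
    if s4: "frame {''i''} {} {''u''} s s4" "drawn s4 = drawn s"
      "\<forall>i<n. rarr s4 ''u'' i = mv n a0 z i + \<gamma> * mv n a1 z i" for s4
  proof -
    have v4: "nvar s4 ''n'' = n" "rvar s4 ''xi'' = \<xi>" "rvar s4 ''gamma'' = \<gamma>"
      "rarr s4 ''w'' = rarr s ''w''" "rarr s4 ''v'' = rarr s ''v''"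
      using s4(1) vars n by (simp_all add: frame_def)
    have b: "(1 + 3 * \<xi> / (1 + \<gamma>)) * (rarr s ''w'' i + rarr s ''v'' i) - 2 / (1 + \<gamma>) * rarr s4 ''u'' i
        = mv n ?B z i" if "i < n" for i
      using s4(3) that by (simp add: mv_iter_mat z_def)
    show ?thesis
    proof (rule runs_SeqI[OF runs_update_wv scalars])
      fix s5 assume s5: "frame {''i''} {''t'', ''x''} {''w'', ''v''} s4 s5 \<and> drawn s5 = drawn s4 \<and>
        (\<forall>i<nvar s4 ''n''. rarr s5 ''w'' i = (1 + 3 * rvar s4 ''xi'' / (1 + rvar s4 ''gamma'')) *
             (rarr s4 ''w'' i + rarr s4 ''v'' i) - 2 / (1 + rvar s4 ''gamma'') * rarr s4 ''u'' i + rarr s4 ''v'' i \<and>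
           rarr s5 ''v'' i = (1 + 3 * rvar s4 ''xi'' / (1 + rvar s4 ''gamma'')) *
             (rarr s4 ''w'' i + rarr s4 ''v'' i) - 2 / (1 + rvar s4 ''gamma'') * rarr s4 ''u'' i - rarr s4 ''w'' i)"
      show "frame {''i''} {''t'', ''x''} {''u'', ''w'', ''v''} s s5"
        using s4(1) s5 by (simp add: frame_def)
      show "drawn s5 = drawn s" using s4(2) s5 by simp
      show "\<forall>i<n. rarr s5 ''w'' i = mv n ?B z i + rarr s ''v'' i \<and> rarr s5 ''v'' i = mv n ?B z i - rarr s ''w'' i"
        using s5 b by (simp only: v4) simp
    qed (simp add: v4)
  qed
  have prod1: "runs \<omega> (Seq (add_product ''nnz1'' ''row1'' ''col1'' ''val1'' (RVar ''gamma''))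
      (Seq update_wv update_scalars)) s3 (100 * Suc (length xs1) + (100 * Suc n + 100)) ?R"
    if s3: "frame {''i''} {} {''u''} s s3" "drawn s3 = drawn s" "\<forall>i<n. rarr s3 ''u'' i = mv n a0 z i" for s3
  proof -
    have ok3: "input_ok s3" by (rule input_ok_frame[OF s3(1) ok]) auto
    have v3: "rvar s3 ''gamma'' = \<gamma>" "rarr s3 ''w'' = rarr s ''w''" "rarr s3 ''v'' = rarr s ''v''"
      using s3(1) vars by (simp_all add: frame_def)
    show ?thesis
    proof (rule runs_SeqI[OF runs_add_product[OF _ _ _ xs1 A1(1), where cv = \<gamma>] update])
      show "holds_matrix s3 ''nnz1'' ''row1'' ''col1'' ''val1'' xs1 A1" using ok3 by (simp add: input_ok_def)
    next
      fix s4 assume s4: "frame {''i''} {} {''u''} s3 s4 \<and> drawn s4 = drawn s3 \<and>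
        (\<forall>i<n. rarr s4 ''u'' i = rarr s3 ''u'' i + \<gamma> * mv n a1 (\<lambda>j. rarr s3 ''w'' j + rarr s3 ''v'' j) i)"
      show "frame {''i''} {} {''u''} s s4" using s3(1) s4 by (simp add: frame_def)
      show "drawn s4 = drawn s" using s3(2) s4 by simp
      show "\<forall>i<n. rarr s4 ''u'' i = mv n a0 z i + \<gamma> * mv n a1 z i"
        using s4 s3(3) by (simp add: v3 z_def)
    qed (simp_all add: v3)
  qed
  have prod0: "runs \<omega> (Seq (add_product ''nnz0'' ''row0'' ''col0'' ''val0'' (RConst 1))
      (Seq (add_product ''nnz1'' ''row1'' ''col1'' ''val1'' (RVar ''gamma''))
      (Seq update_wv update_scalars))) s2
      (100 * Suc (length xs0) + (100 * Suc (length xs1) + (100 * Suc n + 100))) ?R"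
    if s2: "frame {''i''} {} {''u''} s s2" "drawn s2 = drawn s" "\<forall>i<n. rarr s2 ''u'' i = 0" for s2
  proof -
    have ok2: "input_ok s2" by (rule input_ok_frame[OF s2(1) ok]) auto
    have v2: "rarr s2 ''w'' = rarr s ''w''" "rarr s2 ''v'' = rarr s ''v''"
      using s2(1) by (simp_all add: frame_def)
    show ?thesis
    proof (rule runs_SeqI[OF runs_add_product[OF _ _ _ xs0 A0(1), where cv = 1] prod1])
      show "holds_matrix s2 ''nnz0'' ''row0'' ''col0'' ''val0'' xs0 A0" using ok2 by (simp add: input_ok_def)
    next
      fix s3 assume s3: "frame {''i''} {} {''u''} s2 s3 \<and> drawn s3 = drawn s2 \<and>
        (\<forall>i<n. rarr s3 ''u'' i = rarr s2 ''u'' i + 1 * mv n a0 (\<lambda>j. rarr s2 ''w'' j + rarr s2 ''v'' j) i)"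
      show "frame {''i''} {} {''u''} s s3" using s2(1) s3 by (simp add: frame_def)
      show "drawn s3 = drawn s" using s2(2) s3 by simp
      show "\<forall>i<n. rarr s3 ''u'' i = mv n a0 z i"
        using s3 s2(3) by (simp add: v2 z_def)
    qed simp_all
  qed
  show ?thesis
    unfolding chebyshev_step_def
  proof (rule runs_SeqI[OF runs_zero_u prod0])
    \<comment> \<open>The left side is 100 (2 n + \<open>nnz\<close> + 5), and both n and 1 are at
      most \<open>nnz\<close>.\<close>
    show "100 * Suc (nvar s ''n'') + (100 * Suc (length xs0) + (100 * Suc (length xs1) + (100 * Suc n + 100)))
        \<le> 900 * nnz"
      using nnz(2,3) by (simp add: n nnz_def)
  qed (simp_all add: n)
qed

text \<open>The guard holds before iteration \<open>steps\<close> by minimality and fails there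
  because the minimum is attained. The extra \<open>Suc\<close> pays for the last test of the
  guard.\<close>

lemma runs_chebyshev_loop:
  assumes ok: "input_ok s" and vars: "rvar s ''xi'' = \<xi>" "rvar s ''gamma'' = \<gamma>" "rvar s ''eta'' = \<xi> / (1 + \<gamma>)"
    "rvar s ''th'' = T"
    and ch: "cheb_state \<xi> \<gamma> g 0 s" and bounds: "0 < \<xi>" "\<xi> \<le> 1" "0 \<le> \<gamma>" "0 \<le> T"
  shows "runs \<omega> (While chebyshev_guard chebyshev_step) s (Suc (steps \<xi> \<gamma> T) * (1000 * nnz))
    (\<lambda>s'. frame {''i''} {''t'', ''x'', ''cw'', ''cv''} {''u'', ''w'', ''v''} s s' \<and> drawn s' = drawn s \<and>
       cheb_state \<xi> \<gamma> g (steps \<xi> \<gamma> T) s')"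
proof -
  let ?I = "\<lambda>m s'. frame {''i''} {''t'', ''x'', ''cw'', ''cv''} {''u'', ''w'', ''v''} s s' \<and> drawn s' = drawn s \<and>
       cheb_state \<xi> \<gamma> g m s'"
  have guard: "bval chebyshev_guard s' \<longleftrightarrow>
      \<not> T\<^sup>2 \<le> \<xi> / (1 + \<gamma>) * (fst (cheb_scalar (1 + \<xi> / (1 + \<gamma>)) m))\<^sup>2" if "?I m s'" for m s'
    using that vars by (simp add: chebyshev_guard_def frame_def cheb_state_def power2_eq_square)
  show ?thesis
  proof (rule runs_While)
    show "?I 0 s" using ch by (simp add: frame_def)
  next
    fix m s' assume m: "m < steps \<xi> \<gamma> T" and I: "?I m s'"
    have ok': "input_ok s'" by (rule input_ok_frame[OF conjunct1[OF I] ok]) auto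
    have v': "rvar s' ''xi'' = \<xi>" "rvar s' ''gamma'' = \<gamma>" "rvar s' ''eta'' = \<xi> / (1 + \<gamma>)"
      using I vars by (simp_all add: frame_def)
    have "runs \<omega> chebyshev_step s' (900 * nnz) (?I (Suc m))"
    proof (rule runs_weaken[OF runs_chebyshev_step[OF ok' v'] le_refl])
      show "cheb_state \<xi> \<gamma> g m s'" using I by simp
      fix s'' assume "frame {''i''} {''t'', ''x'', ''cw'', ''cv''} {''u'', ''w'', ''v''} s' s'' \<and>
        drawn s'' = drawn s' \<and> cheb_state \<xi> \<gamma> g (Suc m) s''"
      then show "?I (Suc m) s''" using I by (simp add: frame_def)
    qed
    then show "bval chebyshev_guard s' \<and> runs \<omega> chebyshev_step s' (900 * nnz) (?I (Suc m))"
      using guard[OF I] steps_minimal[OF m] by simp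
  next
    fix s' assume "?I (steps \<xi> \<gamma> T) s'"
    from guard[OF this] steps_bound(1)[OF bounds] show "\<not> bval chebyshev_guard s'" by simp
  next
    have "bcost chebyshev_guard = 10" by (simp add: chebyshev_guard_def)
    then have "1 + bcost chebyshev_guard + 900 * nnz \<le> 1000 * nnz" "1 + bcost chebyshev_guard \<le> 1000 * nnz"
      using nnz(3) by simp_all
    then show "steps \<xi> \<gamma> T * (1 + bcost chebyshev_guard + 900 * nnz) + (1 + bcost chebyshev_guard)
        \<le> Suc (steps \<xi> \<gamma> T) * (1000 * nnz)"
      by (metis add.commute add_le_mono mult_Suc mult_le_mono2)
  qed
qed

text \<open>The value of \<open>drawn\<close> makes test \<open>k\<close> read exactly the tape
  block used in \<open>probe k\<close>; \<open>cnt\<close> is a real copy of \<open>k\<close>,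
  needed in the threshold.\<close>

definition top_state :: "(nat \<Rightarrow> real) \<Rightarrow> nat \<Rightarrow> state \<Rightarrow> bool" where
  "top_state \<omega> k s \<longleftrightarrow> input_ok s \<and> (rvar s ''xi'', rvar s ''l'', rvar s ''r'') = search k \<omega> \<and>
     rvar s ''cnt'' = real k \<and> drawn s = k * n \<and> nvar s ''done'' = 0"

definition final_state :: "(nat \<Rightarrow> real) \<Rightarrow> nat \<Rightarrow> state \<Rightarrow> bool" where
  "final_state \<omega> k s \<longleftrightarrow> nvar s ''done'' = 1 \<and> rvar s ''xi'' = fst (reset (search k \<omega>)) \<and>
     rvar s ''gamma'' = mid (reset (search k \<omega>))"

lemma runs_search_step:
  assumes top: "top_state \<omega> k s" and inv: "search_inv k (reset (search k \<omega>))"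
  defines "st \<equiv> reset (search k \<omega>)"
  shows "runs \<omega> search_step s ((steps (fst st) (mid st) (threshold k) + 2) * (1000 * nnz))
    (\<lambda>s'. if witness k \<omega> then top_state \<omega> (Suc k) s' else final_state \<omega> k s')"
proof -
  let ?R = "\<lambda>s'. if witness k \<omega> then top_state \<omega> (Suc k) s' else final_state \<omega> k s'"
  define \<xi> \<gamma> where "\<xi> = fst st" and "\<gamma> = mid st"
  define g where "g = (\<lambda>i. \<omega> (k * n + i))"
  let ?M = "steps \<xi> \<gamma> (threshold k)"
  define y where "y = probe k \<omega> st"
  have y: "y = fst (cheb n (iter_mat \<xi> \<gamma>) g ?M)"
    by (simp add: y_def probe_def \<xi>_def \<gamma>_def g_def)
  note bounds = search_inv_bounds[OF inv, folded st_def, folded \<xi>_def \<gamma>_def]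
  have T0: "0 \<le> threshold k" using p_pos by (simp add: threshold_def)
  have wit: "witness k \<omega> \<longleftrightarrow> 2 * form \<gamma> y < 3 * \<xi> * dot n y y"
    by (simp add: witness_def Let_def y_def \<xi>_def \<gamma>_def st_def)
  \<comment> \<open>What stays fixed from the reset of the bracket until \<open>decide\<close>. The
    proof again treats ever longer suffixes of the program, starting with
    \<open>decide\<close>.\<close>
  define B where "B = (\<lambda>s'. input_ok s' \<and> rvar s' ''xi'' = \<xi> \<and> rvar s' ''l'' = lo st \<and> rvar s' ''r'' = hi st \<and>
     rvar s' ''cnt'' = real k \<and> nvar s' ''done'' = 0)"
  have B_frame: "B s''" if "frame NV RV RA s' s''" "B s'" "NV \<subseteq> {''i''}"
    "RV \<subseteq> {''gamma'', ''rn'', ''x'', ''t'', ''cw'', ''cv'', ''eta'', ''th'', ''a0'', ''a1'', ''nn''}"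
    "RA \<subseteq> {''u'', ''w'', ''v''}" for NV RV RA s' s''
  proof -
    have "input_ok s''" by (rule input_ok_frame[OF that(1)]) (use that in \<open>auto simp: B_def\<close>)
    moreover have "''xi'' \<notin> RV" "''l'' \<notin> RV" "''r'' \<notin> RV" "''cnt'' \<notin> RV" "''done'' \<notin> NV"
      using that(3,4) by auto
    ultimately show ?thesis using that(1,2) by (simp add: B_def frame_def)
  qed
  have decide: "runs \<omega> decide s8 100 ?R"
    if s8: "B s8" "rvar s8 ''gamma'' = \<gamma>" "drawn s8 = Suc k * n" "rvar s8 ''a0'' = dot n y (mv n a0 y)"
      "rvar s8 ''a1'' = dot n y (mv n a1 y)" "rvar s8 ''nn'' = dot n y y" for s8
  proof -
    let ?b = "BNot (RLe (RMul (RMul (RConst 3) (RVar ''xi'')) (RVar ''nn''))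
       (RMul (RConst 2) (RAdd (RVar ''a0'') (RMul (RVar ''gamma'') (RVar ''a1'')))))"
    have b: "bval ?b s8 \<longleftrightarrow> witness k \<omega>"
      using s8 by (simp add: wit form_def B_def not_le)
    have next_search: "search (Suc k) \<omega> = bisect st y" by (simp add: Let_def y_def st_def)
    show ?thesis
      unfolding decide_def
    proof (rule runs_Cond[where T = 50])
      assume "bval ?b s8"
      then have w: "witness k \<omega>" using b by simp
      let ?s = "s8\<lparr>rvar := (rvar s8)(''cnt'' := rval (RAdd (RVar ''cnt'') (RConst 1)) s8)\<rparr>"
      have in_l: "input_ok (?s\<lparr>rvar := (rvar ?s)(''l'' := \<gamma>)\<rparr>)" and in_r: "input_ok (?s\<lparr>rvar := (rvar ?s)(''r'' := \<gamma>)\<rparr>)"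
        using s8(1) by (simp_all add: B_def input_ok_def holds_matrix_def)
      have "runs \<omega> (Cond (RLe (RVar ''a1'') (RConst 0)) (RAssign ''r'' (RVar ''gamma'')) (RAssign ''l'' (RVar ''gamma'')))
        ?s 40 (top_state \<omega> (Suc k))"
      proof (rule runs_Cond[where T = 10])
        assume "bval (RLe (RVar ''a1'') (RConst 0)) ?s"
        then have "search (Suc k) \<omega> = (\<xi>, lo st, \<gamma>)"
          using s8(5) by (simp add: next_search bisect_def \<xi>_def \<gamma>_def del: search.simps)
        then show "runs \<omega> (RAssign ''r'' (RVar ''gamma'')) ?s 10 (top_state \<omega> (Suc k))"
          using s8 in_r by (simp add: runs_atomic top_state_def B_def del: search.simps)
      next
        assume "\<not> bval (RLe (RVar ''a1'') (RConst 0)) ?s"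
        then have "search (Suc k) \<omega> = (\<xi>, \<gamma>, hi st)"
          using s8(5) by (simp add: next_search bisect_def \<xi>_def \<gamma>_def del: search.simps)
        then show "runs \<omega> (RAssign ''l'' (RVar ''gamma'')) ?s 10 (top_state \<omega> (Suc k))"
          using s8 in_l by (simp add: runs_atomic top_state_def B_def del: search.simps)
      qed simp
      then have "runs \<omega> (Cond (RLe (RVar ''a1'') (RConst 0)) (RAssign ''r'' (RVar ''gamma'')) (RAssign ''l'' (RVar ''gamma'')))
        ?s 46 ?R" by (rule runs_weaken) (use w in simp_all)
      then show "runs \<omega> (Seq (RAssign ''cnt'' (RAdd (RVar ''cnt'') (RConst 1)))
          (Cond (RLe (RVar ''a1'') (RConst 0)) (RAssign ''r'' (RVar ''gamma'')) (RAssign ''l'' (RVar ''gamma''))))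
          s8 50 ?R"
        by (intro runs_Seq_atomic(2)) simp
    next
      assume "\<not> bval ?b s8"
      then have "\<not> witness k \<omega>" using b by simp
      then show "runs \<omega> (NAssign ''done'' (NConst 1)) s8 50 ?R"
        using s8 by (simp add: runs_atomic final_state_def B_def \<xi>_def \<gamma>_def st_def)
    qed simp
  qed
  have norms: "runs \<omega> (Seq norm_w decide) s7 (2 + 100 * Suc n + 100) ?R"
    if s7: "B s7" "rvar s7 ''gamma'' = \<gamma>" "drawn s7 = Suc k * n" "\<forall>i<n. rarr s7 ''w'' i = y i"
      "rvar s7 ''a0'' = dot n y (mv n a0 y)" "rvar s7 ''a1'' = dot n y (mv n a1 y)" for s7
  proof -
    have n7: "nvar s7 ''n'' = n" using s7(1) by (simp add: B_def input_ok_def)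
    have d: "dot n (rarr s7 ''w'') (rarr s7 ''w'') = dot n y y" using s7(4) by (intro dot_cong) auto
    show ?thesis
    proof (rule runs_SeqI[OF runs_norm_w decide])
      fix s8 assume s8: "frame {''i''} {''nn''} {} s7 s8 \<and> drawn s8 = drawn s7 \<and>
        rvar s8 ''nn'' = dot (nvar s7 ''n'') (rarr s7 ''w'') (rarr s7 ''w'')"
      show "B s8" by (rule B_frame[OF conjunct1[OF s8] s7(1)]) auto
      show "rvar s8 ''gamma'' = \<gamma>" "drawn s8 = Suc k * n" "rvar s8 ''a0'' = dot n y (mv n a0 y)"
        "rvar s8 ''a1'' = dot n y (mv n a1 y)" "rvar s8 ''nn'' = dot n y y"
        using s8 s7 d n7 by (simp_all add: frame_def)
    qed (simp add: n7)
  qed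
  have forms: "runs \<omega> (Seq (add_form ''nnz0'' ''row0'' ''col0'' ''val0'' ''a0'')
     (Seq (add_form ''nnz1'' ''row1'' ''col1'' ''val1'' ''a1'') (Seq norm_w decide))) s5
     (2 + 100 * Suc (length xs0) + (2 + 100 * Suc (length xs1) + (2 + 100 * Suc n + 100))) ?R"
    if s5: "B s5" "rvar s5 ''gamma'' = \<gamma>" "drawn s5 = Suc k * n" "\<forall>i<n. rarr s5 ''w'' i = y i" for s5
  proof -
    have q: "dot n (rarr s' ''w'') (mv n A (rarr s' ''w'')) = dot n y (mv n A y)"
      if "rarr s' ''w'' = rarr s5 ''w''" for A s'
    proof -
      have "mv n A (rarr s5 ''w'') = mv n A y" using s5(4) by (intro mv_cong) auto
      moreover have "dot n (rarr s5 ''w'') x = dot n y x" for x using s5(4) by (intro dot_cong) auto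
      ultimately show ?thesis by (simp add: that)
    qed
    have hold: "holds_matrix s' ''nnz0'' ''row0'' ''col0'' ''val0'' xs0 A0"
      "holds_matrix s' ''nnz1'' ''row1'' ''col1'' ''val1'' xs1 A1" if "B s'" for s'
      using that by (simp_all add: B_def input_ok_def)
    show ?thesis
    proof (rule runs_SeqI[OF runs_add_form[OF hold(1)[OF s5(1)] _ xs0 A0(1)]])
      fix s6 assume s6: "frame {''i''} {''a0''} {} s5 s6 \<and> drawn s6 = drawn s5 \<and>
        rvar s6 ''a0'' = dot n (rarr s5 ''w'') (mv n a0 (rarr s5 ''w''))"
      have B6: "B s6" by (rule B_frame[OF conjunct1[OF s6] s5(1)]) auto
      have v6: "rarr s6 ''w'' = rarr s5 ''w''" "rvar s6 ''gamma'' = \<gamma>" "drawn s6 = Suc k * n"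
        "rvar s6 ''a0'' = dot n y (mv n a0 y)"
        using s6 s5 q[OF refl] by (simp_all add: frame_def)
      show "runs \<omega> (Seq (add_form ''nnz1'' ''row1'' ''col1'' ''val1'' ''a1'') (Seq norm_w decide)) s6
         (2 + 100 * Suc (length xs1) + (2 + 100 * Suc n + 100)) ?R"
      proof (rule runs_SeqI[OF runs_add_form[OF hold(2)[OF B6] _ xs1 A1(1)] norms])
        fix s7 assume s7: "frame {''i''} {''a1''} {} s6 s7 \<and> drawn s7 = drawn s6 \<and>
          rvar s7 ''a1'' = dot n (rarr s6 ''w'') (mv n a1 (rarr s6 ''w''))"
        show "B s7" by (rule B_frame[OF conjunct1[OF s7] B6]) auto
        show "rvar s7 ''gamma'' = \<gamma>" "drawn s7 = Suc k * n" "\<forall>i<n. rarr s7 ''w'' i = y i"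
          "rvar s7 ''a0'' = dot n y (mv n a0 y)" "rvar s7 ''a1'' = dot n y (mv n a1 y)"
          using s7 v6 s5(4) q[OF v6(1)] by (simp_all add: frame_def)
      qed simp_all
    qed simp_all
  qed
  let ?F = "2 + 100 * Suc (length xs0) + (2 + 100 * Suc (length xs1) + (2 + 100 * Suc n + 100))"
  let ?tail = "Seq (add_form ''nnz0'' ''row0'' ''col0'' ''val0'' ''a0'')
     (Seq (add_form ''nnz1'' ''row1'' ''col1'' ''val1'' ''a1'') (Seq norm_w decide))"
  have loop: "runs \<omega> (Seq (While chebyshev_guard chebyshev_step) ?tail) s4 (Suc ?M * (1000 * nnz) + ?F) ?R"
    if s4: "B s4" "rvar s4 ''gamma'' = \<gamma>" "drawn s4 = Suc k * n" "rvar s4 ''eta'' = \<xi> / (1 + \<gamma>)"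
      "rvar s4 ''th'' = threshold k" "cheb_state \<xi> \<gamma> g 0 s4" for s4
  proof (rule runs_SeqI[OF runs_chebyshev_loop[OF _ _ s4(2) s4(4) s4(5) s4(6) bounds(1-3) T0] forms])
    show "input_ok s4" "rvar s4 ''xi'' = \<xi>" using s4(1) by (simp_all add: B_def)
    fix s5 assume s5: "frame {''i''} {''t'', ''x'', ''cw'', ''cv''} {''u'', ''w'', ''v''} s4 s5 \<and>
      drawn s5 = drawn s4 \<and> cheb_state \<xi> \<gamma> g ?M s5"
    show "B s5" by (rule B_frame[OF conjunct1[OF s5] s4(1)]) auto
    show "rvar s5 ''gamma'' = \<gamma>" "drawn s5 = Suc k * n" "\<forall>i<n. rarr s5 ''w'' i = y i"
      using s5 s4 by (simp_all add: frame_def cheb_state_def y)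
  qed simp
  have init: "runs \<omega> (Seq init_chebyshev (Seq (While chebyshev_guard chebyshev_step) ?tail)) s3
      (50 + (Suc ?M * (1000 * nnz) + ?F)) ?R"
    if s3: "B s3" "rvar s3 ''gamma'' = \<gamma>" "drawn s3 = Suc k * n" "rvar s3 ''rn'' = real n"
      "\<forall>i<n. rarr s3 ''w'' i = g i \<and> rarr s3 ''v'' i = g i" for s3
  proof -
    have "runs \<omega> init_chebyshev s3 50 (\<lambda>s4. frame {} {''eta'', ''th'', ''cw'', ''cv''} {} s3 s4 \<and> drawn s4 = drawn s3 \<and>
       rvar s4 ''eta'' = \<xi> / (1 + \<gamma>) \<and> rvar s4 ''th'' = threshold k \<and> rvar s4 ''cw'' = 1 \<and> rvar s4 ''cv'' = 1)"
      unfolding init_chebyshev_def using s3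
      by (intro runs_Seq_atomic conjI)
        (auto simp: runs_atomic frame_def B_def input_ok_def threshold_def intro!: runs_Seq_atomic)
    then show ?thesis
    proof (rule runs_SeqI[OF _ loop])
      fix s4 assume s4: "frame {} {''eta'', ''th'', ''cw'', ''cv''} {} s3 s4 \<and> drawn s4 = drawn s3 \<and>
       rvar s4 ''eta'' = \<xi> / (1 + \<gamma>) \<and> rvar s4 ''th'' = threshold k \<and> rvar s4 ''cw'' = 1 \<and> rvar s4 ''cv'' = 1"
      show "B s4" by (rule B_frame[OF conjunct1[OF s4] s3(1)]) auto
      show "rvar s4 ''gamma'' = \<gamma>" "drawn s4 = Suc k * n" "rvar s4 ''eta'' = \<xi> / (1 + \<gamma>)"
        "rvar s4 ''th'' = threshold k" "cheb_state \<xi> \<gamma> g 0 s4"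
        using s4 s3 by (simp_all add: frame_def cheb_state_def)
    qed simp
  qed
  have draw: "runs \<omega> (Seq draw_block (Seq init_chebyshev (Seq (While chebyshev_guard chebyshev_step) ?tail))) s2
      (2 + 100 * Suc n + (50 + (Suc ?M * (1000 * nnz) + ?F))) ?R"
    if s2: "B s2" "rvar s2 ''gamma'' = \<gamma>" "drawn s2 = k * n" for s2
  proof -
    have n2: "nvar s2 ''n'' = n" using s2(1) by (simp add: B_def input_ok_def)
    show ?thesis
    proof (rule runs_SeqI[OF runs_draw_block init])
      fix s3 assume s3: "frame {''i''} {''rn'', ''x''} {''w'', ''v''} s2 s3 \<and>
         drawn s3 = drawn s2 + nvar s2 ''n'' \<and> rvar s3 ''rn'' = real (nvar s2 ''n'') \<and>
         (\<forall>i<nvar s2 ''n''. rarr s3 ''w'' i = \<omega> (drawn s2 + i) \<and> rarr s3 ''v'' i = \<omega> (drawn s2 + i))"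
      show "B s3" by (rule B_frame[OF conjunct1[OF s3] s2(1)]) auto
      show "rvar s3 ''gamma'' = \<gamma>" "drawn s3 = Suc k * n" "rvar s3 ''rn'' = real n"
        "\<forall>i<n. rarr s3 ''w'' i = g i \<and> rarr s3 ''v'' i = g i"
        using s3 s2 n2 by (simp_all add: frame_def g_def)
    qed (simp add: n2)
  qed
  have reset: "runs \<omega> reset_bracket s 50 (\<lambda>s1. B s1 \<and> drawn s1 = k * n)"
    unfolding reset_bracket_def
  proof (rule runs_Cond[where T = 20])
    have srch: "search k \<omega> = (rvar s ''xi'', rvar s ''l'', rvar s ''r'')" using top by (simp add: top_state_def)
    have top': "input_ok s" "rvar s ''cnt'' = real k" "drawn s = k * n" "nvar s ''done'' = 0"
      using top by (simp_all add: top_state_def)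
    {
      assume "bval (RLe (RVar ''xi'') (RSub (RVar ''r'') (RVar ''l''))) s"
      then have "st = (rvar s ''xi'', rvar s ''l'', rvar s ''r'')"
        by (simp add: st_def reset_def srch lo_def hi_def)
      then show "runs \<omega> Skip s 20 (\<lambda>s1. B s1 \<and> drawn s1 = k * n)"
        using top' by (simp add: runs_atomic B_def \<xi>_def lo_def hi_def)
    next
      assume "\<not> bval (RLe (RVar ''xi'') (RSub (RVar ''r'') (RVar ''l''))) s"
      then have "st = (rvar s ''xi'' / 2, 0, \<zeta>)"
        by (simp add: st_def reset_def srch lo_def hi_def)
      then show "runs \<omega> (Seq (RAssign ''xi'' (RDiv (RVar ''xi'') (RConst 2))) (Seq (RAssign ''l'' (RConst 0))
         (RAssign ''r'' (RVar ''zeta'')))) s 20 (\<lambda>s1. B s1 \<and> drawn s1 = k * n)"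
        using top'
        by (intro runs_Seq_atomic conjI)
          (auto simp: runs_atomic B_def \<xi>_def lo_def hi_def input_ok_def holds_matrix_def
            intro!: runs_Seq_atomic)
    }
  qed simp
  show ?thesis
    unfolding search_step_def
  proof (rule runs_SeqI[OF reset])
    fix s1 assume s1: "B s1 \<and> drawn s1 = k * n"
    let ?s2 = "s1\<lparr>rvar := (rvar s1)(''gamma'' := \<gamma>)\<rparr>"
    have "frame {} {''gamma''} {} s1 ?s2" by (simp add: frame_def)
    then have "B ?s2" by (rule B_frame) (use s1 in auto)
    moreover have "rval (RDiv (RAdd (RVar ''l'') (RVar ''r'')) (RConst 2)) s1 = \<gamma>"
      using s1 by (simp add: B_def \<gamma>_def mid_def)
    ultimately show "runs \<omega> (Seq set_midpoint (Seq draw_block (Seq init_chebyshev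
         (Seq (While chebyshev_guard chebyshev_step) ?tail)))) s1
         (6 + (2 + 100 * Suc n + (50 + (Suc ?M * (1000 * nnz) + ?F)))) ?R"
      unfolding set_midpoint_def using draw[of ?s2] s1
      by (intro runs_Seq_atomic(2)) simp
  next
    \<comment> \<open>The filter loop takes \<open>steps\<close> plus one portions of
      \<open>1000 * nnz\<close>; all remaining commands fit into one more.\<close>
    show "50 + (6 + (2 + 100 * Suc n + (50 + (Suc ?M * (1000 * nnz) + ?F))))
        \<le> (steps (fst st) (mid st) (threshold k) + 2) * (1000 * nnz)"
      using nnz(2,3) by (simp add: \<xi>_def[symmetric] \<gamma>_def[symmetric] nnz_def algebra_simps)
  qed
qed

lemma runs_approx_xi:
  assumes K: "\<not> witness K \<omega>" "\<And>k. k < K \<Longrightarrow> witness k \<omega>"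
    and M: "\<And>k. k \<le> K \<Longrightarrow>
      steps (fst (reset (search k \<omega>))) (mid (reset (search k \<omega>))) (threshold k) \<le> M"
  shows "runs \<omega> approx_xi (input_state n A0 b0 c0 A1 b1 c1 xs0 xs1 \<zeta> p) (Suc K * ((M + 2) * (1100 * nnz)) + 8)
    (final_state \<omega> K)"
proof -
  define U where "U = Suc K * ((M + 2) * (1100 * nnz))"
  let ?s = "input_state n A0 b0 c0 A1 b1 c1 xs0 xs1 \<zeta> p"
  let ?s1 = "?s\<lparr>rvar := (rvar ?s)(''xi'' := 1)\<rparr>"
  let ?s2 = "?s1\<lparr>rvar := (rvar ?s1)(''r'' := \<zeta>)\<rparr>"
  \<comment> \<open>The loop makes \<open>Suc K\<close> iterations: tests 0 to \<open>K\<close>, of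
    which only the last sets \<open>done\<close>.\<close>
  let ?I = "\<lambda>k s. if k \<le> K then top_state \<omega> k s else final_state \<omega> K s"
  let ?b = "NLe (NVar ''done'') (NConst 0)"
  have zeta: "rvar ?s1 ''zeta'' = \<zeta>" by (simp add: input_state_def)
  have "input_ok ?s2" using input_ok_input_state by (simp add: input_ok_def holds_matrix_def)
  then have top: "top_state \<omega> 0 ?s2" by (simp add: top_state_def) (simp add: input_state_def)
  have inv: "search_inv k (reset (search k \<omega>))" if "k \<le> K" for k
    using that K(2) by (intro search_inv_reset search_inv_search) auto
  have loop: "runs \<omega> (While ?b search_step) ?s2 (U + 4) (?I (Suc K))"
  proof (rule runs_While[where I = ?I and N = "Suc K" and T = "(M + 2) * (1000 * nnz)"])
    show "?I 0 ?s2" using top by simp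
  next
    fix k s assume k: "k < Suc K" and I: "?I k s"
    then have top: "top_state \<omega> k s" by simp
    have "runs \<omega> search_step s ((M + 2) * (1000 * nnz)) (?I (Suc k))"
    proof (rule runs_weaken[OF runs_search_step[OF top inv]])
      show "k \<le> K" using k by simp
      show "(steps (fst (reset (search k \<omega>))) (mid (reset (search k \<omega>))) (threshold k) + 2) * (1000 * nnz)
          \<le> (M + 2) * (1000 * nnz)"
        using M[of k] k by (intro mult_le_mono1) simp
      fix s' assume s': "if witness k \<omega> then top_state \<omega> (Suc k) s' else final_state \<omega> k s'"
      show "?I (Suc k) s'"
      proof (cases "k = K")
        case True
        then show ?thesis using s' K(1) by simp
      next
        case False
        then have "k < K" using k by simp
        then show ?thesis using s' K(2) by simp
      qed
    qed
    moreover have "bval ?b s" using top by (simp add: top_state_def)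
    ultimately show "bval ?b s \<and> runs \<omega> search_step s ((M + 2) * (1000 * nnz)) (?I (Suc k))" by simp
  next
    fix s assume "?I (Suc K) s"
    then show "\<not> bval ?b s" by (simp add: final_state_def)
  next
    have "1 * 1 \<le> (M + 2) * nnz" using nnz(3) by (intro mult_le_mono) auto
    then have "4 + (M + 2) * (1000 * nnz) \<le> (M + 2) * (1100 * nnz)" by simp
    then have "Suc K * (4 + (M + 2) * (1000 * nnz)) \<le> U"
      unfolding U_def by (rule mult_le_mono2)
    then have "Suc K * (4 + (M + 2) * (1000 * nnz)) + 4 \<le> U + 4"
      by (rule add_right_mono)
    moreover have b: "1 + bcost ?b = 4" by simp
    ultimately show "Suc K * (1 + bcost ?b + (M + 2) * (1000 * nnz)) + (1 + bcost ?b)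
        \<le> U + 4" by (simp only: b)
  qed
  have "runs \<omega> approx_xi ?s (U + 8) (?I (Suc K))"
    unfolding approx_xi_def
  proof (rule runs_Seq_atomic(2), intro conjI)
    show "runs \<omega> (Seq (RAssign ''r'' (RVar ''zeta'')) (While ?b search_step))
        (?s\<lparr>rvar := (rvar ?s)(''xi'' := rval (RConst 1) ?s)\<rparr>)
        (U + 8 - Suc (rcost (RConst 1))) (?I (Suc K))"
    proof (rule runs_Seq_atomic(2), intro conjI)
      show "runs \<omega> (While ?b search_step)
          (?s\<lparr>rvar := (rvar ?s)(''xi'' := rval (RConst 1) ?s)\<rparr>
            \<lparr>rvar := (rvar (?s\<lparr>rvar := (rvar ?s)(''xi'' := rval (RConst 1) ?s)\<rparr>))
              (''r'' := rval (RVar ''zeta'') (?s\<lparr>rvar := (rvar ?s)(''xi'' := rval (RConst 1) ?s)\<rparr>))\<rparr>)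
          (U + 8 - Suc (rcost (RConst 1)) - Suc (rcost (RVar ''zeta''))) (?I (Suc K))"
        using loop zeta by (simp add: add.commute)
    qed simp
  qed simp
  then show ?thesis unfolding U_def by (rule runs_weaken) auto
qed

section \<open>The running-time estimate\<close>

abbreviation \<open>L\<xi> \<equiv> lg (1 / \<xi>s)\<close>
abbreviation \<open>L\<zeta> \<equiv> lg \<zeta>\<close>
abbreviation \<open>Lnp \<equiv> lg (real n / p)\<close>
abbreviation \<open>LL \<equiv> loglog_factor n \<zeta> \<xi>s p\<close>

lemma lg_ge_1: "1 \<le> lg x" and ln_le_lg: "ln x \<le> lg x"
  by (simp_all add: lg_def)

lemma log2_le_2_ln: "1 \<le> x \<Longrightarrow> log 2 x \<le> 2 * ln x"
proof -
  assume x: "1 \<le> x"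
  have "1 / 2 \<le> ln (2 :: real)" using ln_2_less_1 ln_add_one_self_le_self2[of "- 1/2"] ln_div[of 1 "2::real"] by simp
  then have "ln x * 1 \<le> ln x * (2 * ln 2)" using x by (intro mult_left_mono) auto
  then show ?thesis by (simp add: log_def field_simps)
qed

text \<open>Halvings number at most 2 + 2 \<open>L\<xi>\<close> and bisections per guess at most 2 +
  2 \<open>L\<zeta>\<close> + 2 \<open>L\<xi>\<close>. With one added to each, all terms are
  absorbed using that the logarithms are at least 1, giving the factors 5 and 7.\<close>

lemma test_count_bound: "real (Suc max_halvings * Suc max_bisections) \<le> 35 * (L\<zeta> * L\<xi>\<^sup>2)"
proof -
  have \<xi>: "0 < \<xi>s" "1 \<le> 1 / \<xi>s" using xi_star_pos xi_star_le_1 by simp_all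
  have L: "1 \<le> L\<xi>" "1 \<le> L\<zeta>" by (rule lg_ge_1)+
  have log\<xi>: "log 2 (1 / \<xi>s) \<le> 2 * L\<xi>"
    using log2_le_2_ln[OF \<xi>(2)] ln_le_lg[of "1 / \<xi>s"] by linarith
  have log\<zeta>: "log 2 \<zeta> \<le> 2 * L\<zeta>"
    using log2_le_2_ln[OF zeta_ge_1] ln_le_lg[of \<zeta>] by linarith
  have log4: "log 2 4 = (2 :: real)" using log_pow_cancel[of "2::real" 2] by simp
  have "log 2 (4 * (1 / \<xi>s)) = 2 + log 2 (1 / \<xi>s)"
    using \<xi>(1) log4 by (subst log_mult_pos) auto
  moreover have "0 \<le> log 2 (1 / \<xi>s)" using \<xi> by (subst zero_le_log_cancel_iff) auto
  ultimately have h: "real (Suc max_halvings) \<le> 5 * L\<xi>"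
    using log\<xi> L(1) unfolding max_halvings_def by simp linarith
  have "log 2 (4 * (\<zeta> * (1 / \<xi>s))) = 2 + (log 2 \<zeta> + log 2 (1 / \<xi>s))"
    using \<xi>(1) zeta_ge_1 log4 by (subst log_mult_pos, simp, simp, subst log_mult_pos) auto
  moreover have "0 \<le> log 2 \<zeta>" using zeta_ge_1 by (subst zero_le_log_cancel_iff) auto
  moreover have "1 * L\<xi> \<le> L\<zeta> * L\<xi>" "L\<zeta> * 1 \<le> L\<zeta> * L\<xi>" "1 * 1 \<le> L\<zeta> * L\<xi>" using L by (intro mult_mono; simp)+
  ultimately have b: "real (Suc max_bisections) \<le> 7 * (L\<zeta> * L\<xi>)"
    using log\<xi> log\<zeta> \<open>0 \<le> log 2 (1 / \<xi>s)\<close> unfolding max_bisections_def by simp linarith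
  have "real (Suc max_halvings) * real (Suc max_bisections) \<le> (5 * L\<xi>) * (7 * (L\<zeta> * L\<xi>))"
    using h b L by (intro mult_mono) auto
  then show ?thesis by (simp add: power2_eq_square algebra_simps)
qed

text \<open>The degree is logarithmic in the threshold, a multiple of n/p times a quadratic in
  \<open>k\<close>. As \<open>k\<close> is bounded by a product of logarithms, it contributes only
  iterated logarithms, which \<open>LL\<close> dominates.\<close>

lemma steps_uniform_bound:
  assumes inv: "search_inv k s" and k: "k < Suc max_halvings * Suc max_bisections"
  shows "real (steps (fst s) (mid s) (threshold k)) + 2 \<le> 135 * (Lnp * LL * sqrt (\<zeta> / \<xi>s))"
proof -
  note bounds = search_inv_bounds[OF inv]
  define H where "H = 35 * (L\<zeta> * L\<xi>\<^sup>2)"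
  have L: "1 \<le> L\<xi>" "1 \<le> L\<zeta>" "1 \<le> Lnp" by (rule lg_ge_1)+
  have H: "1 \<le> H" "real k + 1 \<le> H" "real k + 2 \<le> 2 * H"
  proof -
    have "real k + 1 \<le> real (Suc max_halvings * Suc max_bisections)" using k by linarith
    then show "real k + 1 \<le> H" using test_count_bound unfolding H_def by linarith
    then show "1 \<le> H" "real k + 2 \<le> 2 * H" by linarith+
  qed
  define q where "q = real n / p"
  have q: "1 \<le> q" using n_pos p_pos p_less_1 by (simp add: q_def le_divide_eq)
  have T: "threshold k = 3 * (q * ((real k + 1) * (real k + 2)))"
    by (simp add: threshold_def q_def)
  have kk: "1 * 2 \<le> (real k + 1) * (real k + 2)" by (intro mult_mono) auto
  then have "1 * 2 \<le> q * ((real k + 1) * (real k + 2))" using q by (intro mult_mono) auto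
  then have T6: "6 \<le> threshold k" by (simp add: T)
  have "(real k + 1) * (real k + 2) \<le> H * (2 * H)" using H by (intro mult_mono) auto
  then have "q * ((real k + 1) * (real k + 2)) \<le> q * (H * (2 * H))" using q by (intro mult_left_mono) auto
  then have "2 * threshold k + 2 \<le> 18 * (q * H\<^sup>2)" using T6 by (simp add: T power2_eq_square)
  also have "\<dots> = 22050 * (q * (L\<zeta>\<^sup>2 * L\<xi> ^ 4))"
    by (simp add: H_def power_mult_distrib)
  \<comment> \<open>The constant 22050 is 18 times 35 squared; a power of two makes its logarithm
    easy to bound.\<close>
  also have "\<dots> \<le> 2 ^ 15 * (q * (L\<zeta>\<^sup>2 * L\<xi> ^ 4))" using q L by (intro mult_right_mono) auto
  finally have "ln (2 * threshold k + 2) \<le> ln (2 ^ 15 * (q * (L\<zeta>\<^sup>2 * L\<xi> ^ 4)))"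
    using T6 by (intro ln_mono) auto
  also have "\<dots> = 15 * ln 2 + (ln q + (2 * ln L\<zeta> + 4 * ln L\<xi>))"
    using q L ln_realpow[of "2 :: real" 15] by (simp add: ln_mult ln_realpow)
  also have "\<dots> \<le> 15 + (Lnp + (2 * lg L\<zeta> + 4 * lg L\<xi>))"
    using ln_2_less_1 ln_le_lg[of q] ln_le_lg[of L\<zeta>] ln_le_lg[of L\<xi>] by (simp add: q_def)
  \<comment> \<open>22 = 15 + 1 + 2 + 4, since every factor is at least 1.\<close>
  also have "\<dots> \<le> 22 * (Lnp * LL)"
  proof -
    have l: "1 \<le> lg Lnp" "1 \<le> lg L\<zeta>" "1 \<le> lg L\<xi>" by (rule lg_ge_1)+
    have a: "1 * 1 \<le> lg Lnp * lg L\<zeta>" using l by (intro mult_mono) auto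
    have "1 * lg L\<zeta> \<le> lg Lnp * lg L\<zeta>" using l by (intro mult_mono) auto
    then have "lg L\<zeta> * 1 \<le> LL" unfolding loglog_factor_def using l a by (intro mult_mono) auto
    moreover have "1 * lg L\<xi> \<le> LL" unfolding loglog_factor_def using l a by (intro mult_mono) auto
    ultimately have LL: "1 \<le> LL" "lg L\<zeta> \<le> LL" "lg L\<xi> \<le> LL" using l by linarith+
    have "1 * LL \<le> Lnp * LL" "Lnp * 1 \<le> Lnp * LL" using L LL by (intro mult_mono; simp)+
    then show ?thesis using LL by linarith
  qed
  finally have ln: "ln (2 * threshold k + 2) \<le> 22 * (Lnp * LL)" .
  let ?S = "sqrt (\<zeta> / \<xi>s)"
  have S1: "1 \<le> ?S" using zeta_ge_1 xi_star_pos xi_star_le_1 by (simp add: le_divide_eq)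
  have root: "sqrt ((1 + mid s) / fst s) \<le> 3 * ?S"
  proof -
    have "(1 + mid s) / fst s \<le> (2 * \<zeta>) / (\<xi>s / 4)"
      using bounds zeta_ge_1 xi_star_pos by (intro frac_le) auto
    \<comment> \<open>The true factor is 8; 9 has an integer square root.\<close>
    also have "\<dots> \<le> 9 * (\<zeta> / \<xi>s)" using zeta_ge_1 xi_star_pos by (simp add: field_simps)
    finally have "sqrt ((1 + mid s) / fst s) \<le> sqrt (9 * (\<zeta> / \<xi>s))" by (rule real_sqrt_le_mono)
    also have "\<dots> = 3 * ?S"
    proof -
      have "sqrt 9 = (3 :: real)" by (rule real_sqrt_unique) auto
      then show ?thesis by (simp only: real_sqrt_mult)
    qed
    finally show ?thesis .
  qed
  have T0: "0 \<le> threshold k" using T6 by simp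
  have ln0: "0 \<le> ln (2 * threshold k + 2)" using T6 by simp
  have "real (steps (fst s) (mid s) (threshold k)) \<le> 1 + ln (2 * threshold k + 2) * 2 * sqrt ((1 + mid s) / fst s)"
    by (rule steps_bound(2)[OF bounds(1-3) T0])
  also have "\<dots> \<le> 1 + (22 * (Lnp * LL)) * 2 * (3 * ?S)"
    using ln ln0 root bounds by (intro add_left_mono mult_mono) auto
  finally have "real (steps (fst s) (mid s) (threshold k)) \<le> 1 + 132 * (Lnp * LL * ?S)" by simp
  moreover have "1 \<le> Lnp * LL * ?S"
  proof -
    have l: "1 \<le> lg Lnp" "1 \<le> lg L\<zeta>" "1 \<le> lg L\<xi>" by (rule lg_ge_1)+
    have "1 * 1 \<le> lg Lnp * lg L\<zeta>" using l by (intro mult_mono) auto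
    then have "1 * 1 \<le> LL" unfolding loglog_factor_def using l by (intro mult_mono) auto
    then have "1 * 1 \<le> Lnp * LL" using L by (intro mult_mono) auto
    then have "1 * 1 \<le> Lnp * LL * ?S" using S1 by (intro mult_mono) auto
    then show ?thesis by simp
  qed
  ultimately show ?thesis by linarith
qed

text \<open>Luck enters only through \<open>cert\<close>; termination, the time bound and the lower
  bound on the output hold for every tape.\<close>

lemma approx_xi_correct:
  assumes \<omega>: "\<omega> \<in> lucky"
  shows "\<exists>t s. exec \<omega> approx_xi (input_state n A0 b0 c0 A1 b1 c1 xs0 xs1 \<zeta> p) t s \<and>
    \<xi>s / 4 \<le> rvar s ''xi'' \<and> rvar s ''xi'' \<le> \<xi>s \<and> lam (rvar s ''gamma'') \<ge> rvar s ''xi'' \<and>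
    real t \<le> 6000000 * time_bound (card (nonzeros A0) + card (nonzeros A1)) n \<zeta> \<xi>s p * LL ^ 1"
proof -
  obtain K where K: "K < Suc max_halvings * Suc max_bisections" "\<not> witness K \<omega>"
    "\<And>k. k < K \<Longrightarrow> witness k \<omega>" using first_certificate[of \<omega>] by metis
  let ?st = "\<lambda>k. reset (search k \<omega>)"
  have inv: "search_inv k (?st k)" if "k \<le> K" for k
    using that K(3) by (intro search_inv_reset search_inv_search) auto
  let ?X = "Lnp * LL * sqrt (\<zeta> / \<xi>s)"
  define M where "M = Max ((\<lambda>k. steps (fst (?st k)) (mid (?st k)) (threshold k)) ` {..K})"
  have M: "steps (fst (?st k)) (mid (?st k)) (threshold k) \<le> M" if "k \<le> K" for k
    unfolding M_def using that by (intro Max_ge) auto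
  have "M \<in> (\<lambda>k. steps (fst (?st k)) (mid (?st k)) (threshold k)) ` {..K}"
    unfolding M_def by (rule Max_in) auto
  then obtain k where k: "k \<le> K" "M = steps (fst (?st k)) (mid (?st k)) (threshold k)" by auto
  then have MX: "real M + 2 \<le> 135 * ?X"
    using steps_uniform_bound[OF inv[OF k(1)]] K(1) by simp
  from runs_approx_xi[OF K(2,3) M] obtain t s where
    exec: "exec \<omega> approx_xi (input_state n A0 b0 c0 A1 b1 c1 xs0 xs1 \<zeta> p) t s"
    and t: "t \<le> Suc K * ((M + 2) * (1100 * nnz)) + 8" and fin: "final_state \<omega> K s"
    unfolding runs_def by blast
  note bounds = search_inv_bounds[OF inv[OF le_refl]]
  have xi: "rvar s ''xi'' = fst (?st K)" "rvar s ''gamma'' = mid (?st K)"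
    using fin by (simp_all add: final_state_def)
  have cert: "fst (?st K) \<le> lam (mid (?st K))"
    by (rule certificate_correct[OF \<omega> inv[OF le_refl] K(2)])
  have time: "real t \<le> 6000000 * time_bound (card (nonzeros A0) + card (nonzeros A1)) n \<zeta> \<xi>s p * LL"
  proof -
    define Y where "Y = Suc K * ((M + 2) * nnz)"
    have e: "Suc K * ((M + 2) * (c * nnz)) = c * Y" for c
      unfolding Y_def by (simp only: mult_ac)
    have "1 * (1 * 1) \<le> Y" unfolding Y_def using nnz(3) by (intro mult_le_mono) auto
    \<comment> \<open>Since \<open>Y\<close> is at least 1, the 8 units spent outside the tests are
      absorbed into the constant.\<close>
    then have "t \<le> 1108 * Y" using t unfolding e by linarith
    then have "t \<le> Suc K * ((M + 2) * (1108 * nnz))" unfolding e .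
    then have "real t \<le> real (Suc K * ((M + 2) * (1108 * nnz)))" by (rule of_nat_mono)
    also have "\<dots> = real (Suc K) * ((real M + 2) * (1108 * real nnz))" by (simp add: algebra_simps)
    also have "\<dots> \<le> (35 * (L\<zeta> * L\<xi>\<^sup>2)) * ((135 * ?X) * (1108 * real nnz))"
    proof (intro mult_mono)
      show "real (Suc K) \<le> 35 * (L\<zeta> * L\<xi>\<^sup>2)"
        using K(1) test_count_bound by (meson Suc_leI of_nat_mono order_trans)
    qed (use MX lg_ge_1[of \<zeta>] in auto)
    also have "\<dots> = 5235300 * (real nnz * sqrt (\<zeta> / \<xi>s) * Lnp * L\<zeta> * L\<xi>\<^sup>2 * LL)"
      by (simp add: algebra_simps)
    \<comment> \<open>The number of tests contributes \<open>L\<xi>\<^sup>2\<close>, which is raised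
      here to the third power of the claimed bound. The constant 5235300 is 35 * 135 * 1108.\<close>
    also have "\<dots> \<le> 6000000 * (real nnz * sqrt (\<zeta> / \<xi>s) * Lnp * L\<zeta> * L\<xi> ^ 3 * LL)"
    proof -
      have l: "1 \<le> lg x" for x by (rule lg_ge_1)
      have l0: "0 \<le> lg x" for x using l[of x] by linarith
      have "L\<xi>\<^sup>2 \<le> L\<xi> ^ 3" using l by (intro power_increasing) auto
      then show ?thesis
        using l0 zeta_ge_1 xi_star_pos
        by (intro mult_mono mult_nonneg_nonneg) (auto simp: loglog_factor_def)
    qed
    finally show ?thesis by (simp add: time_bound_def nnz(1) mult.assoc)
  qed
  show ?thesis
    using exec bounds(5) cert le_xi_star[OF bounds(3) cert] time by (intro exI[of _ t] exI[of _ s]) (simp add: xi)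
qed

end

theorem theorem8:
  shows "\<exists>(ApproxXi :: com) (C :: real) (k :: nat).
    \<forall>(n :: nat) (A0 :: real mat) (b0 :: real vec) (c0 :: real)
      (A1 :: real mat) (b1 :: real vec) (c1 :: real)
      (xs0 :: (nat \<times> nat) list) (xs1 :: (nat \<times> nat) list) (\<zeta> :: real) (p :: real).
      assumption_A n A0 b0 c0 A1 b1 c1 \<and> lists_nonzeros xs0 A0 \<and> lists_nonzeros xs1 A1 \<and>
      zeta_star A0 A1 \<le> \<zeta> \<and> 0 < p \<longrightarrow>
      (\<exists>E \<in> sets random_tape. measure random_tape E \<ge> 1 - p \<and>
        (\<forall>\<omega> \<in> E. \<exists>t s.
          exec \<omega> ApproxXi (input_state n A0 b0 c0 A1 b1 c1 xs0 xs1 \<zeta> p) t s \<and>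
          xi_star A0 A1 / 4 \<le> rvar s ''xi'' \<and> rvar s ''xi'' \<le> xi_star A0 A1 \<and>
          lambda_min (pencil A0 A1 (rvar s ''gamma'')) \<ge> rvar s ''xi'' \<and>
          real t \<le> C * time_bound (card (nonzeros A0) + card (nonzeros A1)) n \<zeta> (xi_star A0 A1) p
                     * loglog_factor n \<zeta> (xi_star A0 A1) p ^ k))"
proof (rule exI[of _ approx_xi], rule exI[of _ 6000000], rule exI[of _ 1], intro allI impI, elim conjE)
  fix n A0 b0 c0 A1 b1 c1 xs0 xs1 and \<zeta> p :: real
  assume A: "assumption_A n A0 b0 c0 A1 b1 c1" "lists_nonzeros xs0 A0" "lists_nonzeros xs1 A1"
    "zeta_star A0 A1 \<le> \<zeta>" "0 < p"
  show "\<exists>E\<in>sets random_tape. 1 - p \<le> measure random_tape E \<and>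
        (\<forall>\<omega>\<in>E. \<exists>t s.
          exec \<omega> approx_xi (input_state n A0 b0 c0 A1 b1 c1 xs0 xs1 \<zeta> p) t s \<and>
          xi_star A0 A1 / 4 \<le> rvar s ''xi'' \<and> rvar s ''xi'' \<le> xi_star A0 A1 \<and>
          rvar s ''xi'' \<le> lambda_min (pencil A0 A1 (rvar s ''gamma'')) \<and>
          real t \<le> 6000000 * time_bound (card (nonzeros A0) + card (nonzeros A1)) n \<zeta> (xi_star A0 A1) p
                     * loglog_factor n \<zeta> (xi_star A0 A1) p ^ 1)"
  proof (cases "p < 1")
    case True
    interpret gtrs_run n A0 A1 b0 b1 c0 c1 \<zeta> p xs0 xs1
      using A True by unfold_locales
    show ?thesis
      using lucky_sets lucky_measure approx_xi_correct by (intro bexI[of _ lucky]) auto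
  next
    case False
    \<comment> \<open>For \<open>p \<ge> 1\<close> the required probability is at most 0, so the
      empty event will do.\<close>
    then show ?thesis by (intro bexI[of _ "{}"]) auto
  qed
qed

end
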